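(* Let $\alpha\in[0,1)$, let $\bar k,\bar\sigma,\bar\eta>0$, and let $(\beta,\delta)$ be an admissible pair of scaling parameters for $\alpha$. Let $\hat\sigma_t$ and $\hat\xi_t$ be the at-the-money implied volatility and the skew term of the corresponding ATS model, and let $\hat\sigma_0=\lim_{t\to0^+}\hat\sigma_t$, $\hat\xi_0=\lim_{t\to0^+}\hat\xi_t$. Then: Case 1: if ($\beta<1$ and $-\min(\tfrac12,\beta)<\delta\le 0$) or $\beta=\delta=0$, then $\hat\sigma_0=0$. Case 2: if $-\min\left(\beta,\frac{1-\beta(1-\alpha)}{\alpha}\right)<\delta<-\tfrac12\max(\beta,1)$ (the lower bound being $-\beta$ when $\alpha=0$), then $\hat\sigma_0=\infty$. Case 3: if $\beta\ge1$, $-\tfrac{\beta}{2}\le\delta\le0$ and $(\beta,\delta)\ne(1,-\tfrac12)$, then $\hat\sigma_0$ is positive and finite and $\hat\xi_0=0$. Case 4: if $\beta<1$ and $\delta=-\tfrac12$, then $\hat\sigma_0$ is positive and finite and $\hat\xi_0=-\sqrt{\pi/2}$. Case 5: if $\beta=1$ and $\delta=-\tfrac12$, then $\hat\sigma_0$ is positive and finite and $\hat\xi_0$ is finite and $\hat\xi_0<0$.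
   Context: Parameters. $\alpha\in[0,1)$; $\bar k,\bar\sigma,\bar\eta>0$; $\beta,\delta\in\mathbb R$. The pair $(\beta,\delta)$ is admissible (for $\alpha$) if either $\beta=\delta=0$, or $0\le\beta\le\frac{1}{1-\alpha/2}$ and $-\min\left(\beta,\frac{1-\beta(1-\alpha)}{\alpha}\right)<\delta\le0$ (for $\alpha=0$ the last condition reads $-\beta<\delta\le0$). Put $k_t=\bar k t^\beta$, $\eta_t=\bar\eta t^\delta$ for $t>0$. Model (ATS). For $t>0$, $S_t$ is a positive random variable with Laplace transform $\mathcal L_t(u)=\mathbb E[e^{-uS_t}]$ given by $\ln\mathcal L_t(u)=\frac{t}{k_t}\frac{1-\alpha}{\alpha}\left\{1-\left(1+\frac{u k_t}{(1-\alpha)t}\right)^{\alpha}\right\}$ if $0<\alpha<1$ and $\ln\mathcal L_t(u)=-\frac{t}{k_t}\ln\left(1+\frac{uk_t}{t}\right)$ if $\alpha=0$. Define $\varphi_t$ by $\varphi_t t=-\ln\mathcal L_t(t\bar\sigma^2\eta_t)$, and $f_t=-\left(\eta_t+\tfrac12\right)\bar\sigma^2 S_t t+\bar\sigma\sqrt{S_t t}\,g+\varphi_t t$, with $g$ standard normal independent of $S_t$ (so $\mathbb E[e^{f_t}]=1$). Implied volatility. $N$ is the standard normal cumulative distribution function. For $t>0$ and $y\in\mathbb R$, $\mathcal I_t(y)>0$ is the unique solution of $\mathbb E[(e^{f_t}-e^{y\sqrt t})^+]=N\left(-\frac{y}{\mathcal I_t(y)}+\frac{\mathcal I_t(y)\sqrt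 t}{2}\right)-e^{y\sqrt t}N\left(-\frac{y}{\mathcal I_t(y)}-\frac{\mathcal I_t(y)\sqrt t}{2}\right)$. Set $\hat\sigma_t=\mathcal I_t(0)$ (at-the-money implied volatility) and $\hat\xi_t=\frac{d\mathcal I_t(y)}{dy}\big|_{y=0}$ (skew term). *)

theory Defs
  imports "HOL-Probability.Probability"
begin

definition ats_k :: "real \<Rightarrow> real \<Rightarrow> real \<Rightarrow> real" where
  "ats_k kbar \<beta> t = kbar * t powr \<beta>"

definition ats_eta :: "real \<Rightarrow> real \<Rightarrow> real \<Rightarrow> real" where
  "ats_eta etabar \<delta> t = etabar * t powr \<delta>"

text \<open>The case \<open>\<alpha> = 0\<close> is separated because of the division by \<open>\<alpha>\<close>.\<close>

definition ats_delta_lower :: "real \<Rightarrow> real \<Rightarrow> real" where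
  "ats_delta_lower \<alpha> \<beta> =
     (if \<alpha> = 0 then - \<beta> else - min \<beta> ((1 - \<beta> * (1 - \<alpha>)) / \<alpha>))"

definition ats_admissible :: "real \<Rightarrow> real \<Rightarrow> real \<Rightarrow> bool" where
  "ats_admissible \<alpha> \<beta> \<delta> \<longleftrightarrow>
     (\<beta> = 0 \<and> \<delta> = 0) \<or>
     (0 \<le> \<beta> \<and> \<beta> \<le> 1 / (1 - \<alpha> / 2) \<and> ats_delta_lower \<alpha> \<beta> < \<delta> \<and> \<delta> \<le> 0)"

definition ats_log_laplace :: "real \<Rightarrow> real \<Rightarrow> real \<Rightarrow> real \<Rightarrow> real \<Rightarrow> real" where
  "ats_log_laplace \<alpha> kbar \<beta> t u =
     (let k = ats_k kbar \<beta> t in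
      if \<alpha> = 0 then - (t / k) * ln (1 + u * k / t)
      else (t / k) * ((1 - \<alpha>) / \<alpha>) * (1 - (1 + u * k / ((1 - \<alpha>) * t)) powr \<alpha>))"

definition laplace_transform :: "'a measure \<Rightarrow> ('a \<Rightarrow> real) \<Rightarrow> real \<Rightarrow> real" where
  "laplace_transform M X u = (\<integral>\<omega>. exp (- u * X \<omega>) \<partial>M)"

text \<open>The Laplace transform is prescribed on the half-line \<open>u \<ge> 0\<close>, which determines
  the law of \<open>S t\<close>. Nothing is required of \<open>S t\<close> for \<open>t \<le> 0\<close>, nor of the joint law
  of \<open>S t\<close> for different \<open>t\<close>.\<close>

locale ats_model = prob_space M
  for M :: "'a measure"
  and \<alpha> kbar \<beta> :: real
  and S :: "real \<Rightarrow> 'a \<Rightarrow> real" and g :: "'a \<Rightarrow> real" +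
  assumes S_measurable: "t > 0 \<Longrightarrow> random_variable borel (S t)"
    and S_positive: "t > 0 \<Longrightarrow> AE \<omega> in M. S t \<omega> > 0"
    and S_laplace: "t > 0 \<Longrightarrow> u \<ge> 0 \<Longrightarrow>
          ln (laplace_transform M (S t) u) = ats_log_laplace \<alpha> kbar \<beta> t u"
    and g_std_normal: "distributed M lborel g (\<lambda>x. ennreal (std_normal_density x))"
    and S_g_indep: "t > 0 \<Longrightarrow> indep_var borel (S t) borel g"

definition ats_phi ::
  "'a measure \<Rightarrow> real \<Rightarrow> real \<Rightarrow> real \<Rightarrow> (real \<Rightarrow> 'a \<Rightarrow> real) \<Rightarrow> real \<Rightarrow> real" where
  "ats_phi M sigmabar etabar \<delta> S t =
     - ln (laplace_transform M (S t) (t * sigmabar\<^sup>2 * ats_eta etabar \<delta> t)) / t"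

definition ats_f ::
  "'a measure \<Rightarrow> real \<Rightarrow> real \<Rightarrow> real \<Rightarrow> (real \<Rightarrow> 'a \<Rightarrow> real) \<Rightarrow> ('a \<Rightarrow> real) \<Rightarrow> real \<Rightarrow> 'a \<Rightarrow> real" where
  "ats_f M sigmabar etabar \<delta> S g t \<omega> =
     - (ats_eta etabar \<delta> t + 1 / 2) * sigmabar\<^sup>2 * S t \<omega> * t
     + sigmabar * sqrt (S t \<omega> * t) * g \<omega>
     + ats_phi M sigmabar etabar \<delta> S t * t"

definition std_normal_cdf :: "real \<Rightarrow> real" where
  "std_normal_cdf = cdf std_normal_distribution"

text \<open>Black's formula with unit forward, log-strike \<open>y * sqrt t\<close> and volatility \<open>s\<close>.\<close>

definition black_call :: "real \<Rightarrow> real \<Rightarrow> real \<Rightarrow> real" where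
  "black_call t y s =
     std_normal_cdf (- y / s + s * sqrt t / 2)
     - exp (y * sqrt t) * std_normal_cdf (- y / s - s * sqrt t / 2)"

definition implied_vol :: "'a measure \<Rightarrow> (real \<Rightarrow> 'a \<Rightarrow> real) \<Rightarrow> real \<Rightarrow> real \<Rightarrow> real" where
  "implied_vol M f t y =
     (THE s. s > 0 \<and>
        (\<integral>\<omega>. max 0 (exp (f t \<omega>) - exp (y * sqrt t)) \<partial>M) = black_call t y s)"

definition atm_vol :: "'a measure \<Rightarrow> (real \<Rightarrow> 'a \<Rightarrow> real) \<Rightarrow> real \<Rightarrow> real" where
  "atm_vol M f t = implied_vol M f t 0"

definition skew_term :: "'a measure \<Rightarrow> (real \<Rightarrow> 'a \<Rightarrow> real) \<Rightarrow> real \<Rightarrow> real" where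
  "skew_term M f t = deriv (\<lambda>y. implied_vol M f t y) 0"

end

theory Submission
  imports Defs "HOL-Complex_Analysis.Complex_Analysis"
begin

text \<open>Conditionally on \<open>S t = s\<close>, the variable \<open>f t / sqrt t\<close> is normal, so its law is a normal
  mean-variance mixture over the law of \<open>S t\<close>, and its characteristic function is the Laplace
  transform of \<open>S t\<close> continued to the right half-plane.

  The at-the-money price \<open>C t\<close> determines the volatility through \<open>2 N (\<sigma> sqrt t / 2) - 1 = C t\<close>, hence
  \<open>\<sigma> \<rightarrow> sqrt (2 pi) l\<close> if \<open>C t / sqrt t \<rightarrow> l\<close>; implicit differentiation of the pricing identity
  expresses the skew through \<open>P (f t > 0)\<close>. For \<open>\<beta> < 1\<close> the subordinator collapses to \<open>0\<close> in
  probability and \<open>C t\<close> is squeezed between elementary bounds; for \<open>\<beta> \<ge> 1\<close> Levy's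
  continuity theorem gives a limit law with enough moments to pass to the limit in the put price
  \<open>E (1 - exp (f t))\<^sup>+\<close>, which equals \<open>C t\<close> by put-call parity.

  The sign of the limiting skew for \<open>\<beta> = 1\<close>, \<open>\<delta> = - 1/2\<close> requires a mean-zero mixture to have positive
  median. Writing its characteristic function as \<open>r exp (i \<theta>)\<close>, the difference
  \<open>P (Y > 0) - P (Y < 0)\<close> is \<open>2 / pi\<close> times the integral of \<open>r sin \<theta> / u\<close>, and this
  oscillating integral is positive because \<open>r\<close> decreases while \<open>u \<theta>'(u)\<close> increases.\<close>

section \<open>The normal distribution and implied volatility\<close>

text \<open>Everything rests on one decomposition: \<open>f t / sqrt t\<close> equals \<open>(h t -
  x t) / sqrt t + (x t / sqrt t) * (1 - S) - \<sigma>\<^sup>2 * sqrt t / 2 * S + \<sigma> * sqrt S *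
  g\<close>, where S has mean one and variance \<open>k t = kbar * t powr (\<beta> - 1)\<close>. For
  \<beta> < 1 the factor 1 - S tends to 1, so the second term has size t^(1/2 + \<delta>); for
  \<beta> at least 1 its standard deviation has order t^(\<beta>/2 + \<delta>). The signs of these
  two exponents separate the cases. The first term stems from the concavity of the Laplace exponent;
  in the exploding case it is dominated because admissibility yields \<beta> + \<delta> > 0 and, for
  \<beta> at least 1, (\<beta> + 1)/2 + \<delta> > 0. Weak limits are taken in the put because its
  payoff is bounded, so that second moments control the error. Wherever a limiting skew is claimed
  it is sqrt (2 pi) (1/2 - p) with p the limit of P (f t > 0): p is 1/2 for a symmetric limit law, 1
  for a positive point mass, and above 1/2 in the critical case \<beta> = 1, \<delta> =
  -1/2.\<close>

lemma std_normal_measure_Icc: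
  assumes "a \<le> b"
  shows "measure std_normal_distribution {a..b} = integral {a..b} std_normal_density"
proof -
  interpret real_distribution std_normal_distribution
    by (rule real_dist_normal_dist)
  have "measure std_normal_distribution {a..b} = (\<integral>x. indicator {a..b} x \<partial>std_normal_distribution)"
    by simp
  also have "\<dots> = (\<integral>x. std_normal_density x * indicator {a..b} x \<partial>lborel)"
    by (subst integral_density) auto
  also have "\<dots> = set_lebesgue_integral lborel {a..b} std_normal_density"
    by (simp add: set_lebesgue_integral_def mult.commute)
  also have "\<dots> = integral {a..b} std_normal_density"
    by (intro set_borel_integral_eq_integral(2) borel_integrable_atLeastAtMost')
       (auto simp: std_normal_density_def intro!: continuous_intros)
  finally show ?thesis .
qed

lemma std_normal_cdf_diff:
  assumes "a \<le> b"
  shows "std_normal_cdf b = std_normal_cdf a + integral {a..b} std_normal_density"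
proof -
  interpret real_distribution std_normal_distribution
    by (rule real_dist_normal_dist)
  have s: "measure std_normal_distribution {a} = 0"
    using std_normal_measure_Icc[of a a] by simp
  show ?thesis
  proof (cases "a = b")
    case True then show ?thesis by simp
  next
    case False
    then have "std_normal_cdf b - std_normal_cdf a = measure std_normal_distribution {a<..b}"
      unfolding std_normal_cdf_def using assms by (subst cdf_diff_eq) auto
    also have "{a<..b} = {a..b} - {a}" by auto
    also have "measure std_normal_distribution ({a..b} - {a}) = measure std_normal_distribution {a..b}"
      using assms s by (subst finite_measure_Diff) auto
    finally show ?thesis using std_normal_measure_Icc[OF assms] by simp
  qed
qed

lemma std_normal_cdf_has_derivative:
  "(std_normal_cdf has_real_derivative std_normal_density x) (at x)"
proof -
  have "((\<lambda>u. integral {x-1..u} std_normal_density) has_real_derivative std_normal_density x)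
      (at x within {x-1..x+1})"
    by (intro integral_has_real_derivative)
       (auto simp: std_normal_density_def intro!: continuous_intros)
  then have "((\<lambda>u. std_normal_cdf (x-1) + integral {x-1..u} std_normal_density)
      has_real_derivative std_normal_density x) (at x)"
    by (subst (asm) at_within_interior) (auto intro!: derivative_eq_intros)
  then show ?thesis
  proof (rule has_field_derivative_transform_within_open[where S="{x-1<..<x+1}"])
    show "std_normal_cdf (x - 1) + integral {x - 1..u} std_normal_density = std_normal_cdf u"
      if "u \<in> {x-1<..<x+1}" for u using std_normal_cdf_diff[of "x-1" u] that by simp
  qed auto
qed

lemma std_normal_cdf_derivative_intros[derivative_intros]:
  assumes "(f has_real_derivative f') (at x within A)"
  shows "((\<lambda>x. std_normal_cdf (f x)) has_real_derivative std_normal_density (f x) * f') (at x within A)"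
  using DERIV_chain2[OF std_normal_cdf_has_derivative assms] by simp

lemma std_normal_density_minus [simp]: "std_normal_density (- x) = std_normal_density x"
  by (simp add: std_normal_density_def)

lemma isCont_std_normal_density [simp]: "isCont std_normal_density x"
  unfolding std_normal_density_def by (intro continuous_intros) auto

lemma continuous_on_std_normal_cdf [continuous_intros]:
  "continuous_on A f \<Longrightarrow> continuous_on A (\<lambda>x. std_normal_cdf (f x))"
  by (rule continuous_on_compose2[OF DERIV_continuous_on, of UNIV, OF std_normal_cdf_has_derivative]) auto

lemma isCont_std_normal_cdf: "isCont std_normal_cdf x"
  by (rule DERIV_isCont[OF std_normal_cdf_has_derivative])

lemma std_normal_cdf_strict_mono: "x < y \<Longrightarrow> std_normal_cdf x < std_normal_cdf y"
  by (rule DERIV_pos_imp_increasing[of x y std_normal_cdf])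
     (auto intro!: exI[of _ "std_normal_density _"] std_normal_cdf_has_derivative normal_density_pos)

lemma std_normal_cdf_less_iff [simp]: "std_normal_cdf x < std_normal_cdf y \<longleftrightarrow> x < y"
  using std_normal_cdf_strict_mono[of x y] std_normal_cdf_strict_mono[of y x]
  by (cases x y rule: linorder_cases) auto

lemma std_normal_cdf_at_top: "(std_normal_cdf \<longlongrightarrow> 1) at_top"
  unfolding std_normal_cdf_def
  using real_distribution.cdf_lim_at_top_prob[OF real_dist_normal_dist] .

lemma std_normal_cdf_at_bot: "(std_normal_cdf \<longlongrightarrow> 0) at_bot"
proof -
  interpret real_distribution std_normal_distribution
    by (rule real_dist_normal_dist)
  show ?thesis unfolding std_normal_cdf_def by (rule cdf_lim_at_bot)
qed

text \<open>Since the density is even, N(x) + N(-x) has derivative zero; the constant is read off at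
  infinity.\<close>

lemma std_normal_cdf_minus: "std_normal_cdf (- x) = 1 - std_normal_cdf x"
proof -
  define F where "F = (\<lambda>x. std_normal_cdf x + std_normal_cdf (- x))"
  have "(F has_real_derivative 0) (at x)" for x
    unfolding F_def by (auto intro!: derivative_eq_intros)
  then have c: "F y = F 0" for y
    by (metis DERIV_isconst_all)
  have "(F \<longlongrightarrow> 1 + 0) at_top"
    unfolding F_def
    by (intro tendsto_add std_normal_cdf_at_top
        filterlim_compose[OF std_normal_cdf_at_bot filterlim_uminus_at_bot_at_top])
  moreover have "F = (\<lambda>_. F 0)" using c by auto
  ultimately have "F 0 = 1"
    by (metis add_0_right tendsto_const_iff trivial_limit_at_top_linorder)
  then show ?thesis using c[of x] by (simp add: F_def)
qed

lemma std_normal_cdf_0 [simp]: "std_normal_cdf 0 = 1 / 2"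
  using std_normal_cdf_minus[of 0] by simp

text \<open>Mean value theorem with the maximum 1 / sqrt (2 pi) of the density. It turns a lower
  bound for a price into one for the volatility when the price over \<open>sqrt t\<close> has no
  finite limit.\<close>

lemma std_normal_cdf_le: 
  assumes "0 \<le> x" shows "std_normal_cdf x - 1 / 2 \<le> x / sqrt (2 * pi)"
proof (cases "x = 0")
  case False
  then have x: "0 < x" using assms by simp
  obtain z where "std_normal_cdf x - std_normal_cdf 0 = (x - 0) * std_normal_density z"
    using MVT2[OF x, of std_normal_cdf std_normal_density] std_normal_cdf_has_derivative by auto
  moreover have "std_normal_density z \<le> 1 / sqrt (2 * pi)"
    unfolding std_normal_density_def by (simp add: divide_right_mono)
  ultimately show ?thesis
    using mult_left_mono[of "std_normal_density z" "1 / sqrt (2 * pi)" x] x by simp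
qed auto

section \<open>Black's formula: derivatives in volatility and log-strike\<close>

lemma black_call_has_derivative_vol:
  assumes "s > 0" "t > 0"
  shows "((\<lambda>s. black_call t y s) has_real_derivative
           sqrt t * std_normal_density (- y / s + s * sqrt t / 2)) (at s)"
proof -
  \<comment> \<open>The two exponents differ by exactly \<open>y * sqrt t\<close>. Hence both
    density terms carry the same factor, the \<open>y / s^2\<close> contributions cancel and the
    usual vega remains.\<close>
  have e: "exp (y * sqrt t) * std_normal_density (- y / s - s * sqrt t / 2)
      = std_normal_density (- y / s + s * sqrt t / 2)"
    using assms unfolding std_normal_density_def
    by (simp add: mult.left_commute exp_add[symmetric] power2_eq_square field_simps)
  have "((\<lambda>s. black_call t y s) has_real_derivative
        std_normal_density (- y / s + s * sqrt t / 2) * (y / s^2 + sqrt t / 2)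
        - (exp (y * sqrt t) * std_normal_density (- y / s - s * sqrt t / 2)) * (y / s^2 - sqrt t / 2)) (at s)"
    unfolding black_call_def using assms
    by (auto intro!: derivative_eq_intros simp: power2_eq_square)
  then show ?thesis unfolding e by (simp add: algebra_simps)
qed

lemma black_call_strict_mono:
  assumes "0 < s" "s < s'" "t > 0"
  shows "black_call t y s < black_call t y s'"
  by (rule DERIV_pos_imp_increasing[OF assms(2)])
     (use assms in \<open>auto intro!: exI black_call_has_derivative_vol
        mult_pos_pos normal_density_pos\<close>)

text \<open>At the money the two arguments of the distribution function are opposite, so by symmetry
  of the density the contributions of \<open>- y / s\<close> cancel.\<close>

lemma black_call_has_derivative_strike:
  assumes "s > 0" 
  shows "((\<lambda>y. black_call t y s) has_real_derivative
           - sqrt t * std_normal_cdf (- s * sqrt t / 2)) (at 0)"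
proof -
  have "((\<lambda>y. black_call t y s) has_real_derivative
     std_normal_density (s * sqrt t / 2) * (- 1 / s) - (sqrt t * std_normal_cdf (- (s * sqrt t / 2))
       + std_normal_density (- (s * sqrt t / 2)) * (- 1 / s))) (at 0)"
    unfolding black_call_def using assms
    by (auto intro!: derivative_eq_intros)
  then show ?thesis by (simp add: field_simps)
qed

lemma isCont_black_call_strike:
  assumes "s > 0" shows "isCont (\<lambda>y. black_call t y s) y"
  unfolding black_call_def using assms
  by (intro continuous_intros isCont_o2[OF _ isCont_std_normal_cdf]) auto

lemma black_call_0: "black_call t 0 s = 2 * std_normal_cdf (s * sqrt t / 2) - 1"
  using std_normal_cdf_minus[of "s * sqrt t / 2"] by (simp add: black_call_def)

lemma black_call_0_surj:
  assumes "0 < p" "p < 1" "t > 0"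
  obtains s where "s > 0" "black_call t 0 s = p"
proof -
  have "eventually (\<lambda>x. (1 + p) / 2 < std_normal_cdf x) at_top"
    using std_normal_cdf_at_top assms by (intro order_tendstoD) auto
  then obtain b where b: "b > 0" "(1 + p) / 2 < std_normal_cdf b"
    using eventually_gt_at_top[of "0::real"]
    by (metis (mono_tags, lifting) eventually_conj eventually_happens' trivial_limit_at_top_linorder)
  have "\<exists>x\<ge>0. x \<le> b \<and> std_normal_cdf x = (1 + p) / 2"
    using b assms by (intro IVT') (auto intro!: continuous_intros)
  then obtain x where x: "x \<ge> 0" "std_normal_cdf x = (1 + p) / 2" by auto
  have "x \<noteq> 0" using x assms by auto
  show ?thesis
    by (rule that[of "2 * x / sqrt t"]) (use x assms \<open>x \<noteq> 0\<close> in \<open>auto simp: black_call_0 field_simps\<close>)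
qed

text \<open>Separates the implicit differentiation from the model. The price is required to lie in
  (0,1) and to be differentiable at y = 0 only; the implied volatility then exists at 0 and, by
  continuity, near 0, which is all that a derivative at 0 sees.\<close>

locale smile =
  fixes P :: "real \<Rightarrow> real" and t p :: real and I :: "real \<Rightarrow> real"
  assumes t_pos: "t > 0"
    and price_pos: "0 < P 0" and price_less_1: "P 0 < 1"
    and price_deriv: "(P has_real_derivative p) (at 0)"
    and I_def: "\<And>y. I y = (THE s. s > 0 \<and> P y = black_call t y s)"
begin

lemma I_eqI: "s > 0 \<Longrightarrow> P y = black_call t y s \<Longrightarrow> I y = s"
  unfolding I_def using t_pos
  by (intro the_equality) (auto, metis black_call_strict_mono linorder_neqE_linordered_idom order_less_irrefl)

lemma I_0: "I 0 > 0" "black_call t 0 (I 0) = P 0"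
proof -
  obtain s where "s > 0" "black_call t 0 s = P 0"
    using black_call_0_surj[OF price_pos price_less_1 t_pos] .
  then show "I 0 > 0" "black_call t 0 (I 0) = P 0" using I_eqI[of s 0] by auto
qed

text \<open>At y = 0 the price lies strictly between the Black prices for the volatilities
  \<open>I 0 - \<epsilon>\<close> and \<open>I 0 + \<epsilon>\<close>. All three are continuous in
  y, so the order persists near 0 and the intermediate value theorem in the volatility locates
  \<open>I y\<close>.\<close>

lemma I_near_0:
  assumes "\<epsilon> > 0" "\<epsilon> < I 0"
  shows "eventually (\<lambda>y. I 0 - \<epsilon> \<le> I y \<and> I y \<le> I 0 + \<epsilon> \<and> P y = black_call t y (I y)) (nhds 0)"
proof -
  let ?l = "I 0 - \<epsilon>" and ?u = "I 0 + \<epsilon>"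
  have cP: "isCont P 0" by (rule DERIV_isCont[OF price_deriv])
  have near: "eventually (\<lambda>y. f y > 0) (nhds 0)" if "isCont f 0" "f 0 > 0" for f :: "real \<Rightarrow> real"
    using that order_tendstoD(1) unfolding isCont_def tendsto_at_iff_tendsto_nhds by blast
  have "eventually (\<lambda>y. P y - black_call t y ?l > 0) (nhds 0)"
      "eventually (\<lambda>y. black_call t y ?u - P y > 0) (nhds 0)"
    using assms I_0 black_call_strict_mono[of ?l "I 0" t 0] black_call_strict_mono[of "I 0" ?u t 0] t_pos
    by (auto intro!: near[of "\<lambda>y. P y - black_call t y ?l"] near[of "\<lambda>y. black_call t y ?u - P y"]
        continuous_intros cP isCont_black_call_strike simp del: less_diff_eq diff_gt_0_iff_gt)
  then show ?thesis
  proof eventually_elim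
    case (elim y)
    have "\<exists>s\<ge>?l. s \<le> ?u \<and> black_call t y s = P y"
    proof (rule IVT')
      show "continuous_on {?l..?u} (\<lambda>s. black_call t y s)"
        using assms t_pos
        by (auto intro!: continuous_at_imp_continuous_on DERIV_isCont[OF black_call_has_derivative_vol])
    qed (use elim assms in auto)
    then obtain s where "s \<ge> ?l" "s \<le> ?u" "black_call t y s = P y" by auto
    moreover from this have "I y = s" using assms by (intro I_eqI) auto
    ultimately show ?case by auto
  qed
qed

text \<open>\<open>P y - P 0\<close> is split into the change of Black's formula in the volatility
  at fixed y and its change in the log-strike at fixed volatility \<open>I 0\<close>. The first part
  is a vega times \<open>I y - I 0\<close> by the mean value theorem, so no joint differentiability
  enters.\<close>

lemma I_has_derivative:
  "(I has_real_derivative (p + sqrt t * std_normal_cdf (- I 0 * sqrt t / 2))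
     / (sqrt t * std_normal_density (I 0 * sqrt t / 2))) (at 0)"
proof -
  have cI: "isCont I 0"
    unfolding isCont_def
  proof (rule tendstoI)
    fix e :: real assume e: "e > 0"
    define \<epsilon> where "\<epsilon> = min (e / 2) (I 0 / 2)"
    have "\<epsilon> > 0" "\<epsilon> < I 0" "\<epsilon> < e" using e I_0 by (auto simp: \<epsilon>_def)
    from I_near_0[OF this(1,2)] \<open>\<epsilon> < e\<close> have "eventually (\<lambda>y. dist (I y) (I 0) < e) (nhds 0)"
      by (elim eventually_mono) (auto simp: dist_real_def)
    then show "eventually (\<lambda>y. dist (I y) (I 0) < e) (at 0)"
      by (simp add: eventually_nhds_conv_at)
  qed
  define D where "D y s = sqrt t * std_normal_density (- y / s + s * sqrt t / 2)" for y s
  have "\<exists>s. (s \<ge> min (I 0) (I y) \<and> s \<le> max (I 0) (I y)) \<and>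
      black_call t y (I y) - black_call t y (I 0) = D y s * (I y - I 0)" if "I y > 0" for y
  proof -
    have d: "((\<lambda>s. black_call t y s) has_real_derivative D y s) (at s)" if "s > 0" for s
      unfolding D_def by (rule black_call_has_derivative_vol[OF that t_pos])
    consider "I y < I 0" | "I y = I 0" | "I 0 < I y" by linarith
    then show ?thesis
    proof cases
      case 1
      then obtain z where "z > I y" "z < I 0"
        "black_call t y (I 0) - black_call t y (I y) = (I 0 - I y) * D y z"
        using MVT2[OF 1, of "\<lambda>s. black_call t y s" "D y"] d \<open>I y > 0\<close> by auto
      then show ?thesis by (intro exI[of _ z]) (auto simp: algebra_simps)
    next
      case 3
      then obtain z where "z > I 0" "z < I y"
        "black_call t y (I y) - black_call t y (I 0) = (I y - I 0) * D y z"
        using MVT2[OF 3, of "\<lambda>s. black_call t y s" "D y"] d I_0 by auto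
      then show ?thesis by (intro exI[of _ z]) (auto simp: algebra_simps)
    qed (auto intro!: exI[of _ "I 0"])
  qed
  \<comment> \<open>The intermediate volatilities form a function \<open>m\<close> squeezed between
    \<open>I 0\<close> and \<open>I y\<close>; it tends to \<open>I 0\<close>, and continuity of the
    vega \<open>D\<close> gives the limit of the denominator.\<close>
  then obtain m where m: "\<And>y. I y > 0 \<Longrightarrow> m y \<ge> min (I 0) (I y) \<and> m y \<le> max (I 0) (I y) \<and>
      black_call t y (I y) - black_call t y (I 0) = D y (m y) * (I y - I 0)"
    by metis
  have near: "eventually (\<lambda>y. I y > 0 \<and> P y = black_call t y (I y)) (at 0)"
    using I_near_0[of "I 0 / 2"] I_0
    by (auto simp: eventually_nhds_conv_at elim!: eventually_mono)
  have mlim: "(m \<longlongrightarrow> I 0) (at 0)"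
  proof (rule tendsto_sandwich)
    show "((\<lambda>y. min (I 0) (I y)) \<longlongrightarrow> I 0) (at 0)" "((\<lambda>y. max (I 0) (I y)) \<longlongrightarrow> I 0) (at 0)"
      using cI tendsto_min[of "\<lambda>_. I 0" "I 0" "at 0" I "I 0"] tendsto_max[of "\<lambda>_. I 0" "I 0" "at 0" I "I 0"]
      by (auto simp: isCont_def)
  qed (use near m in \<open>auto elim!: eventually_mono\<close>)
  have Dlim: "((\<lambda>y. D y (m y)) \<longlongrightarrow> sqrt t * std_normal_density (I 0 * sqrt t / 2)) (at 0)"
  proof -
    have "((\<lambda>y. - y / m y + m y * sqrt t / 2) \<longlongrightarrow> - 0 / I 0 + I 0 * sqrt t / 2) (at 0)"
      using I_0 by (intro tendsto_intros mlim) auto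
    then show ?thesis unfolding D_def
      by (intro tendsto_mult tendsto_const isCont_tendsto_compose[OF isCont_std_normal_density]) simp
  qed
  have pos: "sqrt t * std_normal_density (I 0 * sqrt t / 2) > 0"
    using t_pos by (simp add: normal_density_pos)
  have "((\<lambda>y. ((P y - P 0) / (y - 0) - (black_call t y (I 0) - black_call t 0 (I 0)) / (y - 0)) / D y (m y))
     \<longlongrightarrow> (p - - sqrt t * std_normal_cdf (- I 0 * sqrt t / 2)) / (sqrt t * std_normal_density (I 0 * sqrt t / 2))) (at 0)"
    using pos price_deriv[unfolded DERIV_def] black_call_has_derivative_strike[OF I_0(1), of t]
    by (intro tendsto_divide tendsto_diff Dlim)
       (auto simp: has_field_derivative_iff simp del: minus_mult_left)
  moreover have "eventually (\<lambda>y. ((P y - P 0) / (y - 0) - (black_call t y (I 0) - black_call t 0 (I 0)) / (y - 0)) / D y (m y)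
      = (I y - I 0) / (y - 0)) (at 0)"
    using near
  proof eventually_elim
    case (elim y)
    have "D y (m y) > 0" using t_pos by (simp add: D_def normal_density_pos)
    moreover have "P y - P 0 - (black_call t y (I 0) - black_call t 0 (I 0)) = D y (m y) * (I y - I 0)"
      using m[of y] elim I_0 by simp
    ultimately show ?case
      by (simp add: diff_divide_distrib[symmetric])
  qed
  ultimately show ?thesis
    unfolding has_field_derivative_iff by (auto dest: Lim_transform_eventually)
qed

end

section \<open>Normal mean-variance mixtures\<close>

text \<open>Completing the square: tilting the standard density by exp (p x) gives exp (p^2 / 2)
  times the normal density with mean p.\<close>

lemma nn_integral_std_normal_exp:
  "(\<integral>\<^sup>+x. ennreal (exp (p * x)) \<partial>std_normal_distribution) = ennreal (exp (p\<^sup>2 / 2))"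
proof -
  interpret N: prob_space "density lborel (normal_density p 1)"
    by (rule prob_space_normal_density) simp
  have "(\<integral>\<^sup>+x. ennreal (exp (p * x)) \<partial>std_normal_distribution)
      = (\<integral>\<^sup>+x. ennreal (std_normal_density x * exp (p * x)) \<partial>lborel)"
    by (subst nn_integral_density) (auto simp: ennreal_mult)
  also have "(\<lambda>x. std_normal_density x * exp (p * x)) = (\<lambda>x. exp (p\<^sup>2 / 2) * normal_density p 1 x)"
    unfolding normal_density_def
    by (auto simp: fun_eq_iff exp_add[symmetric] power2_eq_square field_simps)
  also have "(\<integral>\<^sup>+x. ennreal (exp (p\<^sup>2 / 2) * normal_density p 1 x) \<partial>lborel)
      = ennreal (exp (p\<^sup>2 / 2)) * (\<integral>\<^sup>+x. ennreal (normal_density p 1 x) \<partial>lborel)"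
    by (simp add: ennreal_mult nn_integral_cmult)
  also have "(\<integral>\<^sup>+x. ennreal (normal_density p 1 x) \<partial>lborel) = 1"
    using N.emeasure_space_1 by (simp add: emeasure_density)
  finally show ?thesis by simp
qed

lemma has_bochner_integral_std_normal_exp:
  "has_bochner_integral std_normal_distribution (\<lambda>x. exp (p * x)) (exp (p\<^sup>2 / 2))"
  by (rule has_bochner_integral_nn_integral) (auto simp: nn_integral_std_normal_exp)

lemma std_normal_moments:
  "integrable std_normal_distribution (\<lambda>x. x)" "(\<integral>x. x \<partial>std_normal_distribution) = 0"
  "integrable std_normal_distribution (\<lambda>x. x\<^sup>2)" "(\<integral>x. x\<^sup>2 \<partial>std_normal_distribution) = 1"
  using integrable_std_normal_distribution_moment[of 1] integrable_std_normal_distribution_moment[of 2]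
    std_normal_distribution_even_moments[of 1] integral_std_normal_distribution_moment_odd[of 1]
  by (auto simp: fact_numeral)

definition mixlaw :: "real measure \<Rightarrow> real \<Rightarrow> real \<Rightarrow> real \<Rightarrow> real measure" where
  "mixlaw \<mu> a b c =
     distr (\<mu> \<Otimes>\<^sub>M std_normal_distribution) borel (\<lambda>(s, x). a + b * s + c * sqrt s * x)"

definition claplace :: "real measure \<Rightarrow> complex \<Rightarrow> complex" where
  "claplace \<mu> z = (\<integral>s. exp (- z * of_real s) \<partial>\<mu>)"

locale mixing = real_distribution \<mu> for \<mu> :: "real measure" +
  assumes AE_pos: "AE s in \<mu>. s > 0"
begin

lemma bounded_integrable:
  fixes f :: "real \<Rightarrow> 'c :: {banach, second_countable_topology}"
  shows "f \<in> borel_measurable \<mu> \<Longrightarrow> AE s in \<mu>. norm (f s) \<le> B \<Longrightarrow> integrable \<mu> f"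
  by (rule integrable_const_bound)

lemma prob_UNIV: "measure \<mu> UNIV = 1"
  using prob_space by simp

sublocale pair_prob_space \<mu> std_normal_distribution
proof -
  interpret N: prob_space std_normal_distribution
    using real_dist_normal_dist by (simp add: real_distribution_def)
  show "pair_prob_space \<mu> std_normal_distribution" by unfold_locales
qed

lemma mixlaw_measurable [measurable]:
  "(\<lambda>(s, x). a + b * s + c * sqrt s * x) \<in> borel_measurable (\<mu> \<Otimes>\<^sub>M std_normal_distribution)"
  by measurable

lemma real_distribution_mixlaw: "real_distribution (mixlaw \<mu> a b c)"
  unfolding mixlaw_def by (rule P.real_distribution_distr) measurable

lemma mixlaw_integral:
  fixes F :: "real \<Rightarrow> 'c :: {banach, second_countable_topology}"
  assumes "integrable (mixlaw \<mu> a b c) F"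
  shows "integrable \<mu> (\<lambda>s. \<integral>x. F (a + b * s + c * sqrt s * x) \<partial>std_normal_distribution)"
    and "integral\<^sup>L (mixlaw \<mu> a b c) F
      = (\<integral>s. (\<integral>x. F (a + b * s + c * sqrt s * x) \<partial>std_normal_distribution) \<partial>\<mu>)"
proof -
  have [measurable]: "F \<in> borel_measurable borel"
    using borel_measurable_integrable[OF assms] by (simp add: mixlaw_def)
  have "integrable (\<mu> \<Otimes>\<^sub>M std_normal_distribution) (\<lambda>z. F (case z of (s, x) \<Rightarrow> a + b * s + c * sqrt s * x))"
    using assms unfolding mixlaw_def by (subst (asm) integrable_distr_eq) auto
  from integrable_fst'[OF this] integral_fst'[OF this]
  show "integrable \<mu> (\<lambda>s. \<integral>x. F (a + b * s + c * sqrt s * x) \<partial>std_normal_distribution)"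
    "integral\<^sup>L (mixlaw \<mu> a b c) F
      = (\<integral>s. (\<integral>x. F (a + b * s + c * sqrt s * x) \<partial>std_normal_distribution) \<partial>\<mu>)"
    unfolding mixlaw_def by (auto simp: integral_distr)
qed

text \<open>The Tonelli counterpart of \<open>mixlaw_integral\<close>: for nonnegative F,
  integrability is not assumed but deduced from that of the conditional expectation
  \<open>G\<close>.\<close>

lemma mixlaw_integrable:
  fixes F :: "real \<Rightarrow> real"
  assumes [measurable]: "F \<in> borel_measurable borel"
    and "AE s in \<mu>. has_bochner_integral std_normal_distribution (\<lambda>x. F (a + b * s + c * sqrt s * x)) (G s)"
    and "integrable \<mu> G" "\<And>y. F y \<ge> 0"
  shows "integrable (mixlaw \<mu> a b c) F" "integral\<^sup>L (mixlaw \<mu> a b c) F = integral\<^sup>L \<mu> G"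
proof -
  have G: "AE s in \<mu>. (\<integral>x. F (a + b * s + c * sqrt s * x) \<partial>std_normal_distribution) = G s"
    using assms(2) by eventually_elim (rule has_bochner_integral_integral_eq)
  have [measurable]: "G \<in> borel_measurable \<mu>" using assms(3) by auto
  have "integrable (\<mu> \<Otimes>\<^sub>M std_normal_distribution) (\<lambda>z. F (case z of (s, x) \<Rightarrow> a + b * s + c * sqrt s * x))"
  proof (rule Fubini_integrable)
    show "AE s in \<mu>. integrable std_normal_distribution
        (\<lambda>y. F (case (s, y) of (s, x) \<Rightarrow> a + b * s + c * sqrt s * x))"
      using assms(2) by eventually_elim (auto simp: has_bochner_integral_iff)
    show "integrable \<mu> (\<lambda>s. \<integral>y. norm (F (case (s, y) of (s, x) \<Rightarrow> a + b * s + c * sqrt s * x)) \<partial>std_normal_distribution)"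
      by (rule integrable_cong_AE_imp[OF assms(3)]) (use G assms(4) in auto)
  qed measurable
  then show *: "integrable (mixlaw \<mu> a b c) F"
    unfolding mixlaw_def by (subst integrable_distr_eq) auto
  show "integral\<^sup>L (mixlaw \<mu> a b c) F = integral\<^sup>L \<mu> G"
    unfolding mixlaw_integral(2)[OF *] by (rule integral_cong_AE) (use G in auto)
qed

text \<open>Given s the variable is Gaussian with mean a + b s and variance c^2 s, so its
  conditional characteristic function is exp (i u a) exp (- z s) with z = u^2 c^2 / 2 - i u b;
  integrating over s gives the Laplace transform at z.\<close>

lemma char_mixlaw:
  "char (mixlaw \<mu> a b c) u = iexp (u * a) * claplace \<mu> (Complex (u\<^sup>2 * c\<^sup>2 / 2) (- u * b))"
proof -
  interpret Q: real_distribution "mixlaw \<mu> a b c" by (rule real_distribution_mixlaw)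
  have i: "integrable (mixlaw \<mu> a b c) (\<lambda>y. iexp (u * y))"
    by (rule Q.integrable_iexp) auto
  have "char (mixlaw \<mu> a b c) u
      = (\<integral>s. (\<integral>x. iexp (u * (a + b * s + c * sqrt s * x)) \<partial>std_normal_distribution) \<partial>\<mu>)"
    unfolding char_def by (rule mixlaw_integral(2)[OF i])
  also have "\<dots> = (\<integral>s. iexp (u * a) * exp (- Complex (u\<^sup>2 * c\<^sup>2 / 2) (- u * b) * of_real s) \<partial>\<mu>)"
  proof (rule integral_cong_AE)
    show "AE s in \<mu>. (\<integral>x. iexp (u * (a + b * s + c * sqrt s * x)) \<partial>std_normal_distribution)
        = iexp (u * a) * exp (- Complex (u\<^sup>2 * c\<^sup>2 / 2) (- u * b) * of_real s)"
      using AE_pos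
    proof eventually_elim
      case (elim s)
      have "(\<integral>x. iexp (u * (a + b * s + c * sqrt s * x)) \<partial>std_normal_distribution)
          = (\<integral>x. iexp (u * (a + b * s)) * iexp ((u * c * sqrt s) * x) \<partial>std_normal_distribution)"
        by (intro Bochner_Integration.integral_cong) (auto simp: exp_add[symmetric] algebra_simps)
      also have "\<dots> = iexp (u * (a + b * s)) * char std_normal_distribution (u * c * sqrt s)"
        unfolding char_def by (rule integral_mult_right_zero)
      also have "char std_normal_distribution (u * c * sqrt s) = of_real (exp (- (u\<^sup>2 * c\<^sup>2 / 2) * s))"
        using elim by (subst char_std_normal_distribution) (simp add: power_mult_distrib)
      also have "iexp (u * (a + b * s)) * of_real (exp (- (u\<^sup>2 * c\<^sup>2 / 2) * s))
          = iexp (u * a) * exp (- Complex (u\<^sup>2 * c\<^sup>2 / 2) (- u * b) * of_real s)"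
        unfolding exp_of_real[symmetric] exp_add[symmetric]
        by (rule arg_cong[where f=exp]) (simp add: complex_eq_iff algebra_simps)
      finally show ?case .
    qed
  qed (auto simp: mixlaw_integral(1)[OF i, THEN borel_measurable_integrable])
  also have "\<dots> = iexp (u * a) * claplace \<mu> (Complex (u\<^sup>2 * c\<^sup>2 / 2) (- u * b))"
    unfolding claplace_def by (rule integral_mult_right_zero)
  finally show ?thesis .
qed

lemma conditional_exp:
  assumes "s > 0"
  shows "has_bochner_integral std_normal_distribution (\<lambda>x. exp (\<tau> * (a + b * s + c * sqrt s * x)))
    (exp (\<tau> * (a + b * s) + \<tau>\<^sup>2 * c\<^sup>2 * s / 2))"
proof -
  have "has_bochner_integral std_normal_distribution
      (\<lambda>x. exp (\<tau> * (a + b * s)) * exp ((\<tau> * c * sqrt s) * x))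
      (exp (\<tau> * (a + b * s)) * exp ((\<tau> * c * sqrt s)\<^sup>2 / 2))"
    by (intro has_bochner_integral_mult_right has_bochner_integral_std_normal_exp)
  then show ?thesis using assms
    by (simp add: exp_add[symmetric] power_mult_distrib algebra_simps)
qed

lemma mixlaw_exp:
  assumes "integrable \<mu> (\<lambda>s. exp (\<tau> * (a + b * s) + \<tau>\<^sup>2 * c\<^sup>2 * s / 2))"
  shows "integrable (mixlaw \<mu> a b c) (\<lambda>y. exp (\<tau> * y))"
    and "(\<integral>y. exp (\<tau> * y) \<partial>mixlaw \<mu> a b c) = (\<integral>s. exp (\<tau> * (a + b * s) + \<tau>\<^sup>2 * c\<^sup>2 * s / 2) \<partial>\<mu>)"
proof -
  have "AE s in \<mu>. has_bochner_integral std_normal_distribution (\<lambda>x. exp (\<tau> * (a + b * s + c * sqrt s * x)))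
      (exp (\<tau> * (a + b * s) + \<tau>\<^sup>2 * c\<^sup>2 * s / 2))"
    using AE_pos by eventually_elim (rule conditional_exp)
  from mixlaw_integrable[OF _ this assms]
  show "integrable (mixlaw \<mu> a b c) (\<lambda>y. exp (\<tau> * y))"
    and "(\<integral>y. exp (\<tau> * y) \<partial>mixlaw \<mu> a b c) = (\<integral>s. exp (\<tau> * (a + b * s) + \<tau>\<^sup>2 * c\<^sup>2 * s / 2) \<partial>\<mu>)"
    by auto
qed

lemma mixlaw_second_moment:
  assumes "integrable \<mu> (\<lambda>s. s)" "integrable \<mu> (\<lambda>s. s\<^sup>2)"
  shows "integrable (mixlaw \<mu> a b c) (\<lambda>y. y\<^sup>2)"
    and "(\<integral>y. y\<^sup>2 \<partial>mixlaw \<mu> a b c) = (\<integral>s. (a + b * s)\<^sup>2 + c\<^sup>2 * s \<partial>\<mu>)"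
proof -
  have "AE s in \<mu>. has_bochner_integral std_normal_distribution (\<lambda>x. (a + b * s + c * sqrt s * x)\<^sup>2)
      ((a + b * s)\<^sup>2 + c\<^sup>2 * s)"
    using AE_pos
  proof eventually_elim
    case (elim s)
    have "has_bochner_integral std_normal_distribution
        (\<lambda>x. (a + b * s)\<^sup>2 + 2 * (a + b * s) * c * sqrt s * x + (c * sqrt s)\<^sup>2 * x\<^sup>2)
        ((a + b * s)\<^sup>2 + 2 * (a + b * s) * c * sqrt s * 0 + (c * sqrt s)\<^sup>2 * 1)"
      by (intro has_bochner_integral_add has_bochner_integral_mult_right)
        (auto simp: has_bochner_integral_iff std_normal_moments M2.prob_space[simplified])
    then show ?case using elim
      by (simp add: power2_sum power_mult_distrib algebra_simps)
  qed
  moreover have "integrable \<mu> (\<lambda>s. (a + b * s)\<^sup>2 + c\<^sup>2 * s)"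
    using assms by (simp add: power2_sum power_mult_distrib algebra_simps)
  ultimately show "integrable (mixlaw \<mu> a b c) (\<lambda>y. y\<^sup>2)"
    and "(\<integral>y. y\<^sup>2 \<partial>mixlaw \<mu> a b c) = (\<integral>s. (a + b * s)\<^sup>2 + c\<^sup>2 * s \<partial>\<mu>)"
    by (auto intro: mixlaw_integrable)
qed

lemma mixlaw_prob:
  assumes [measurable]: "A \<in> sets borel"
  shows "integrable \<mu> (\<lambda>s. measure std_normal_distribution {x. a + b * s + c * sqrt s * x \<in> A})"
    and "measure (mixlaw \<mu> a b c) A
    = (\<integral>s. measure std_normal_distribution {x. a + b * s + c * sqrt s * x \<in> A} \<partial>\<mu>)"
proof -
  interpret Q: real_distribution "mixlaw \<mu> a b c" by (rule real_distribution_mixlaw)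
  have "integrable (mixlaw \<mu> a b c) (indicator A :: real \<Rightarrow> real)"
    by (rule Q.integrable_const_bound[of _ 1]) auto
  note i = mixlaw_integral[OF this]
  have "(\<lambda>x. indicator A (a + b * s + c * sqrt s * x) :: real)
      = indicator {x. a + b * s + c * sqrt s * x \<in> A}" for s
    by (auto simp: indicator_def)
  then show "integrable \<mu> (\<lambda>s. measure std_normal_distribution {x. a + b * s + c * sqrt s * x \<in> A})"
    "measure (mixlaw \<mu> a b c) A
      = (\<integral>s. measure std_normal_distribution {x. a + b * s + c * sqrt s * x \<in> A} \<partial>\<mu>)"
    using i by simp_all
qed

text \<open>Given s > 0, hitting z pins the normal variable to a single point.\<close>

lemma mixlaw_no_atom:
  assumes "c > 0"
  shows "measure (mixlaw \<mu> a b c) {z} = 0"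
proof -
  have "(\<integral>s. measure std_normal_distribution {x. a + b * s + c * sqrt s * x \<in> {z}} \<partial>\<mu>) = (\<integral>s. 0 \<partial>\<mu>)"
  proof (rule integral_cong_AE)
    show "AE s in \<mu>. measure std_normal_distribution {x. a + b * s + c * sqrt s * x \<in> {z}} = 0"
      using AE_pos
    proof eventually_elim
      case (elim s)
      then have "{x. a + b * s + c * sqrt s * x \<in> {z}} = {(z - a - b * s) / (c * sqrt s)}"
        using assms by (auto simp: field_simps)
      then show ?case
        using std_normal_measure_Icc[of "(z - a - b * s) / (c * sqrt s)" "(z - a - b * s) / (c * sqrt s)"]
        by simp
    qed
  qed (use mixlaw_prob(1)[THEN borel_measurable_integrable] in auto)
  then show ?thesis by (subst mixlaw_prob(2)) auto
qed

lemma mixlaw_median_0: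
  assumes "c > 0"
  shows "measure (mixlaw \<mu> 0 0 c) {0<..} = 1 / 2"
proof -
  have "(\<integral>s. measure std_normal_distribution {x. 0 + 0 * s + c * sqrt s * x \<in> {0<..}} \<partial>\<mu>) = (\<integral>s. 1 / 2 \<partial>\<mu>)"
  proof (rule integral_cong_AE)
    show "AE s in \<mu>. measure std_normal_distribution {x. 0 + 0 * s + c * sqrt s * x \<in> {0<..}} = 1 / 2"
      using AE_pos
    proof eventually_elim
      case (elim s)
      then have "{x. 0 + 0 * s + c * sqrt s * x \<in> {0<..}} = UNIV - {..0}"
        using assms by (auto simp: zero_less_mult_iff mult_less_0_iff)
      moreover have "measure std_normal_distribution (space std_normal_distribution - {..0}) = 1 - 1 / 2"
        using std_normal_cdf_0 unfolding std_normal_cdf_def cdf_def by (subst M2.prob_compl) auto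
      ultimately show ?case by simp
    qed
  qed (use mixlaw_prob(1)[THEN borel_measurable_integrable] in auto)
  then show ?thesis by (subst mixlaw_prob(2)) (auto simp: prob_UNIV)
qed

text \<open>Conditional Jensen: given s, the call is worth at least the positive part of the
  conditional mean of exp (\<tau> y) - 1, which is exp A - 1 and hence at least A.\<close>

lemma mixlaw_price_lower:
  assumes "integrable \<mu> (\<lambda>s. exp (\<tau> * (a + b * s) + \<tau>\<^sup>2 * c\<^sup>2 * s / 2))"
    and "integrable \<mu> (\<lambda>s. s)"
  shows "(\<integral>s. max 0 (\<tau> * (a + b * s) + \<tau>\<^sup>2 * c\<^sup>2 * s / 2) \<partial>\<mu>)
     \<le> (\<integral>y. max 0 (exp (\<tau> * y) - 1) \<partial>mixlaw \<mu> a b c)"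
proof -
  interpret Q: real_distribution "mixlaw \<mu> a b c" by (rule real_distribution_mixlaw)
  have "integrable (mixlaw \<mu> a b c) (\<lambda>y. max 0 (exp (\<tau> * y) - 1))"
    by (rule Bochner_Integration.integrable_bound[OF mixlaw_exp(1)[OF assms(1)]]) auto
  note i = mixlaw_integral[OF this]
  show ?thesis unfolding i(2)
  proof (rule integral_mono_AE[OF _ i(1)])
    show "integrable \<mu> (\<lambda>s. max 0 (\<tau> * (a + b * s) + \<tau>\<^sup>2 * c\<^sup>2 * s / 2))"
      using assms(2) by (intro Bochner_Integration.integrable_max) (auto simp: algebra_simps)
    show "AE s in \<mu>. max 0 (\<tau> * (a + b * s) + \<tau>\<^sup>2 * c\<^sup>2 * s / 2)
        \<le> (\<integral>x. max 0 (exp (\<tau> * (a + b * s + c * sqrt s * x)) - 1) \<partial>std_normal_distribution)"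
      using AE_pos
    proof eventually_elim
      case (elim s)
      let ?A = "\<tau> * (a + b * s) + \<tau>\<^sup>2 * c\<^sup>2 * s / 2"
      have h: "has_bochner_integral std_normal_distribution
          (\<lambda>x. exp (\<tau> * (a + b * s + c * sqrt s * x))) (exp ?A)"
        by (rule conditional_exp[OF elim])
      note hi = has_bochner_integral_iff[THEN iffD1, OF h]
      have "?A \<le> exp ?A - 1" using exp_ge_add_one_self[of ?A] by linarith
      also have "exp ?A - 1 = (\<integral>x. exp (\<tau> * (a + b * s + c * sqrt s * x)) - 1 \<partial>std_normal_distribution)"
        using hi M2.prob_space by (subst Bochner_Integration.integral_diff) auto
      also have "\<dots> \<le> (\<integral>x. max 0 (exp (\<tau> * (a + b * s + c * sqrt s * x)) - 1) \<partial>std_normal_distribution)"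
        by (intro integral_mono Bochner_Integration.integrable_max) (use hi in auto)
      finally show ?case by (intro max.boundedI Bochner_Integration.integral_nonneg) simp_all
    qed
  qed
qed

lemma sqrt_integrable:
  assumes "integrable \<mu> (\<lambda>s. s)"
  shows "integrable \<mu> (\<lambda>s. sqrt s)"
proof (rule Bochner_Integration.integrable_bound[of _ "\<lambda>s. 1 + s"])
  show "AE s in \<mu>. norm (sqrt s) \<le> norm (1 + s)"
    using AE_pos
  proof eventually_elim
    case (elim s)
    have "sqrt s \<le> 1 + s" by (rule real_le_lsqrt) (use elim in \<open>auto simp: power2_eq_square algebra_simps\<close>)
    then show ?case using elim by simp
  qed
  show "integrable \<mu> (\<lambda>s. 1 + s)" using assms by simp
  show "(\<lambda>s. sqrt s) \<in> borel_measurable \<mu>" by measurable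
qed

text \<open>From 1 - exp w <= - w. The constant a has the favourable sign and is dropped; what
  remains is the drift and the mean absolute value of the Gaussian part.\<close>

lemma mixlaw_put_upper:
  assumes "integrable \<mu> (\<lambda>s. s)" "\<tau> > 0" "a \<ge> 0" "b \<le> 0" "c \<ge> 0"
  shows "(\<integral>y. max 0 (1 - exp (\<tau> * y)) \<partial>mixlaw \<mu> a b c)
     \<le> \<tau> * (- b * (\<integral>s. s \<partial>\<mu>) + c * (\<integral>s. sqrt s \<partial>\<mu>) * (\<integral>x. \<bar>x\<bar> \<partial>std_normal_distribution))"
proof -
  interpret Q: real_distribution "mixlaw \<mu> a b c" by (rule real_distribution_mixlaw)
  note sq = sqrt_integrable[OF assms(1)]
  have "integrable (mixlaw \<mu> a b c) (\<lambda>y. max 0 (1 - exp (\<tau> * y)))"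
    by (rule Q.integrable_const_bound[of _ 1]) auto
  note i = mixlaw_integral[OF this]
  have "(\<integral>y. max 0 (1 - exp (\<tau> * y)) \<partial>mixlaw \<mu> a b c)
      \<le> (\<integral>s. \<tau> * (- b * s + c * sqrt s * (\<integral>x. \<bar>x\<bar> \<partial>std_normal_distribution)) \<partial>\<mu>)"
    unfolding i(2)
  proof (rule integral_mono_AE[OF i(1)])
    show "integrable \<mu> (\<lambda>s. \<tau> * (- b * s + c * sqrt s * (\<integral>x. \<bar>x\<bar> \<partial>std_normal_distribution)))"
      using sq assms(1) by simp
    show "AE s in \<mu>. (\<integral>x. max 0 (1 - exp (\<tau> * (a + b * s + c * sqrt s * x))) \<partial>std_normal_distribution)
        \<le> \<tau> * (- b * s + c * sqrt s * (\<integral>x. \<bar>x\<bar> \<partial>std_normal_distribution))"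
      using AE_pos
    proof eventually_elim
      case (elim s)
      have "(\<integral>x. max 0 (1 - exp (\<tau> * (a + b * s + c * sqrt s * x))) \<partial>std_normal_distribution)
          \<le> (\<integral>x. \<tau> * (- b * s) + \<tau> * c * sqrt s * \<bar>x\<bar> \<partial>std_normal_distribution)"
      proof (rule integral_mono)
        show "integrable std_normal_distribution (\<lambda>x. max 0 (1 - exp (\<tau> * (a + b * s + c * sqrt s * x))))"
          by (rule M2.integrable_const_bound[of _ 1]) auto
        show "integrable std_normal_distribution (\<lambda>x. \<tau> * (- b * s) + \<tau> * c * sqrt s * \<bar>x\<bar>)"
          using std_normal_moments(1) by auto
        fix x
        have "1 - exp (\<tau> * (a + b * s + c * sqrt s * x)) \<le> - (\<tau> * (a + b * s + c * sqrt s * x))"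
          using exp_ge_add_one_self[of "\<tau> * (a + b * s + c * sqrt s * x)"] by linarith
        also have "\<dots> \<le> \<tau> * (- b * s + c * sqrt s * \<bar>x\<bar>)"
        proof -
          have "c * sqrt s * (- x) \<le> c * sqrt s * \<bar>x\<bar>"
            using assms elim by (intro mult_left_mono) auto
          then have "- (a + b * s + c * sqrt s * x) \<le> - b * s + c * sqrt s * \<bar>x\<bar>"
            using assms by (simp add: algebra_simps)
          then show ?thesis using mult_left_mono[OF _ less_imp_le[OF assms(2)]]
            unfolding mult_minus_right[symmetric] by blast
        qed
        finally have *: "1 - exp (\<tau> * (a + b * s + c * sqrt s * x)) \<le> \<tau> * (- b * s + c * sqrt s * \<bar>x\<bar>)" .
        have "0 \<le> - b * s + c * sqrt s * \<bar>x\<bar>"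
          using assms elim by (intro add_nonneg_nonneg mult_nonneg_nonneg) auto
        then have "0 \<le> \<tau> * (- b * s + c * sqrt s * \<bar>x\<bar>)" using assms by simp
        with * show "max 0 (1 - exp (\<tau> * (a + b * s + c * sqrt s * x))) \<le> \<tau> * (- b * s) + \<tau> * c * sqrt s * \<bar>x\<bar>"
          by (simp add: algebra_simps)
      qed
      also have "\<dots> = \<tau> * (- b * s + c * sqrt s * (\<integral>x. \<bar>x\<bar> \<partial>std_normal_distribution))"
        using std_normal_moments(1) M2.prob_space by (simp add: algebra_simps)
      finally show ?case .
    qed
  qed
  also have "\<dots> = \<tau> * (- b * (\<integral>s. s \<partial>\<mu>) + c * (\<integral>s. sqrt s \<partial>\<mu>) * (\<integral>x. \<bar>x\<bar> \<partial>std_normal_distribution))"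
    using sq assms(1) by (simp add: algebra_simps)
  finally show ?thesis .
qed

end

section \<open>Weak convergence and rescaled put prices\<close>

lemma le_by_derivatives:
  fixes F G :: "real \<Rightarrow> real"
  assumes "0 \<le> w" "F 0 = G 0"
    and "\<And>x. 0 \<le> x \<Longrightarrow> x \<le> w \<Longrightarrow> (F has_real_derivative F' x) (at x)"
    and "\<And>x. 0 \<le> x \<Longrightarrow> x \<le> w \<Longrightarrow> (G has_real_derivative G' x) (at x)"
    and "\<And>x. 0 \<le> x \<Longrightarrow> x \<le> w \<Longrightarrow> F' x \<le> G' x"
  shows "F w \<le> G w"
proof -
  have "G 0 - F 0 \<le> G w - F w"
  proof (rule DERIV_nonneg_imp_nondecreasing[OF assms(1)])
    fix x assume x: "0 \<le> x" "x \<le> w"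
    then have "((\<lambda>x. G x - F x) has_real_derivative G' x - F' x) (at x)"
      by (intro DERIV_diff assms)
    then show "\<exists>y. ((\<lambda>x. G x - F x) has_real_derivative y) (at x) \<and> 0 \<le> y"
      using assms(5)[OF x] by auto
  qed
  then show ?thesis using assms by simp
qed

lemma exp_minus_le_quadratic:
  fixes w :: real
  assumes "0 \<le> w" shows "exp (- w) \<le> 1 - w + w\<^sup>2 / 2"
proof (rule le_by_derivatives[OF assms, where F' = "\<lambda>x. - exp (- x)" and G' = "\<lambda>x. x - 1"])
  show "- exp (- x) \<le> x - 1" for x :: real using exp_ge_add_one_self[of "- x"] by simp
qed (auto intro!: derivative_eq_intros)

text \<open>The rescaled put payoff is compared with the truncation of the negative part at level K,
  which is bounded and continuous and so passes through the weak limit. The error is at most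
  (\<tau>/2 + 1/K) y^2, uniformly small by the second moment bound; K is fixed first and n is sent
  to infinity afterwards.\<close>

lemma expectation_put_tendsto:
  fixes Q :: "nat \<Rightarrow> real measure" and \<tau> :: "nat \<Rightarrow> real"
  assumes Q: "\<And>n. real_distribution (Q n)" "real_distribution R" "weak_conv_m Q R"
    and moment: "\<And>n. integrable (Q n) (\<lambda>y. y\<^sup>2)" "\<And>n. (\<integral>y. y\<^sup>2 \<partial>Q n) \<le> B"
    and R: "integrable R (\<lambda>y. y)"
    and \<tau>: "\<And>n. \<tau> n > 0" "\<tau> \<longlonglongrightarrow> 0"
  shows "(\<lambda>n. (\<integral>y. max 0 (1 - exp (\<tau> n * y)) \<partial>Q n) / \<tau> n) \<longlonglongrightarrow> (\<integral>y. max 0 (- y) \<partial>R)"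
proof -
  interpret R: real_distribution R by (rule Q)
  define m where "m K y = min (max 0 (- y)) K" for K y :: real
  have m_int: "integrable M (m K)" if "real_distribution M" "K \<ge> 0" for M K
  proof -
    interpret M: real_distribution M by fact
    show ?thesis unfolding m_def using that by (intro M.integrable_const_bound[of _ K]) auto
  qed
  have "B \<ge> 0" using order_trans[OF Bochner_Integration.integral_nonneg moment(2)[of 0]] by simp
  have near: "\<bar>(\<integral>y. max 0 (1 - exp (\<tau> n * y)) \<partial>Q n) / \<tau> n - integral\<^sup>L (Q n) (m K)\<bar> \<le> \<tau> n / 2 * B + B / K"
    if "K > 0" for n K
  proof -
    interpret Qn: real_distribution "Q n" by (rule Q)
    have i1: "integrable (Q n) (\<lambda>y. max 0 (1 - exp (\<tau> n * y)))"
      by (rule Qn.integrable_const_bound[of _ 1]) auto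
    have i2: "integrable (Q n) (m K)" using m_int[OF Q(1)] that by auto
    \<comment> \<open>Two errors add up: the quadratic Taylor error \<tau> y^2 / 2 of the
      exponential, and y^2 / K for the truncation, which acts only where - y exceeds K.\<close>
    have p: "\<bar>max 0 (1 - exp (\<tau> n * y)) / \<tau> n - m K y\<bar> \<le> (\<tau> n / 2 + 1 / K) * y\<^sup>2" for y
    proof (cases "y \<ge> 0")
      case True
      then have "m K y = 0" "max 0 (1 - exp (\<tau> n * y)) = 0"
        using \<tau>(1)[of n] that by (auto simp: m_def)
      then show ?thesis using \<tau>(1)[of n] that by simp
    next
      case False
      define x where "x = - y"
      have x: "x > 0" using False by (simp add: x_def)
      have tx: "\<tau> n * x > 0" using x \<tau>(1)[of n] by simp
      have "(1 - exp (- (\<tau> n * x))) / \<tau> n \<le> x"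
        using exp_ge_add_one_self[of "- (\<tau> n * x)"] \<tau>(1)[of n] by (simp add: divide_le_eq mult.commute)
      moreover have "x - \<tau> n / 2 * x\<^sup>2 \<le> (1 - exp (- (\<tau> n * x))) / \<tau> n"
        using exp_minus_le_quadratic[of "\<tau> n * x"] tx
        unfolding pos_le_divide_eq[OF \<tau>(1)[of n]] by (simp add: power2_eq_square algebra_simps)
      moreover have "0 \<le> \<tau> n / 2 * x\<^sup>2" using \<tau>(1)[of n] by simp
      ultimately have "\<bar>(1 - exp (- (\<tau> n * x))) / \<tau> n - x\<bar> \<le> \<tau> n / 2 * x\<^sup>2"
        unfolding abs_le_iff by linarith
      moreover have "\<bar>x - min x K\<bar> \<le> x\<^sup>2 / K"
      proof (cases "x \<le> K")
        case False
        then have "x * K \<le> x * x" "x - K \<le> x" using x that by (auto intro!: mult_left_mono)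
        then have "(x - K) * K \<le> x * x" using that by (smt (verit) mult_right_mono)
        then show ?thesis using False that by (simp add: field_simps power2_eq_square)
      qed (use that in auto)
      ultimately have "\<bar>(1 - exp (- (\<tau> n * x))) / \<tau> n - min x K\<bar> \<le> \<tau> n / 2 * x\<^sup>2 + x\<^sup>2 / K"
        by linarith
      moreover have "max 0 (1 - exp (\<tau> n * y)) = 1 - exp (- (\<tau> n * x))" "m K y = min x K" "y\<^sup>2 = x\<^sup>2"
        using tx x by (auto simp: x_def m_def max_def)
      ultimately show ?thesis by (simp only: distrib_right mult_1_left times_divide_eq_left)
    qed
    have "\<bar>(\<integral>y. max 0 (1 - exp (\<tau> n * y)) / \<tau> n - m K y \<partial>Q n)\<bar> \<le> (\<integral>y. (\<tau> n / 2 + 1 / K) * y\<^sup>2 \<partial>Q n)"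
      using i1 i2 moment(1) p by (intro integral_abs_bound[THEN order_trans] integral_mono) auto
    also have "\<dots> \<le> (\<tau> n / 2 + 1 / K) * B"
      using moment \<tau>(1)[of n] that by (auto intro!: mult_left_mono add_nonneg_nonneg)
    finally show ?thesis using i1 i2 by (simp add: algebra_simps)
  qed
  \<comment> \<open>Removing the truncation under the limit law by dominated convergence, with the
    first moment as majorant.\<close>
  have mR: "(\<lambda>j. integral\<^sup>L R (m (real j))) \<longlonglongrightarrow> (\<integral>y. max 0 (- y) \<partial>R)"
  proof (rule integral_dominated_convergence[where w="\<lambda>y. \<bar>y\<bar>"])
    show "AE y in R. (\<lambda>j. m (real j) y) \<longlonglongrightarrow> max 0 (- y)"
    proof (rule AE_I2)
      fix y :: real
      obtain j0 :: nat where "max 0 (- y) \<le> real j0" using real_arch_simple by blast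
      then have "eventually (\<lambda>j. m (real j) y = max 0 (- y)) sequentially"
        unfolding m_def by (intro eventually_sequentiallyI[of j0]) (auto simp: min_def)
      then show "(\<lambda>j. m (real j) y) \<longlonglongrightarrow> max 0 (- y)" by (rule tendsto_eventually)
    qed
    show "\<And>j. AE y in R. norm (m (real j) y) \<le> \<bar>y\<bar>" by (auto simp: m_def)
    show "(\<lambda>y. max 0 (- y)) \<in> borel_measurable R" by simp
    show "\<And>j. m (real j) \<in> borel_measurable R" unfolding m_def by simp
    show "integrable R (\<lambda>y. \<bar>y\<bar>)" using R by (rule integrable_abs)
  qed
  show ?thesis
  proof (rule LIMSEQ_I)
    fix e :: real assume e: "e > 0"
    let ?L = "\<integral>y. max 0 (- y) \<partial>R"
    have "eventually (\<lambda>j. \<bar>integral\<^sup>L R (m (real j)) - ?L\<bar> < e / 4) sequentially"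
      using tendstoD[OF mR, of "e / 4"] e by (simp add: dist_real_def)
    moreover have "(\<lambda>j. B / real j) \<longlonglongrightarrow> 0" by (rule lim_const_over_n)
    then have "eventually (\<lambda>j. B / real j < e / 4) sequentially"
      using e by (intro order_tendstoD) auto
    ultimately have "eventually (\<lambda>j. \<bar>integral\<^sup>L R (m (real j)) - ?L\<bar> < e / 4 \<and> B / real j < e / 4 \<and> j > 0) sequentially"
      using eventually_gt_at_top[of 0] by eventually_elim auto
    then obtain j where j: "\<bar>integral\<^sup>L R (m (real j)) - ?L\<bar> < e / 4" "B / real j < e / 4" "j > 0"
      by (auto simp: eventually_sequentially)
    have "(\<lambda>n. integral\<^sup>L (Q n) (m (real j))) \<longlonglongrightarrow> integral\<^sup>L R (m (real j))"
      using Q unfolding m_def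
      by (intro weak_conv_imp_integral_bdd_continuous_conv[where B="real j"]) (auto intro!: continuous_intros)
    from tendstoD[OF this, of "e / 4"] e
    have "eventually (\<lambda>n. \<bar>integral\<^sup>L (Q n) (m (real j)) - integral\<^sup>L R (m (real j))\<bar> < e / 4) sequentially"
      by (simp add: dist_real_def)
    moreover have "(\<lambda>n. \<tau> n / 2 * B) \<longlonglongrightarrow> 0 / 2 * B" by (intro tendsto_intros \<tau>) auto
    from order_tendstoD(2)[OF this, of "e / 4"] e
    have "eventually (\<lambda>n. \<tau> n / 2 * B < e / 4) sequentially" by simp
    ultimately have "eventually (\<lambda>n. norm ((\<integral>y. max 0 (1 - exp (\<tau> n * y)) \<partial>Q n) / \<tau> n - ?L) < e) sequentially"
    proof eventually_elim
      case (elim n)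
      then show ?case using near[of "real j" n] j unfolding real_norm_def by linarith
    qed
    then show "\<exists>no. \<forall>n\<ge>no. norm ((\<integral>y. max 0 (1 - exp (\<tau> n * y)) \<partial>Q n) / \<tau> n - ?L) < e"
      by (simp add: eventually_sequentially)
  qed
qed

section \<open>Call prices as functions of the strike; put-call parity\<close>

lemma AE_nonzero:
  assumes "real_distribution Q" "measure Q {0} = 0"
  shows "AE x in Q. x \<noteq> 0"
proof -
  interpret Q: real_distribution Q by fact
  show ?thesis using assms(2) by (intro AE_I[of _ _ "{0}"]) (auto simp: Q.emeasure_eq_measure)
qed

text \<open>Mean zero makes the two parts equal in expectation, and both vanishing would force X = 0
  almost surely. This one fact yields put-call parity, the positivity of the at-the-money price and
  the positivity of the limiting volatility.\<close>

lemma (in prob_space) negative_part_pos: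
  fixes X :: "'a \<Rightarrow> real"
  assumes "integrable M X" "expectation X = 0" "AE \<omega> in M. X \<omega> \<noteq> 0"
  shows "expectation (\<lambda>\<omega>. max 0 (X \<omega>)) = expectation (\<lambda>\<omega>. max 0 (- X \<omega>))"
    and "0 < expectation (\<lambda>\<omega>. max 0 (- X \<omega>))"
proof -
  have i: "integrable M (\<lambda>\<omega>. max 0 (X \<omega>))" "integrable M (\<lambda>\<omega>. max 0 (- X \<omega>))"
    using assms(1) by (auto intro!: Bochner_Integration.integrable_max)
  have "expectation (\<lambda>\<omega>. max 0 (X \<omega>)) - expectation (\<lambda>\<omega>. max 0 (- X \<omega>))
      = expectation (\<lambda>\<omega>. max 0 (X \<omega>) - max 0 (- X \<omega>))" using i by simp
  also have "\<dots> = expectation X" by (rule Bochner_Integration.integral_cong) auto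
  finally show eq: "expectation (\<lambda>\<omega>. max 0 (X \<omega>)) = expectation (\<lambda>\<omega>. max 0 (- X \<omega>))"
    using assms(2) by simp
  show "0 < expectation (\<lambda>\<omega>. max 0 (- X \<omega>))"
  proof (rule ccontr)
    assume "\<not> ?thesis"
    moreover have "0 \<le> expectation (\<lambda>\<omega>. max 0 (- X \<omega>))" by simp
    ultimately have z: "expectation (\<lambda>\<omega>. max 0 (- X \<omega>)) = 0" by linarith
    have "AE \<omega> in M. max 0 (X \<omega>) = 0" "AE \<omega> in M. max 0 (- X \<omega>) = 0"
      using integral_nonneg_eq_0_iff_AE[OF i(1)] integral_nonneg_eq_0_iff_AE[OF i(2)] z eq by simp_all
    with assms(3) have "AE \<omega> in M. False" by eventually_elim auto
    then show False using AE_False by simp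
  qed
qed

text \<open>The payoff is 1-Lipschitz in the strike K, so the difference quotients at K = 1 are
  dominated by 1; away from the kink they are eventually constant, and the kink x = 0 is a null set.
  The chain rule with K = exp (y \<tau>) finishes.\<close>

lemma call_price_has_derivative:
  assumes "real_distribution Q" "integrable Q (\<lambda>x. exp (\<tau> * x))" "measure Q {0} = 0" "\<tau> > 0"
  shows "((\<lambda>y. \<integral>x. max 0 (exp (\<tau> * x) - exp (y * \<tau>)) \<partial>Q) has_real_derivative
           - \<tau> * measure Q {0<..}) (at 0)"
proof -
  interpret Q: real_distribution Q by fact
  define R where "R K = (\<integral>x. max 0 (exp (\<tau> * x) - K) \<partial>Q)" for K
  have i: "integrable Q (\<lambda>x. max 0 (exp (\<tau> * x) - K))" for K
    using assms(2) by (intro Bochner_Integration.integrable_max) auto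
  note AE0 = AE_nonzero[OF assms(1,3)]
  have "(R has_real_derivative - measure Q {0<..}) (at 1)"
    unfolding has_field_derivative_iff tendsto_at_iff_sequentially comp_def
  proof (intro allI impI)
    fix K :: "nat \<Rightarrow> real" assume K: "\<forall>n. K n \<in> UNIV - {1}" "K \<longlonglongrightarrow> 1"
    have "(\<lambda>n. \<integral>x. (max 0 (exp (\<tau> * x) - K n) - max 0 (exp (\<tau> * x) - 1)) / (K n - 1) \<partial>Q)
        \<longlonglongrightarrow> (\<integral>x. - indicator {0<..} x \<partial>Q)"
    proof (rule integral_dominated_convergence[where w="\<lambda>_. 1"])
      show "AE x in Q. (\<lambda>n. (max 0 (exp (\<tau> * x) - K n) - max 0 (exp (\<tau> * x) - 1)) / (K n - 1))
          \<longlonglongrightarrow> - indicator {0<..} x"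
        using AE0
      proof eventually_elim
        case (elim x)
        have "exp (\<tau> * x) \<noteq> 1" using elim assms by auto
        have "eventually (\<lambda>n. (max 0 (exp (\<tau> * x) - K n) - max 0 (exp (\<tau> * x) - 1)) / (K n - 1)
           = - indicator {0<..} x) sequentially"
        proof (cases "x > 0")
          case True
          then have "exp (\<tau> * x) > 1" using assms by auto
          then have "eventually (\<lambda>n. K n < exp (\<tau> * x)) sequentially" using K by (intro order_tendstoD)
          then show ?thesis
          proof eventually_elim
            case (elim n)
            then show ?case using True \<open>exp (\<tau> * x) > 1\<close> K(1)[rule_format, of n] by (simp add: max_def field_simps)
          qed
        next
          case False
          then have "exp (\<tau> * x) < 1" using elim assms by (auto simp: mult_less_0_iff)
          then have "eventually (\<lambda>n. K n > exp (\<tau> * x)) sequentially" using K by (intro order_tendstoD)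
          then show ?thesis
            by eventually_elim (use False \<open>exp (\<tau> * x) < 1\<close> in \<open>simp add: max_def\<close>)
        qed
        then show ?case by (rule tendsto_eventually)
      qed
      show "AE x in Q. norm ((max 0 (exp (\<tau> * x) - K n) - max 0 (exp (\<tau> * x) - 1)) / (K n - 1)) \<le> 1" for n
      proof (rule AE_I2)
        fix x
        have "\<bar>max 0 (E - k) - max 0 (E - 1)\<bar> \<le> \<bar>k - 1\<bar>" for E k :: real
          by (auto simp: max_def)
        from this[of "exp (\<tau> * x)" "K n"]
        have "\<bar>max 0 (exp (\<tau> * x) - K n) - max 0 (exp (\<tau> * x) - 1)\<bar> \<le> \<bar>K n - 1\<bar>" .
        then show "norm ((max 0 (exp (\<tau> * x) - K n) - max 0 (exp (\<tau> * x) - 1)) / (K n - 1)) \<le> 1"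
          using K(1)[rule_format, of n] by (simp add: abs_divide)
      qed
    qed (auto intro!: borel_measurable_uminus borel_measurable_indicator)
    moreover have "(\<integral>x. - indicator {0<..} x \<partial>Q) = - measure Q {0<..}" by simp
    moreover have "(\<integral>x. (max 0 (exp (\<tau> * x) - K n) - max 0 (exp (\<tau> * x) - 1)) / (K n - 1) \<partial>Q)
        = (R (K n) - R 1) / (K n - 1)" for n
      unfolding R_def using i by simp
    ultimately show "(\<lambda>n. (R (K n) - R 1) / (K n - 1)) \<longlonglongrightarrow> - measure Q {0<..}" by (simp only:)
  qed
  then have "(R has_real_derivative - measure Q {0<..}) (at (exp (0 * \<tau>)))" by simp
  moreover have "((\<lambda>y. exp (y * \<tau>)) has_real_derivative \<tau>) (at 0)"
    by (auto intro!: derivative_eq_intros)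
  ultimately have "((\<lambda>y. R (exp (y * \<tau>))) has_real_derivative - measure Q {0<..} * \<tau>) (at 0)"
    by (rule DERIV_chain2)
  then show ?thesis by (simp add: R_def mult.commute)
qed

lemma call_price_bounds:
  assumes "real_distribution Q" "integrable Q (\<lambda>x. exp (\<tau> * x))" "(\<integral>x. exp (\<tau> * x) \<partial>Q) = 1"
    and "measure Q {0} = 0" "\<tau> > 0"
  shows "0 < (\<integral>x. max 0 (exp (\<tau> * x) - 1) \<partial>Q)" "(\<integral>x. max 0 (exp (\<tau> * x) - 1) \<partial>Q) < 1"
    and "(\<integral>x. max 0 (exp (\<tau> * x) - 1) \<partial>Q) = (\<integral>x. max 0 (1 - exp (\<tau> * x)) \<partial>Q)"
proof -
  interpret Q: real_distribution Q by fact
  have i: "integrable Q (\<lambda>x. max 0 (exp (\<tau> * x) - 1))"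
    using assms(2) by (auto intro!: Bochner_Integration.integrable_max)
  have "AE x in Q. exp (\<tau> * x) - 1 \<noteq> 0"
    using AE_nonzero[OF assms(1,4)] by (rule eventually_mono) (use assms(5) in simp)
  moreover have "(\<integral>x. exp (\<tau> * x) - 1 \<partial>Q) = 0"
    using assms(2,3) Q.prob_space by simp
  ultimately show "0 < (\<integral>x. max 0 (exp (\<tau> * x) - 1) \<partial>Q)"
    "(\<integral>x. max 0 (exp (\<tau> * x) - 1) \<partial>Q) = (\<integral>x. max 0 (1 - exp (\<tau> * x)) \<partial>Q)"
    using Q.negative_part_pos[of "\<lambda>x. exp (\<tau> * x) - 1"] assms(2) by simp_all
  show "(\<integral>x. max 0 (exp (\<tau> * x) - 1) \<partial>Q) < 1"
  proof -
    have "(\<integral>x. max 0 (exp (\<tau> * x) - 1) \<partial>Q) < (\<integral>x. exp (\<tau> * x) \<partial>Q)"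
      by (rule Q.integral_less_AE_space[OF i assms(2)])
        (auto simp: max_def Q.emeasure_space_1[simplified])
    then show ?thesis using assms by simp
  qed
qed

section \<open>Tempered stable laws\<close>

text \<open>Normalised so that the value at 0 is 0 and the derivative is (1 + w)^(\<alpha> - 1) for
  every \<alpha>, the logarithm being the limit of the power formula as \<alpha> tends to 0. The
  model's log-Laplace transform becomes \<open>- ts_exponent \<alpha> (v * u) / v\<close> with v =
  k_t / ((1 - \<alpha>) t).\<close>

definition ts_exponent :: "real \<Rightarrow> real \<Rightarrow> real" where
  "ts_exponent \<alpha> w = (if \<alpha> = 0 then ln (1 + w) else ((1 + w) powr \<alpha> - 1) / \<alpha>)"

definition cts_exponent :: "real \<Rightarrow> complex \<Rightarrow> complex" where
  "cts_exponent \<alpha> w = (if \<alpha> = 0 then Ln (1 + w) else ((1 + w) powr of_real \<alpha> - 1) / of_real \<alpha>)"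

lemma cts_exponent_of_real:
  assumes "x > -1" shows "cts_exponent \<alpha> (of_real x) = of_real (ts_exponent \<alpha> x)"
proof -
  have "1 + complex_of_real x = of_real (1 + x)" by simp
  then show ?thesis using assms
    unfolding cts_exponent_def ts_exponent_def by (simp add: Ln_of_real powr_of_real del: of_real_add)
qed

lemma one_plus_not_nonpos_Reals: "Re w > - 1 \<Longrightarrow> 1 + w \<notin> \<real>\<^sub>\<le>\<^sub>0"
  by (auto simp: complex_nonpos_Reals_iff)

lemma cts_exponent_has_derivative:
  assumes "Re w > -1"
  shows "(cts_exponent \<alpha> has_field_derivative (1 + w) powr (of_real \<alpha> - 1)) (at w)"
proof (cases "\<alpha> = 0")
  case True
  have "1 + w \<noteq> 0" using one_plus_not_nonpos_Reals[OF assms] by auto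
  then have "((\<lambda>w. Ln (1 + w)) has_field_derivative (1 + w) powr (of_real \<alpha> - 1)) (at w)"
    using one_plus_not_nonpos_Reals[OF assms] True
    by (auto intro!: derivative_eq_intros simp: powr_minus field_simps)
  then show ?thesis using True by (simp add: cts_exponent_def[abs_def])
next
  case False
  have "((\<lambda>w. (1 + w) powr of_real \<alpha>) has_field_derivative of_real \<alpha> * (1 + w) powr (of_real \<alpha> - 1) * 1) (at w)"
    by (rule DERIV_chain2[where f="\<lambda>z. z powr of_real \<alpha>" and g="\<lambda>w. 1 + w"])
      (auto intro!: has_field_derivative_powr one_plus_not_nonpos_Reals assms derivative_eq_intros)
  then have "((\<lambda>w. ((1 + w) powr of_real \<alpha> - 1) / of_real \<alpha>) has_field_derivative
      (of_real \<alpha> * (1 + w) powr (of_real \<alpha> - 1) * 1 - 0) / of_real \<alpha>) (at w)"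
    by (intro DERIV_cdivide DERIV_diff DERIV_const)
  then show ?thesis using False by (simp add: cts_exponent_def[abs_def])
qed

lemma ts_exponent_has_derivative:
  assumes "w > -1"
  shows "(ts_exponent \<alpha> has_real_derivative (1 + w) powr (\<alpha> - 1)) (at w)"
proof (cases "\<alpha> = 0")
  case True
  then show ?thesis using assms unfolding ts_exponent_def[abs_def]
    by (auto intro!: derivative_eq_intros simp: powr_minus field_simps)
next
  case False
  have "((\<lambda>w. (1 + w) powr \<alpha>) has_real_derivative \<alpha> * (1 + w) powr (\<alpha> - 1) * 1) (at w)"
    by (rule DERIV_chain2[where f="\<lambda>z. z powr \<alpha>" and g="\<lambda>w. 1 + w"])
      (use assms in \<open>auto intro!: has_real_derivative_powr derivative_eq_intros\<close>)
  then have "((\<lambda>w. ((1 + w) powr \<alpha> - 1) / \<alpha>) has_real_derivative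
      (\<alpha> * (1 + w) powr (\<alpha> - 1) * 1 - 0) / \<alpha>) (at w)"
    by (intro DERIV_cdivide DERIV_diff DERIV_const)
  then show ?thesis using False by (simp add: ts_exponent_def[abs_def])
qed

lemma ts_exponent_0 [simp]: "ts_exponent \<alpha> 0 = 0"
  by (simp add: ts_exponent_def)

text \<open>With the common derivative (1 + x)^(\<alpha> - 1), bounds on the exponent reduce to
  bounds on a power, treated without distinguishing \<alpha> = 0.\<close>

lemma ts_exponent_le_compare:
  assumes "0 \<le> w" "G 0 = 0"
    and "\<And>x. 0 \<le> x \<Longrightarrow> x \<le> w \<Longrightarrow> (G has_real_derivative G' x) (at x)"
    and "\<And>x. 0 \<le> x \<Longrightarrow> x \<le> w \<Longrightarrow> (1 + x) powr (\<alpha> - 1) \<le> G' x"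
  shows "ts_exponent \<alpha> w \<le> G w"
  using assms by (intro le_by_derivatives[OF assms(1) _ ts_exponent_has_derivative]) auto

lemma ts_exponent_ge_compare:
  assumes "0 \<le> w" "G 0 = 0"
    and "\<And>x. 0 \<le> x \<Longrightarrow> x \<le> w \<Longrightarrow> (G has_real_derivative G' x) (at x)"
    and "\<And>x. 0 \<le> x \<Longrightarrow> x \<le> w \<Longrightarrow> G' x \<le> (1 + x) powr (\<alpha> - 1)"
  shows "G w \<le> ts_exponent \<alpha> w"
  using assms by (intro le_by_derivatives[OF assms(1) _ _ ts_exponent_has_derivative]) auto

lemma ts_exponent_le:
  assumes "0 \<le> w" "\<alpha> \<le> 1" shows "ts_exponent \<alpha> w \<le> w"
proof (rule ts_exponent_le_compare[where G' = "\<lambda>_. 1"])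
  fix x :: real assume "0 \<le> x"
  then show "(1 + x) powr (\<alpha> - 1) \<le> 1" using powr_mono[of "\<alpha> - 1" 0 "1 + x"] assms by simp
qed (use assms in auto)

text \<open>The derivative is exp (- (1 - \<alpha>) ln (1 + x)), at least 1 - (1 - \<alpha>) x. The
  quadratic coefficient is the exact second-order one, which later produces the variance (1 -
  \<alpha>) v.\<close>

lemma ts_exponent_ge:
  assumes "0 \<le> w" "\<alpha> \<le> 1" shows "w - (1 - \<alpha>) * w\<^sup>2 / 2 \<le> ts_exponent \<alpha> w"
proof (rule ts_exponent_ge_compare[where G' = "\<lambda>x. 1 - (1 - \<alpha>) * x"])
  fix x :: real assume x: "0 \<le> x" "x \<le> w"
  have "(1 - \<alpha>) * ln (1 + x) \<le> (1 - \<alpha>) * x"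
    using assms x by (intro mult_left_mono ln_add_one_self_le_self) auto
  then have "1 - (1 - \<alpha>) * x \<le> 1 + (\<alpha> - 1) * ln (1 + x)" by (simp add: algebra_simps)
  also have "\<dots> \<le> exp ((\<alpha> - 1) * ln (1 + x))" by (rule exp_ge_add_one_self)
  also have "\<dots> = (1 + x) powr (\<alpha> - 1)" using x by (simp add: powr_def)
  finally show "1 - (1 - \<alpha>) * x \<le> (1 + x) powr (\<alpha> - 1)" .
qed (use assms in \<open>auto intro!: derivative_eq_intros\<close>)

lemma ts_exponent_nonneg:
  assumes "0 \<le> w" shows "0 \<le> ts_exponent \<alpha> w"
  using ts_exponent_ge_compare[of w "\<lambda>_. 0" "\<lambda>_. 0" \<alpha>] assms by auto

text \<open>Convexity of exp, as weighted AM-GM, bounds the derivative by \<alpha> + (1 - \<alpha>)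
  / (1 + x); freezing the denominator at the endpoint w leaves a linear derivative. The quadratic
  gain quantifies that the law is not degenerate.\<close>

lemma ts_exponent_le_strict:
  assumes "0 \<le> w" "0 \<le> \<alpha>" "\<alpha> \<le> 1"
  shows "ts_exponent \<alpha> w \<le> w - (1 - \<alpha>) * w\<^sup>2 / (2 * (1 + w))"
proof -
  define c where "c = (1 - \<alpha>) / (2 * (1 + w))"
  have "ts_exponent \<alpha> w \<le> w - c * w\<^sup>2"
  proof (rule ts_exponent_le_compare[where G = "\<lambda>x. x - c * x\<^sup>2" and G' = "\<lambda>x. 1 - c * (2 * x)"])
  fix x :: real assume x: "0 \<le> x" "x \<le> w"
  have "(1 + x) powr (\<alpha> - 1) = exp ((1 - (1 - \<alpha>)) *\<^sub>R 0 + (1 - \<alpha>) *\<^sub>R (- ln (1 + x)))"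
    using x by (simp add: powr_def algebra_simps)
  also have "\<dots> \<le> (1 - (1 - \<alpha>)) * exp 0 + (1 - \<alpha>) * exp (- ln (1 + x))"
    using assms by (intro convex_onD[OF exp_convex]) auto
  also have "\<dots> = \<alpha> + (1 - \<alpha>) * (1 / (1 + x))"
    using x by (simp add: exp_minus inverse_eq_divide)
  also have "\<dots> = 1 - (1 - \<alpha>) * (x / (1 + x))" using x by (simp add: field_simps)
  also have "\<dots> \<le> 1 - (1 - \<alpha>) * (x / (1 + w))"
    using x assms by (intro diff_left_mono mult_left_mono divide_left_mono) auto
  also have "(1 - \<alpha>) * (x / (1 + w)) = c * (2 * x)" using assms by (simp add: c_def field_simps)
  finally show "(1 + x) powr (\<alpha> - 1) \<le> 1 - c * (2 * x)" .
  qed (use assms in \<open>auto intro!: derivative_eq_intros\<close>)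
  then show ?thesis by (simp add: c_def)
qed

text \<open>The positive tempered stable law with mean 1 and variance (1 - \<alpha>) v. Only its
  Laplace transform on the half-line is given; the finiteness of its first two moments is
  derived.\<close>

locale tempered_stable = mixing +
  fixes \<alpha> v :: real
  assumes alpha: "0 \<le> \<alpha>" "\<alpha> < 1" and v_pos: "v > 0"
    and laplace: "\<And>u. u \<ge> 0 \<Longrightarrow> (\<integral>s. exp (- u * s) \<partial>\<mu>) = exp (- ts_exponent \<alpha> (v * u) / v)"
begin

lemma exp_integrable: "u \<ge> 0 \<Longrightarrow> integrable \<mu> (\<lambda>s. exp (- u * s))"
  using AE_pos by (intro bounded_integrable[of _ 1]) (auto elim!: eventually_mono)

text \<open>Differentiation under the integral. On the disc of radius \<delta> = Re z / 2 around z
  the real part stays above \<delta>, and s exp (- \<delta> s) <= 1 / \<delta> dominates the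
  difference quotients.\<close>

lemma claplace_holomorphic: "claplace \<mu> holomorphic_on {z. Re z > 0}"
proof (rule holomorphic_onI)
  fix z assume "z \<in> {z. Re z > 0}"
  define \<delta> where "\<delta> = Re z / 2"
  have d: "\<delta> > 0" "Re z = 2 * \<delta>" using \<open>z \<in> _\<close> by (auto simp: \<delta>_def)
  have int: "integrable \<mu> (\<lambda>s. exp (- w * of_real s))" if "Re w \<ge> 0" for w
    using AE_pos that
    by (intro bounded_integrable[of _ 1]) (auto elim!: eventually_mono intro!: mult_nonneg_nonneg)
  have "((\<lambda>w. (claplace \<mu> w - claplace \<mu> z) / (w - z)) \<longlongrightarrow> (\<integral>s. - of_real s * exp (- z * of_real s) \<partial>\<mu>))
      (at z within ball z \<delta>)"
    unfolding tendsto_at_iff_sequentially comp_def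
  proof (intro allI impI)
    fix X assume X: "\<forall>i. X i \<in> ball z \<delta> - {z}" "X \<longlonglongrightarrow> z"
    have Re: "Re w \<ge> \<delta>" if "w \<in> ball z \<delta>" for w
      using that abs_Re_le_cmod[of "z - w"] d by (auto simp: dist_norm)
    have "(\<lambda>i. \<integral>s. (exp (- X i * of_real s) - exp (- z * of_real s)) / (X i - z) \<partial>\<mu>)
        \<longlonglongrightarrow> (\<integral>s. - of_real s * exp (- z * of_real s) \<partial>\<mu>)"
    proof (rule integral_dominated_convergence[where w="\<lambda>_. 1 / \<delta>"])
      have "(\<lambda>i. (exp (- X i * of_real s) - exp (- z * of_real s)) / (X i - z))
          \<longlonglongrightarrow> - of_real s * exp (- z * of_real s)" for s :: real
      proof -
        have "((\<lambda>w. exp (- w * of_real s)) has_field_derivative - of_real s * exp (- z * of_real s)) (at z)"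
          by (auto intro!: derivative_eq_intros)
        then show ?thesis using X unfolding has_field_derivative_iff tendsto_at_iff_sequentially comp_def
          by blast
      qed
      then show "AE s in \<mu>. (\<lambda>i. (exp (- X i * of_real s) - exp (- z * of_real s)) / (X i - z))
          \<longlonglongrightarrow> - of_real s * exp (- z * of_real s)" by simp
      show "AE s in \<mu>. norm ((exp (- X i * of_real s) - exp (- z * of_real s)) / (X i - z)) \<le> 1 / \<delta>" for i
        using AE_pos
      proof eventually_elim
        case (elim s)
        have "norm (exp (- X i * of_real s) - exp (- z * of_real s)) \<le> 1 / \<delta> * norm (X i - z)"
        proof (rule field_differentiable_bound[of "ball z \<delta>" "\<lambda>w. exp (- w * of_real s)" "\<lambda>w. - of_real s * exp (- w * of_real s)"])
          fix w assume w: "w \<in> ball z \<delta>"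
          show "((\<lambda>w. exp (- w * of_real s)) has_field_derivative - of_real s * exp (- w * of_real s)) (at w within ball z \<delta>)"
            by (auto intro!: derivative_eq_intros)
          have "norm (- of_real s * exp (- w * of_real s)) = s * exp (- Re w * s)"
            using elim by (simp add: norm_mult)
          also have "\<dots> \<le> s * exp (- (\<delta> * s))"
            using elim Re[OF w] by simp
          also have "\<dots> \<le> 1 / \<delta>"
          proof -
            have "\<delta> * s \<le> exp (\<delta> * s)" using exp_ge_add_one_self[of "\<delta> * s"] by linarith
            then show ?thesis using d by (simp add: exp_minus field_simps)
          qed
          finally show "norm (- of_real s * exp (- w * of_real s)) \<le> 1 / \<delta>" .
        qed (use X d in auto)
        then show ?case using X(1)[rule_format, of i] by (simp add: norm_divide divide_le_eq)
      qed
    qed auto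
    moreover have "(\<integral>s. (exp (- X i * of_real s) - exp (- z * of_real s)) / (X i - z) \<partial>\<mu>)
        = (claplace \<mu> (X i) - claplace \<mu> z) / (X i - z)" for i
    proof -
      have "Re (X i) \<ge> 0" using Re[of "X i"] X(1) d by (metis DiffD1 less_eq_real_def order_trans)
      then show ?thesis unfolding claplace_def
        using int[of "X i"] int[of z] d by simp
    qed
    ultimately show "(\<lambda>i. (claplace \<mu> (X i) - claplace \<mu> z) / (X i - z))
        \<longlonglongrightarrow> (\<integral>s. - of_real s * exp (- z * of_real s) \<partial>\<mu>)" by (simp only:)
  qed
  then have "(claplace \<mu> has_field_derivative (\<integral>s. - of_real s * exp (- z * of_real s) \<partial>\<mu>)) (at z)"
    using d at_within_open[of z "ball z \<delta>"] unfolding has_field_derivative_iff by simp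
  then show "claplace \<mu> field_differentiable at z within {z. Re z > 0}"
    by (meson field_differentiable_at_within field_differentiable_def)
qed

text \<open>Identity theorem on the right half-plane: both sides are holomorphic there and agree on
  the positive reals, which accumulate at 1.\<close>

lemma claplace_eq:
  assumes "Re z > 0"
  shows "claplace \<mu> z = exp (- cts_exponent \<alpha> (of_real v * z) / of_real v)"
proof -
  define S where "S = {z. Re z > 0}"
  define F where "F z = claplace \<mu> z - exp (- cts_exponent \<alpha> (of_real v * z) / of_real v)" for z
  have "F z = 0"
  proof (rule analytic_continuation[of F S "of_real ` {0<..}" 1])
    have "(\<lambda>z. exp (- cts_exponent \<alpha> (of_real v * z) / of_real v)) holomorphic_on S"
    proof (rule holomorphic_onI)
      fix z assume "z \<in> S"
      then have "Re (of_real v * z) > -1" using v_pos by (simp add: S_def) (smt (verit) mult_pos_pos)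
      from cts_exponent_has_derivative[OF this, of \<alpha>]
      have "((\<lambda>z. exp (- cts_exponent \<alpha> (of_real v * z) / of_real v)) has_field_derivative
          exp (- cts_exponent \<alpha> (of_real v * z) / of_real v) *
           (- ((1 + of_real v * z) powr (of_real \<alpha> - 1) * of_real v) / of_real v)) (at z)"
        using v_pos by (auto intro!: derivative_eq_intros DERIV_chain2[of "cts_exponent \<alpha>"])
      then show "(\<lambda>z. exp (- cts_exponent \<alpha> (of_real v * z) / of_real v)) field_differentiable at z within S"
        by (meson field_differentiable_at_within field_differentiable_def)
    qed
    then show "F holomorphic_on S" unfolding F_def
      using claplace_holomorphic unfolding S_def by (intro holomorphic_on_diff)
    show "open S" unfolding S_def by (rule open_halfspace_Re_gt)
    show "connected S" unfolding S_def by (intro convex_connected convex_halfspace_Re_gt)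
    show "of_real ` {0<..} \<subseteq> S" "1 \<in> S" "z \<in> S" using assms by (auto simp: S_def)
    show "1 islimpt complex_of_real ` {0<..}"
    proof (rule islimpt_approachable[THEN iffD2], intro allI impI)
      fix e :: real assume "e > 0"
      then show "\<exists>x'\<in>complex_of_real ` {0<..}. x' \<noteq> 1 \<and> dist x' 1 < e"
        by (intro bexI[OF _ imageI[of "1 + e / 2"]]) (auto simp: dist_norm)
    qed
    fix w assume "w \<in> complex_of_real ` {0<..}"
    then obtain u where u: "u > 0" "w = of_real u" by auto
    have "claplace \<mu> w = (\<integral>s. of_real (exp (- u * s)) \<partial>\<mu>)"
      unfolding claplace_def u by (simp flip: exp_of_real)
    also have "\<dots> = of_real (exp (- ts_exponent \<alpha> (v * u) / v))"
      using laplace[of u] u by simp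
    also have "- 1 < v * u" using v_pos u by (smt (verit) mult_pos_pos)
    then have "of_real (exp (- ts_exponent \<alpha> (v * u) / v)) = exp (- cts_exponent \<alpha> (of_real v * w) / of_real v)"
      using cts_exponent_of_real[of "v * u" \<alpha>] u by (simp flip: exp_of_real)
    finally show "F w = 0" by (simp add: F_def)
  qed
  then show ?thesis by (simp add: F_def)
qed

section \<open>Moments and concentration of tempered stable laws\<close>

definition q :: real where "q = (1 - \<alpha>) * v"

lemma q_pos: "q > 0"
  using alpha v_pos by (simp add: q_def)

lemma laplace_ge: "u \<ge> 0 \<Longrightarrow> 1 - u \<le> (\<integral>s. exp (- u * s) \<partial>\<mu>)"
proof -
  assume u: "u \<ge> 0"
  have "ts_exponent \<alpha> (v * u) \<le> v * u" using u v_pos alpha by (intro ts_exponent_le) auto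
  then have "1 - u \<le> 1 + (- ts_exponent \<alpha> (v * u) / v)" using v_pos by (simp add: field_simps)
  also have "\<dots> \<le> exp (- ts_exponent \<alpha> (v * u) / v)" by (rule exp_ge_add_one_self)
  finally show ?thesis using laplace[OF u] by simp
qed

lemma ts_exponent_ge_v:
  assumes "u \<ge> 0" shows "u - q * u\<^sup>2 / 2 \<le> ts_exponent \<alpha> (v * u) / v"
proof -
  have "v * (u - q * u\<^sup>2 / 2) \<le> ts_exponent \<alpha> (v * u)"
    using ts_exponent_ge[of "v * u" \<alpha>] assms v_pos alpha by (simp add: q_def algebra_simps power2_eq_square)
  then show ?thesis using v_pos by (simp add: le_divide_eq mult.commute)
qed

lemma laplace_le:
  assumes u: "0 \<le> u" "q * u \<le> 2"
  shows "(\<integral>s. exp (- u * s) \<partial>\<mu>) \<le> 1 - u + (1 + q) * u\<^sup>2 / 2"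
proof -
  \<comment> \<open>The hypothesis \<open>q * u \<le> 2\<close> is what makes \<open>x\<close>
    nonnegative, so that exp (- x) is below its second Taylor polynomial.\<close>
  define x where "x = u - q * u\<^sup>2 / 2"
  have "u * (q * u) \<le> u * 2" using u by (intro mult_left_mono)
  then have x: "0 \<le> x" by (simp add: x_def power2_eq_square algebra_simps)
  have xu: "x \<le> u" using q_pos u by (simp add: x_def)
  have "(\<integral>s. exp (- u * s) \<partial>\<mu>) \<le> exp (- x)"
    using ts_exponent_ge_v[OF u(1)] laplace[OF u(1)] by (simp add: x_def)
  also have "\<dots> \<le> 1 - x + x\<^sup>2 / 2" by (rule exp_minus_le_quadratic[OF x])
  also have "\<dots> \<le> 1 - x + u\<^sup>2 / 2" using power_mono[OF xu x, of 2] by simp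
  finally show ?thesis by (simp add: x_def algebra_simps add_divide_distrib)
qed

text \<open>Fatou's lemma in a form that also delivers the integrability of the limit, so that
  moments come out of Laplace transform expansions.\<close>

lemma nn_integral_Fatou_bound:
  fixes f :: "nat \<Rightarrow> real \<Rightarrow> real"
  assumes [measurable]: "\<And>n. f n \<in> borel_measurable \<mu>" "h \<in> borel_measurable \<mu>"
    and "\<And>n. AE s in \<mu>. 0 \<le> f n s" "AE s in \<mu>. (\<lambda>n. f n s) \<longlonglongrightarrow> h s"
    and "\<And>n. integrable \<mu> (f n)" "eventually (\<lambda>n. integral\<^sup>L \<mu> (f n) \<le> B) sequentially"
  shows "integrable \<mu> h" "integral\<^sup>L \<mu> h \<le> B"
proof -
  have "AE s in \<mu>. \<forall>n. 0 \<le> f n s" using assms(3) by (simp add: AE_all_countable)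
  then have h0: "AE s in \<mu>. 0 \<le> h s"
    using assms(4) by eventually_elim (auto intro: LIMSEQ_le_const)
  have "0 \<le> B"
  proof -
    obtain n where "integral\<^sup>L \<mu> (f n) \<le> B" using assms(6) by (auto simp: eventually_sequentially)
    then show ?thesis using integral_nonneg_AE[OF assms(3)[of n]] by linarith
  qed
  have "(\<integral>\<^sup>+s. ennreal (h s) \<partial>\<mu>) = (\<integral>\<^sup>+s. liminf (\<lambda>n. ennreal (f n s)) \<partial>\<mu>)"
  proof (rule nn_integral_cong_AE)
    show "AE s in \<mu>. ennreal (h s) = liminf (\<lambda>n. ennreal (f n s))"
      using assms(4)
    proof eventually_elim
      case (elim s)
      then have "(\<lambda>n. ennreal (f n s)) \<longlonglongrightarrow> ennreal (h s)" by (rule tendsto_ennrealI)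
      then show ?case by (simp add: lim_imp_Liminf)
    qed
  qed
  also have "\<dots> \<le> liminf (\<lambda>n. \<integral>\<^sup>+s. ennreal (f n s) \<partial>\<mu>)" by (rule nn_integral_liminf) measurable
  also have "\<dots> \<le> ennreal B"
  proof (rule Liminf_le)
    show "eventually (\<lambda>n. (\<integral>\<^sup>+s. ennreal (f n s) \<partial>\<mu>) \<le> ennreal B) sequentially"
      using assms(6)
    proof eventually_elim
      case (elim n)
      then show ?case using nn_integral_eq_integral[OF assms(5,3), of n] by (simp add: ennreal_leI)
    qed
  qed simp
  finally have b: "(\<integral>\<^sup>+s. ennreal (h s) \<partial>\<mu>) \<le> ennreal B" .
  show i: "integrable \<mu> h"
    by (rule integrableI_nonneg[OF _ h0]) (use b in \<open>auto intro: le_less_trans simp: ennreal_less_top\<close>)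
  show "integral\<^sup>L \<mu> h \<le> B"
    using b nn_integral_eq_integral[OF i h0] \<open>0 \<le> B\<close> by simp
qed

lemma inverse_Suc_filterlim: "filterlim (\<lambda>n. inverse (real (Suc n))) (at_right 0) sequentially"
  by (rule tendsto_imp_filterlim_at_right[OF LIMSEQ_inverse_real_of_nat]) auto

text \<open>Fatou along the difference quotients (1 - exp (- u s)) / u gives integrability and mean
  at most 1. Conversely, integrating 1 - u s <= exp (- u s), using the second-order upper bound for
  the transform and letting u tend to 0 gives at least 1.\<close>

lemma mean:
  shows mean_integrable: "integrable \<mu> (\<lambda>s. s)" and mean_eq: "(\<integral>s. s \<partial>\<mu>) = 1"
proof -
  let ?u = "\<lambda>n. inverse (real (Suc n))"
  have lim: "(\<lambda>n. (1 - exp (- ?u n * s)) / ?u n) \<longlonglongrightarrow> s" for s :: real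
  proof -
    have "((\<lambda>u. (1 - exp (- u * s)) / u) \<longlongrightarrow> s) (at_right 0)"
      by real_asymp
    from filterlim_compose[OF this inverse_Suc_filterlim] show ?thesis .
  qed
  have le: "(\<integral>s. (1 - exp (- ?u n * s)) / ?u n \<partial>\<mu>) \<le> 1" for n
    using laplace_ge[of "?u n"] exp_integrable[of "?u n"] prob_UNIV
    by (simp add: field_simps)
  show i: "integrable \<mu> (\<lambda>s. s)" 
    by (rule nn_integral_Fatou_bound(1)[where f="\<lambda>n s. (1 - exp (- ?u n * s)) / ?u n" and B=1])
      (use lim le exp_integrable[of "?u _"] AE_pos in \<open>auto elim!: eventually_mono\<close>)
  have le1: "(\<integral>s. s \<partial>\<mu>) \<le> 1" 
    by (rule nn_integral_Fatou_bound(2)[where f="\<lambda>n s. (1 - exp (- ?u n * s)) / ?u n" and B=1])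
      (use lim le exp_integrable[of "?u _"] AE_pos in \<open>auto elim!: eventually_mono\<close>)
  have "1 - (1 + q) * u / 2 \<le> (\<integral>s. s \<partial>\<mu>)" if u: "u > 0" "q * u \<le> 2" for u
  proof -
    have "(\<integral>s. 1 - u * s \<partial>\<mu>) \<le> (\<integral>s. exp (- u * s) \<partial>\<mu>)"
      using i exp_integrable[of u] u exp_ge_add_one_self[of "- u * s" for s]
      by (intro integral_mono) auto
    then have "1 - u * (\<integral>s. s \<partial>\<mu>) \<le> 1 - u + (1 + q) * u\<^sup>2 / 2"
      using laplace_le[of u] u i prob_UNIV by simp
    then have "u * (1 - (1 + q) * u / 2) \<le> u * (\<integral>s. s \<partial>\<mu>)" by (simp add: algebra_simps power2_eq_square)
    then show ?thesis using u by simp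
  qed
  then have ge: "eventually (\<lambda>u. 1 - (1 + q) * u / 2 \<le> (\<integral>s. s \<partial>\<mu>)) (at_right 0)"
    using q_pos by (intro eventually_at_rightI[of 0 "2 / q"]) (auto simp: field_simps)
  have lim1: "((\<lambda>u. 1 - (1 + q) * u / 2) \<longlongrightarrow> 1 - (1 + q) * 0 / 2) (at_right 0)"
    by (intro tendsto_intros) auto
  have "1 - (1 + q) * 0 / 2 \<le> (\<integral>s. s \<partial>\<mu>)"
    by (rule tendsto_upperbound[OF lim1 ge]) simp
  with le1 show "(\<integral>s. s \<partial>\<mu>) = 1" by simp
qed

text \<open>Fatou again, for the second-order remainder 2 (exp (- u s) - 1 + u s) / u^2, whose
  integral is controlled by \<open>laplace_le\<close> once \<open>q * u \<le> 2\<close>.\<close>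

lemma second_moment:
  shows second_moment_integrable: "integrable \<mu> (\<lambda>s. s\<^sup>2)" and second_moment_le: "(\<integral>s. s\<^sup>2 \<partial>\<mu>) \<le> 1 + q"
proof -
  let ?u = "\<lambda>n. inverse (real (Suc n))"
  let ?f = "\<lambda>n s. (exp (- ?u n * s) - 1 + ?u n * s) * 2 / (?u n)\<^sup>2"
  have lim: "(\<lambda>n. ?f n s) \<longlonglongrightarrow> s\<^sup>2" for s :: real
  proof -
    have "((\<lambda>u. (exp (- u * s) - 1 + u * s) * 2 / u\<^sup>2) \<longlongrightarrow> s * s) (at_right 0)"
      by real_asymp
    then have "((\<lambda>u. (exp (- u * s) - 1 + u * s) * 2 / u\<^sup>2) \<longlongrightarrow> s\<^sup>2) (at_right 0)"
      by (simp only: power2_eq_square)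
    from filterlim_compose[OF this inverse_Suc_filterlim] show ?thesis .
  qed
  have int: "integrable \<mu> (?f n)" for n
    using exp_integrable[of "?u n"] mean_integrable by simp
  have ev: "eventually (\<lambda>n. (\<integral>s. ?f n s \<partial>\<mu>) \<le> 1 + q) sequentially"
  proof -
    have "(\<lambda>n. q * ?u n) \<longlonglongrightarrow> q * 0" by (intro tendsto_intros LIMSEQ_inverse_real_of_nat)
    then have "eventually (\<lambda>n. q * ?u n < 2) sequentially" by (rule order_tendstoD) simp
    then show ?thesis
    proof eventually_elim
      case (elim n)
      have "(\<integral>s. ?f n s \<partial>\<mu>) = ((\<integral>s. exp (- ?u n * s) \<partial>\<mu>) - 1 + ?u n) * 2 / (?u n)\<^sup>2"
        using exp_integrable[of "?u n"] mean_integrable mean_eq prob_UNIV by simp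
      also have "\<dots> \<le> ((1 + q) * (?u n)\<^sup>2 / 2) * 2 / (?u n)\<^sup>2"
        using laplace_le[of "?u n"] elim by (intro divide_right_mono mult_right_mono) auto
      also have "\<dots> = 1 + q" by (simp add: field_simps)
      finally show ?case .
    qed
  qed
  have nn: "0 \<le> ?f n s" for n s
  proof -
    have "0 \<le> exp (- ?u n * s) - 1 + ?u n * s" using exp_ge_add_one_self[of "- ?u n * s"] by simp
    then show ?thesis by (intro divide_nonneg_nonneg mult_nonneg_nonneg) auto
  qed
  show "integrable \<mu> (\<lambda>s. s\<^sup>2)" 
    by (rule nn_integral_Fatou_bound(1)[where f="?f" and B="1 + q"]) (use lim int ev nn in \<open>simp_all del: of_nat_Suc\<close>)
  show "(\<integral>s. s\<^sup>2 \<partial>\<mu>) \<le> 1 + q"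
    by (rule nn_integral_Fatou_bound(2)[where f="?f" and B="1 + q"]) (use lim int ev nn in \<open>simp_all del: of_nat_Suc\<close>)
qed

text \<open>Pointwise, sqrt s is at most \<epsilon> for s <= \<epsilon>^2, at most \<epsilon> s for
  s > 1 / \<epsilon>^2, and a multiple of 1 - exp (- s) covers the range between. As the mean is 1,
  the first two cost 2 \<epsilon>, and the third vanishes when the Laplace transform at 1 tends to
  1.\<close>

lemma sqrt_mean_le:
  assumes "0 < \<epsilon>" "\<epsilon> \<le> 1"
  shows "(\<integral>s. sqrt s \<partial>\<mu>) \<le> 2 * \<epsilon> + (1 - exp (- ts_exponent \<alpha> v / v)) / (\<epsilon> * (1 - exp (- \<epsilon>\<^sup>2)))"
proof -
  let ?C = "1 / (\<epsilon> * (1 - exp (- \<epsilon>\<^sup>2)))"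
  have C: "1 - exp (- \<epsilon>\<^sup>2) > 0" using assms by simp
  have p: "sqrt s \<le> \<epsilon> + \<epsilon> * s + ?C * (1 - exp (- 1 * s))" if s: "s > 0" for s
  proof -
    have nn: "0 \<le> ?C * (1 - exp (- 1 * s))" using C s assms by simp
    consider "s \<le> \<epsilon>\<^sup>2" | "\<epsilon>\<^sup>2 < s" "s \<le> (1 / \<epsilon>)\<^sup>2" | "(1 / \<epsilon>)\<^sup>2 < s" by linarith
    then show ?thesis
    proof cases
      case 1
      then have "sqrt s \<le> \<epsilon>" using assms by (simp add: real_le_lsqrt)
      then show ?thesis using nn assms s by (smt (verit) mult_pos_pos)
    next
      case 2
      then have "sqrt s \<le> 1 / \<epsilon>" using assms by (simp add: real_le_lsqrt)
      also have "\<dots> \<le> ?C * (1 - exp (- 1 * s))"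
        using 2 C assms by (simp add: field_simps)
      finally show ?thesis using assms s by (smt (verit) mult_pos_pos)
    next
      case 3
      then have "1 / \<epsilon> < sqrt s" using assms by (intro real_less_rsqrt)
      then have "1 < \<epsilon> * sqrt s" using assms by (simp add: field_simps)
      then have "1 * sqrt s \<le> (\<epsilon> * sqrt s) * sqrt s" using s by (intro mult_right_mono) auto
      moreover have "(\<epsilon> * sqrt s) * sqrt s = \<epsilon> * s" using s by (simp add: mult.assoc)
      ultimately have "sqrt s \<le> \<epsilon> * s" by simp
      then show ?thesis using nn assms by linarith
    qed
  qed
  have i: "integrable \<mu> (\<lambda>s. \<epsilon> + \<epsilon> * s + ?C * (1 - exp (- 1 * s)))"
    using exp_integrable[of 1] mean_integrable by (intro Bochner_Integration.integrable_add integrable_mult_right Bochner_Integration.integrable_diff) auto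
  have "(\<integral>s. sqrt s \<partial>\<mu>) \<le> (\<integral>s. \<epsilon> + \<epsilon> * s + ?C * (1 - exp (- 1 * s)) \<partial>\<mu>)"
  proof (rule integral_mono_AE[OF _ i])
    show "integrable \<mu> (\<lambda>s. sqrt s)"
      by (rule Bochner_Integration.integrable_bound[OF i])
        (use AE_pos p in \<open>auto elim!: eventually_mono intro: order_trans[OF _ abs_ge_self]\<close>)
    show "AE s in \<mu>. sqrt s \<le> \<epsilon> + \<epsilon> * s + ?C * (1 - exp (- 1 * s))"
      using AE_pos by eventually_elim (rule p)
  qed
  also have "\<dots> = \<epsilon> + \<epsilon> + ?C * (1 - (\<integral>s. exp (- 1 * s) \<partial>\<mu>))"
    using exp_integrable[of 1] mean_integrable mean_eq prob_UNIV by simp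
  also have "(\<integral>s. exp (- 1 * s) \<partial>\<mu>) = exp (- ts_exponent \<alpha> v / v)"
    using laplace[of 1] by simp
  finally show ?thesis by simp
qed

text \<open>On [0,1] the chord of the convex function exp (- s) gives s <= (1 - exp (- s)) / (1 -
  exp (- 1)); beyond 1 the left side is nonpositive. A Laplace transform at 1 close to 1 thus forces
  the expectation close to 1.\<close>

lemma put_on_mean_ge:
  "1 - (1 - exp (- ts_exponent \<alpha> v / v)) / (1 - exp (- 1)) \<le> (\<integral>s. max 0 (1 - s) \<partial>\<mu>)"
proof -
  let ?A = "1 / (1 - exp (- 1 :: real))"
  have A: "1 - exp (- 1 :: real) > 0" by simp
  have "(\<integral>s. 1 - ?A * (1 - exp (- 1 * s)) \<partial>\<mu>) \<le> (\<integral>s. max 0 (1 - s) \<partial>\<mu>)"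
  proof (rule integral_mono_AE)
    show "integrable \<mu> (\<lambda>s. 1 - ?A * (1 - exp (- 1 * s)))"
      using exp_integrable[of 1] by (intro Bochner_Integration.integrable_diff integrable_mult_right) auto
    show "integrable \<mu> (\<lambda>s. max 0 (1 - s))"
      using mean_integrable by (intro Bochner_Integration.integrable_max) auto
    show "AE s in \<mu>. 1 - ?A * (1 - exp (- 1 * s)) \<le> max 0 (1 - s)"
      using AE_pos
    proof eventually_elim
      case (elim s)
      show ?case
      proof (cases "s \<ge> 1")
        case True
        then show ?thesis using A by (simp add: field_simps)
      next
        case False
        have "convex_on UNIV (\<lambda>x::real. exp x)" by (rule exp_convex)
        then have "exp ((1 - s) *\<^sub>R 0 + s *\<^sub>R (- 1)) \<le> (1 - s) * exp 0 + s * exp (- 1 :: real)"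
          using False elim by (intro convex_onD) auto
        then have "s * (1 - exp (- 1)) \<le> 1 - exp (- s)" by (simp add: algebra_simps)
        then have "s \<le> ?A * (1 - exp (- 1 * s))" using A by (simp add: field_simps)
        then show ?thesis by simp
      qed
    qed
  qed
  also have "(\<integral>s. 1 - ?A * (1 - exp (- 1 * s)) \<partial>\<mu>) = 1 - ?A * (1 - (\<integral>s. exp (- 1 * s) \<partial>\<mu>))"
    using exp_integrable[of 1] prob_UNIV by simp
  also have "(\<integral>s. exp (- 1 * s) \<partial>\<mu>) = exp (- ts_exponent \<alpha> v / v)"
    using laplace[of 1] by simp
  finally show ?thesis by simp
qed

text \<open>The standardised variable \<open>W = (s - 1) / \<kappa>\<close> with \<open>\<kappa> = sqrt q\<close> has
  \<open>E exp (- W) \<ge> 1 + D\<close> and \<open>E exp (- 2 W) \<le> exp 2\<close>; this forces its negative part to carry mass.\<close>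

lemma put_on_mean_ge_sqrt:
  assumes "v \<le> V"
  shows "sqrt q / (16 * exp 2 * (1 + sqrt (V / (1 - \<alpha>)))\<^sup>2) \<le> (\<integral>s. max 0 (1 - s) \<partial>\<mu>)"
proof -
  define \<kappa> where "\<kappa> = sqrt q"
  have k: "\<kappa> > 0" "\<kappa>\<^sup>2 = q" using q_pos by (auto simp: \<kappa>_def)
  \<comment> \<open>The strict exponent bound at u = 1 / \<kappa> gives the excess 1 / (2 (1 + v /
    \<kappa>)), where v / \<kappa> = sqrt (v / (1 - \<alpha>)); replacing v by its bound V makes it
    uniform.\<close>
  define D where "D = 1 / (2 * (1 + sqrt (V / (1 - \<alpha>))))"
  have V: "V / (1 - \<alpha>) > 0" using assms v_pos alpha by simp
  then have D: "D > 0" by (simp add: D_def add_pos_pos)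
  \<comment> \<open>Chosen so that \<epsilon> times the bound exp 2 for E exp (- 2 W) consumes
    exactly half of the excess D.\<close>
  define \<epsilon> where "\<epsilon> = D / (2 * exp 2)"
  have e: "\<epsilon> > 0" using D by (simp add: \<epsilon>_def)
  have E: "(\<integral>s. exp (- (l * ((s - 1) / \<kappa>))) \<partial>\<mu>) = exp (l / \<kappa> - ts_exponent \<alpha> (v * (l / \<kappa>)) / v)"
    and Ei: "integrable \<mu> (\<lambda>s. exp (- (l * ((s - 1) / \<kappa>))))" if "l \<ge> 0" for l
  proof -
    have eq: "(\<lambda>s. exp (- (l * ((s - 1) / \<kappa>)))) = (\<lambda>s. exp (l / \<kappa>) * exp (- (l / \<kappa>) * s))"
      using k by (auto simp: fun_eq_iff exp_add[symmetric] field_simps)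
    have lk: "l / \<kappa> \<ge> 0" using that k by simp
    show "integrable \<mu> (\<lambda>s. exp (- (l * ((s - 1) / \<kappa>))))"
      unfolding eq using exp_integrable[OF lk] by (rule integrable_mult_right)
    show "(\<integral>s. exp (- (l * ((s - 1) / \<kappa>))) \<partial>\<mu>) = exp (l / \<kappa> - ts_exponent \<alpha> (v * (l / \<kappa>)) / v)"
      unfolding eq integral_mult_right_zero laplace[OF lk] by (simp add: exp_add[symmetric])
  qed
  have E2: "(\<integral>s. exp (- (2 * ((s - 1) / \<kappa>))) \<partial>\<mu>) \<le> exp 2"
    using ts_exponent_ge_v[of "2 / \<kappa>"] k E[of 2] q_pos by (simp add: power_divide)
  have E1: "1 + D \<le> (\<integral>s. exp (- (1 * ((s - 1) / \<kappa>))) \<partial>\<mu>)"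
  proof -
    have vk: "v / \<kappa> > 0" using v_pos k by simp
    have "v / \<kappa> = sqrt (v / (1 - \<alpha>))"
    proof (rule real_sqrt_unique[symmetric])
      show "(v / \<kappa>)\<^sup>2 = v / (1 - \<alpha>)"
        using k v_pos alpha by (simp add: power_divide q_def power2_eq_square)
    qed (use vk in auto)
    also have "\<dots> \<le> sqrt (V / (1 - \<alpha>))" using assms alpha by (simp add: divide_right_mono)
    finally have vkV: "v / \<kappa> \<le> sqrt (V / (1 - \<alpha>))" .
    have "D \<le> 1 / (2 * (1 + v / \<kappa>))" unfolding D_def
      using vkV vk by (intro divide_left_mono) (auto intro!: mult_pos_pos add_pos_pos)
    also have "\<dots> = (1 - \<alpha>) * (v / \<kappa>)\<^sup>2 / (2 * (1 + v / \<kappa>)) / v"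
      using k v_pos alpha by (simp add: power_divide q_def power2_eq_square)
    also have "\<dots> \<le> (v / \<kappa> - ts_exponent \<alpha> (v / \<kappa>)) / v"
      using ts_exponent_le_strict[of "v / \<kappa>" \<alpha>] vk alpha v_pos by (intro divide_right_mono) auto
    also have "\<dots> = 1 / \<kappa> - ts_exponent \<alpha> (v * (1 / \<kappa>)) / v"
      using v_pos by (simp add: diff_divide_distrib)
    finally have "1 + D \<le> exp (1 / \<kappa> - ts_exponent \<alpha> (v * (1 / \<kappa>)) / v)"
      using exp_ge_add_one_self[of "1 / \<kappa> - ts_exponent \<alpha> (v * (1 / \<kappa>)) / v"] by linarith
    then show ?thesis using E[of 1] by simp
  qed
  \<comment> \<open>Where exp x <= 1 / \<epsilon>, exp x - 1 <= x exp x is linear in x; elsewhere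
    exp x is absorbed by \<epsilon> exp (2 x). This trades the exponential moment for a first moment
    of the positive part.\<close>
  have p: "exp x - 1 \<le> max 0 x / \<epsilon> + \<epsilon> * exp (2 * x)" for x :: real
  proof (cases "x \<le> 0")
    case True
    then show ?thesis using e by (simp add: max_def) (smt (verit) exp_gt_zero exp_le_one_iff mult_pos_pos)
  next
    case False
    show ?thesis
    proof (cases "exp x \<le> 1 / \<epsilon>")
      case True
      have "exp x - 1 \<le> x * exp x"
        using exp_ge_add_one_self[of "- x"] mult_left_mono[of "1 - x" "exp (- x)" "exp x"]
        by (simp add: exp_minus algebra_simps)
      also have "\<dots> \<le> x * (1 / \<epsilon>)" using True False by (intro mult_left_mono) auto
      also have "\<dots> \<le> max 0 x / \<epsilon> + \<epsilon> * exp (2 * x)" using e False by (simp add: max_def)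
      finally show ?thesis .
    next
      case c: False
      then have "1 \<le> \<epsilon> * exp x" using e by (simp add: field_simps)
      then have "exp x * 1 \<le> exp x * (\<epsilon> * exp x)" by (intro mult_left_mono) auto
      also have "\<dots> = \<epsilon> * exp (2 * x)" by (simp add: exp_add[symmetric] mult.left_commute)
      finally show ?thesis using e by (smt (verit) divide_nonneg_pos max.cobounded1)
    qed
  qed
  let ?W = "\<lambda>s. - ((s - 1) / \<kappa>)"
  have iW: "integrable \<mu> (\<lambda>s. max 0 (?W s))" 
    using mean_integrable by (intro Bochner_Integration.integrable_max) auto
  have "(\<integral>s. exp (?W s) - 1 \<partial>\<mu>) \<le> (\<integral>s. max 0 (?W s) / \<epsilon> + \<epsilon> * exp (2 * ?W s) \<partial>\<mu>)"
  proof (rule integral_mono)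
    show "integrable \<mu> (\<lambda>s. exp (?W s) - 1)" using Ei[of 1] by simp
    show "integrable \<mu> (\<lambda>s. max 0 (?W s) / \<epsilon> + \<epsilon> * exp (2 * ?W s))" using Ei[of 2] iW by simp
  qed (rule p)
  also have "\<dots> = (\<integral>s. max 0 (?W s) \<partial>\<mu>) / \<epsilon> + \<epsilon> * (\<integral>s. exp (2 * ?W s) \<partial>\<mu>)"
    using Ei[of 2] iW by simp
  also have "(\<integral>s. max 0 (?W s) \<partial>\<mu>) = (\<integral>s. max 0 (1 - s) / \<kappa> \<partial>\<mu>)"
    using k by (intro Bochner_Integration.integral_cong) (auto simp: max_def field_simps)
  also have "(\<integral>s. max 0 (1 - s) / \<kappa> \<partial>\<mu>) = (\<integral>s. max 0 (1 - s) \<partial>\<mu>) / \<kappa>" by simp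
  finally have "D \<le> (\<integral>s. max 0 (1 - s) \<partial>\<mu>) / \<kappa> / \<epsilon> + \<epsilon> * exp 2"
  proof -
    assume *: "(\<integral>s. exp (?W s) - 1 \<partial>\<mu>) \<le> (\<integral>s. max 0 (1 - s) \<partial>\<mu>) / \<kappa> / \<epsilon> + \<epsilon> * (\<integral>s. exp (2 * ?W s) \<partial>\<mu>)"
    have "(\<integral>s. exp (?W s) - 1 \<partial>\<mu>) \<ge> D" using E1 Ei[of 1] prob_UNIV by simp
    moreover have "(\<integral>s. exp (2 * ?W s) \<partial>\<mu>) \<le> exp 2" using E2 by simp
    then have "\<epsilon> * (\<integral>s. exp (2 * ?W s) \<partial>\<mu>) \<le> \<epsilon> * exp 2" using e by (intro mult_left_mono) auto
    ultimately show ?thesis using * by linarith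
  qed
  also have "\<epsilon> * exp 2 = D / 2" by (simp add: \<epsilon>_def)
  finally have "D / 2 \<le> (\<integral>s. max 0 (1 - s) \<partial>\<mu>) / \<kappa> / \<epsilon>" by linarith
  then have "D / 2 * \<epsilon> * \<kappa> \<le> (\<integral>s. max 0 (1 - s) \<partial>\<mu>)" using e k by (simp add: field_simps)
  moreover have "D / 2 * \<epsilon> * \<kappa> = sqrt q / (16 * exp 2 * (1 + sqrt (V / (1 - \<alpha>)))\<^sup>2)"
  proof -
    have A: "D / 2 * (D / (2 * exp 2)) * k = k / (16 * exp 2 * r\<^sup>2)" if "D = 1 / (2 * r)" for r k
      using that by (simp add: power2_eq_square)
    show ?thesis unfolding \<epsilon>_def \<kappa>_def by (rule A[OF D_def])
  qed
  ultimately show ?thesis by simp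
qed

end

section \<open>Positive median of the limit law\<close>

text \<open>A Gil-Pelaez inversion at 0: by Fubini the integral up to T is the expectation of sgn Y
  Si (T |Y|), and Si tends to pi / 2 while staying bounded. Fubini is justified by |sin (u y) / u|
  <= |y| and the first moment.\<close>

lemma char_sign_integral:
  assumes "real_distribution Q" "integrable Q (\<lambda>y. y)"
  shows "set_integrable lborel {0<..<T} (\<lambda>u. Im (char Q u) / u)"
    and "((\<lambda>T. LINT u:{0<..<T}|lborel. Im (char Q u) / u) \<longlongrightarrow>
           pi / 2 * (measure Q {0<..} - measure Q {..<0})) at_top"
proof -
  interpret Q: real_distribution Q by fact
  interpret PQ: pair_sigma_finite lborel Q by unfold_locales
  have Im_char: "Im (char Q u) = (\<integral>y. sin (u * y) \<partial>Q)" for u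
  proof -
    have "integrable Q (\<lambda>y. iexp (u * y))" by (rule Q.integrable_iexp) auto
    then have "Im (\<integral>y. iexp (u * y) \<partial>Q) = (\<integral>y. Im (iexp (u * y)) \<partial>Q)" by simp
    then show ?thesis by (simp add: char_def Im_exp)
  qed
  let ?f = "\<lambda>T u y. indicator {0<..<T} u * (sin (u * y) / u)"
  have bnd: "\<bar>sin (u * y) / u\<bar> \<le> \<bar>y\<bar>" for u y :: real
  proof (cases "u = 0")
    case False
    then show ?thesis using abs_sin_x_le_abs_x[of "u * y"]
      by (simp add: abs_divide abs_mult pos_divide_le_eq mult.commute)
  qed simp
  have int: "integrable (lborel \<Otimes>\<^sub>M Q) (\<lambda>(u, y). ?f T u y)" for T
  proof (rule PQ.Fubini_integrable)
    have sin_int: "integrable Q (\<lambda>y. ?f T u y)" for u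
    proof (rule Bochner_Integration.integrable_bound[OF assms(2)])
      show "AE y in Q. norm (?f T u y) \<le> norm y"
        using bnd[of u] by (intro AE_I2) (auto simp: indicator_def)
    qed measurable
    have le: "(\<integral>y. \<bar>?f T u y\<bar> \<partial>Q) \<le> indicator {0<..<T} u * (\<integral>y. \<bar>y\<bar> \<partial>Q)" for u
    proof -
      have "(\<integral>y. \<bar>?f T u y\<bar> \<partial>Q) \<le> (\<integral>y. indicator {0<..<T} u * \<bar>y\<bar> \<partial>Q)"
      proof (rule integral_mono[OF integrable_abs[OF sin_int]])
        show "integrable Q (\<lambda>y. indicator {0<..<T} u * \<bar>y\<bar>)"
          using assms(2) by (intro integrable_mult_right integrable_abs)
        show "\<bar>?f T u y\<bar> \<le> indicator {0<..<T} u * \<bar>y\<bar>" for y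
          using bnd[of u y] by (auto simp: indicator_def)
      qed
      then show ?thesis by simp
    qed
    show "integrable lborel (\<lambda>u. \<integral>y. norm (case (u, y) of (u, y) \<Rightarrow> ?f T u y) \<partial>Q)"
    proof (rule Bochner_Integration.integrable_bound)
      show "integrable lborel (\<lambda>u. indicator {0<..<T} u * (\<integral>y. \<bar>y\<bar> \<partial>Q))"
        by (intro integrable_mult_left integrable_real_indicator; cases "0 \<le> T") auto
      show "AE u in lborel. norm (\<integral>y. norm (case (u, y) of (u, y) \<Rightarrow> ?f T u y) \<partial>Q)
          \<le> norm (indicator {0<..<T} u * (\<integral>y. \<bar>y\<bar> \<partial>Q))"
        using le by (auto intro!: AE_I2 order_trans[OF _ abs_ge_self])
    qed measurable
    show "AE u in lborel. integrable Q (\<lambda>y. case (u, y) of (u, y) \<Rightarrow> ?f T u y)"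
      using sin_int by simp
  qed measurable
  from PQ.integrable_fst'[OF int] show "set_integrable lborel {0<..<T} (\<lambda>u. Im (char Q u) / u)"
    by (simp add: set_integrable_def Im_char)
  have eq: "(LINT u:{0<..<T}|lborel. Im (char Q u) / u) = (\<integral>y. sgn y * Si (T * \<bar>y\<bar>) \<partial>Q)" if "T \<ge> 0" for T
  proof -
    have "(LINT u:{0<..<T}|lborel. Im (char Q u) / u) = (\<integral>u. (\<integral>y. ?f T u y \<partial>Q) \<partial>lborel)"
      by (simp add: set_lebesgue_integral_def Im_char)
    also have "\<dots> = (\<integral>y. (\<integral>u. ?f T u y \<partial>lborel) \<partial>Q)"
      using PQ.Fubini_integral[OF int] by simp
    also have "\<dots> = (\<integral>y. sgn y * Si (T * \<bar>y\<bar>) \<partial>Q)"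
      using LBINT_I0c_sin_scale_divide[OF that] that
      by (intro Bochner_Integration.integral_cong)
         (auto simp: interval_lebesgue_integral_def set_lebesgue_integral_def zero_ereal_def)
    finally show ?thesis .
  qed
  obtain B where B: "\<And>T. \<bar>Si T\<bar> \<le> B" using bounded_Si by blast
  have L: "((\<lambda>T. \<integral>y. sgn y * Si (T * \<bar>y\<bar>) \<partial>Q) \<longlongrightarrow> (\<integral>y. sgn y * (pi / 2) \<partial>Q)) at_top"
  proof (rule integral_dominated_convergence_at_top[where w="\<lambda>_. B"])
    show "eventually (\<lambda>T. AE y in Q. norm (sgn y * Si (T * \<bar>y\<bar>)) \<le> B) at_top"
      using B order_trans[OF abs_ge_zero B] by (auto simp: abs_mult sgn_if)
    show "AE y in Q. ((\<lambda>T. sgn y * Si (T * \<bar>y\<bar>)) \<longlongrightarrow> sgn y * (pi / 2)) at_top"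
    proof (rule AE_I2)
      fix y :: real
      show "((\<lambda>T. sgn y * Si (T * \<bar>y\<bar>)) \<longlongrightarrow> sgn y * (pi / 2)) at_top"
      proof (cases "y = 0")
        case False
        then have "filterlim (\<lambda>T. T * \<bar>y\<bar>) at_top at_top"
          by (intro filterlim_at_top_mult_tendsto_pos[OF tendsto_const] filterlim_ident) auto
        then show ?thesis by (intro tendsto_mult tendsto_const filterlim_compose[OF Si_at_top])
      qed simp
    qed
  qed auto
  have E: "(\<integral>y. sgn y * (pi / 2) \<partial>Q) = pi / 2 * (measure Q {0<..} - measure Q {..<0})"
  proof -
    have "(\<lambda>y. sgn y * (pi / 2)) = (\<lambda>y::real. pi / 2 * (indicator {0<..} y - indicator {..<0} y))"
      by (auto simp: fun_eq_iff sgn_if)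
    moreover have "integrable Q (indicator {0<..} :: real \<Rightarrow> real)" "integrable Q (indicator {..<0} :: real \<Rightarrow> real)"
      by (auto intro!: integrable_real_indicator simp: Q.emeasure_eq_measure)
    ultimately show ?thesis by simp
  qed
  have ev: "eventually (\<lambda>T. (\<integral>y. sgn y * Si (T * \<bar>y\<bar>) \<partial>Q) = (LINT u:{0<..<T}|lborel. Im (char Q u) / u)) at_top"
    using eventually_ge_at_top[of 0] by eventually_elim (simp add: eq)
  show "((\<lambda>T. LINT u:{0<..<T}|lborel. Im (char Q u) / u) \<longlongrightarrow>
       pi / 2 * (measure Q {0<..} - measure Q {..<0})) at_top"
    by (rule Lim_transform_eventually[OF L[unfolded E] ev])
qed

text \<open>Write \<open>V = 1 - cos \<theta>\<close> and \<open>g = r / \<kappa>\<close>, so that the integrand is \<open>g V'\<close> with \<open>g\<close> decreasing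
  and \<open>V \<ge> 0\<close>. Past \<open>b\<close> it dominates \<open>(g V)'\<close>; before \<open>b\<close>, where \<open>V' \<ge> 0\<close>, it is bounded below
  through the values of \<open>g\<close> at \<open>a\<close> and \<open>b\<close>.\<close>

lemma oscillating_integral_pos:
  fixes r \<theta> \<kappa> r' \<kappa>' :: "real \<Rightarrow> real"
  assumes theta0: "isCont \<theta> 0" "\<theta> 0 = 0"
    and deriv: "\<And>u. u > 0 \<Longrightarrow> (\<theta> has_real_derivative \<kappa> u / u) (at u)"
      "\<And>u. u > 0 \<Longrightarrow> (r has_real_derivative r' u) (at u)"
      "\<And>u. u > 0 \<Longrightarrow> (\<kappa> has_real_derivative \<kappa>' u) (at u)"
    and sgn: "\<And>u. u > 0 \<Longrightarrow> r u > 0" "\<And>u. u > 0 \<Longrightarrow> r' u < 0"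
      "\<And>u. u > 0 \<Longrightarrow> \<kappa> u > 0" "\<And>u. u > 0 \<Longrightarrow> \<kappa>' u \<ge> 0"
    and int: "\<And>T. (\<lambda>u. r u * sin (\<theta> u) / u) integrable_on {0..T}"
  obtains d b where "d > 0" "\<And>T. T \<ge> b \<Longrightarrow> d \<le> integral {0..T} (\<lambda>u. r u * sin (\<theta> u) / u)"
proof -
  define g where "g u = r u / \<kappa> u" for u
  define g' where "g' u = (r' u * \<kappa> u - r u * \<kappa>' u) / (\<kappa> u * \<kappa> u)" for u
  define V where "V u = 1 - cos (\<theta> u)" for u
  define V' where "V' u = sin (\<theta> u) * (\<kappa> u / u)" for u
  let ?F = "\<lambda>u. r u * sin (\<theta> u) / u"
  have gd: "(g has_real_derivative g' u) (at u)" if "u > 0" for u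
    unfolding g_def g'_def using sgn(3)[OF that] by (intro DERIV_divide deriv that) auto
  have g'neg: "g' u < 0" if "u > 0" for u
  proof -
    have "r' u * \<kappa> u < 0" "r u * \<kappa>' u \<ge> 0" using sgn[OF that] by (auto simp: mult_less_0_iff)
    then show ?thesis using sgn(3)[OF that] by (simp add: g'_def divide_neg_pos)
  qed
  have gpos: "g u > 0" if "u > 0" for u using sgn[OF that] by (simp add: g_def)
  have gdec: "g y < g x" if "0 < x" "x < y" for x y
    using that gd g'neg by (intro DERIV_neg_imp_decreasing[OF that(2)]) (metis less_le_trans)
  have Vd: "(V has_real_derivative V' u) (at u)" if "u > 0" for u
    unfolding V_def V'_def using deriv(1)[OF that] by (auto intro!: derivative_eq_intros)
  have V0: "V u \<ge> 0" for u by (simp add: V_def)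
  have F: "?F u = g u * V' u" if "u > 0" for u
    using sgn(3)[OF that] by (simp add: g_def V'_def field_simps)
  have th_cont: "isCont \<theta> u" if "u \<ge> 0" for u
    using that theta0 DERIV_isCont[OF deriv(1)[of u]] by (cases "u = 0") auto
  have Vc: "continuous_on A V" if "A \<subseteq> {0..}" for A
    unfolding V_def using that th_cont by (intro continuous_intros continuous_at_imp_continuous_on) auto
  \<comment> \<open>Up to b the phase stays below pi in absolute value, hence sin \<theta> >= 0 and
    V increases there.\<close>
  obtain b where b: "b > 0" "\<And>u. 0 \<le> u \<Longrightarrow> u \<le> b \<Longrightarrow> \<bar>\<theta> u\<bar> < pi"
  proof -
    have "eventually (\<lambda>u. \<theta> u > - pi \<and> \<theta> u < pi) (nhds 0)"
      using theta0 unfolding isCont_def tendsto_at_iff_tendsto_nhds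
      by (intro eventually_conj order_tendstoD) auto
    then obtain e where e: "e > 0" "\<And>u. dist u 0 < e \<Longrightarrow> \<theta> u > - pi \<and> \<theta> u < pi"
      unfolding eventually_nhds_metric by blast
    show ?thesis
    proof (rule that[of "e / 2"])
      fix u assume "0 \<le> u" "u \<le> e / 2"
      then show "\<bar>\<theta> u\<bar> < pi" using e(2)[of u] e(1) by (auto simp: abs_less_iff)
    qed (use e in auto)
  qed
  have th_pos: "\<theta> u > 0" if "u > 0" for u
  proof -
    have "\<theta> 0 < \<theta> u"
    proof (rule DERIV_pos_imp_increasing_open[OF that])
      fix x assume "0 < x" "x < u"
      then show "\<exists>y. (\<theta> has_real_derivative y) (at x) \<and> 0 < y"
        using deriv(1)[of x] sgn(3)[of x] by (intro exI[of _ "\<kappa> x / x"]) auto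
    qed (use th_cont in \<open>auto intro!: continuous_at_imp_continuous_on\<close>)
    then show ?thesis using theta0 by simp
  qed
  have V'0: "V' u \<ge> 0" if "0 < u" "u \<le> b" for u
    using th_pos[OF that(1)] b(2)[of u] that sgn(3)[OF that(1)]
    unfolding V'_def by (intro mult_nonneg_nonneg sin_ge_zero divide_nonneg_pos) auto
  \<comment> \<open>Any interior point would do: splitting there makes the strict decrease of g
    visible as the gap g a - g b.\<close>
  define a where "a = b / 2"
  have ab: "0 < a" "a < b" using b(1) by (auto simp: a_def)
  have Va: "V a > 0"
    using th_pos[OF ab(1)] b(2)[of a] ab cos_monotone_0_pi[of 0 "\<theta> a"] by (simp add: V_def)
  have seg: "g y * (V y - V x) \<le> integral {x..y} ?F" if "0 \<le> x" "x \<le> y" "0 < y" "y \<le> b" for x y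
  proof -
    have hi: "((\<lambda>u. g y * V' u) has_integral g y * (V y - V x)) {x..y}"
      using that Vd by (intro has_integral_mult_right fundamental_theorem_of_calculus_interior Vc)
        (auto simp: has_real_derivative_iff_has_vector_derivative[symmetric])
    have "?F integrable_on {x..y}" by (rule integrable_subinterval_real[OF int[of y]]) (use that in auto)
    then have hF: "(?F has_integral integral {x..y} ?F) {x..y}" by (rule integrable_integral)
    show ?thesis
    proof (rule has_integral_le[OF hi hF])
      fix u assume u: "u \<in> {x..y}"
      show "g y * V' u \<le> ?F u"
      \<comment> \<open>At the endpoint 0 both integrands take the value 0, since
        \<open>\<theta> 0 = 0\<close> and division by zero is zero.\<close>
      proof (cases "u = 0")
        case True
        then show ?thesis using theta0 by (simp add: V'_def)
      next
        case False
        then have "0 < u" "u \<le> b" "u \<le> y" using u that by auto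
        then have "g y \<le> g u" using gdec[of u y] by (cases "u = y") auto
        then have "g y * V' u \<le> g u * V' u" using V'0[of u] \<open>0 < u\<close> \<open>u \<le> b\<close> by (intro mult_right_mono) auto
        then show ?thesis using F[OF \<open>0 < u\<close>] by simp
      qed
    qed
  qed
  have tail: "g T * V T - g b * V b \<le> integral {b..T} ?F" if "b \<le> T" for T
  proof -
    have hi: "((\<lambda>u. g' u * V u + V' u * g u) has_integral g T * V T - g b * V b) {b..T}"
    proof (rule fundamental_theorem_of_calculus[OF that])
      fix u assume "u \<in> {b..T}"
      then have "u > 0" using b by auto
      then show "((\<lambda>u. g u * V u) has_vector_derivative g' u * V u + V' u * g u) (at u within {b..T})"
        using DERIV_mult[OF gd Vd, of u] 
        by (auto simp: has_real_derivative_iff_has_vector_derivative[symmetric] intro: has_field_derivative_at_within)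
    qed
    have "?F integrable_on {b..T}" by (rule integrable_subinterval_real[OF int[of T]]) (use that b in auto)
    then have hF: "(?F has_integral integral {b..T} ?F) {b..T}" by (rule integrable_integral)
    show ?thesis
    proof (rule has_integral_le[OF hi hF])
      fix u assume "u \<in> {b..T}"
      then have u: "u > 0" using b by auto
      have "g' u * V u \<le> 0" using g'neg[OF u] V0[of u] by (simp add: mult_le_0_iff)
      then show "g' u * V u + V' u * g u \<le> ?F u" using F[OF u] by (simp add: mult.commute)
    qed
  qed
  show ?thesis
  proof (rule that[of "V a * (g a - g b)" b])
    show "V a * (g a - g b) > 0" using Va gdec[OF ab] by simp
    fix T assume T: "b \<le> T"
    \<comment> \<open>Adding the three lower bounds, g b V b cancels and V a (g a - g b) + g T V T
      remains.\<close>
    have "integral {0..T} ?F = integral {0..a} ?F + integral {a..b} ?F + integral {b..T} ?F"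
      using T ab int[of T] Henstock_Kurzweil_Integration.integral_combine[where a=0 and c=b and b=T and f="?F"]
          Henstock_Kurzweil_Integration.integral_combine[where a=0 and c=a and b=b and f="?F"]
        integrable_subinterval_real[OF int[of T], of 0 b] by simp
    moreover have "g a * (V a - V 0) \<le> integral {0..a} ?F" using ab by (intro seg) auto
    moreover have "g b * (V b - V a) \<le> integral {a..b} ?F" using ab by (intro seg) auto
    moreover have "V 0 = 0" using theta0 by (simp add: V_def)
    moreover have "0 \<le> g T * V T" using gpos[of T] T b V0[of T] by simp
    ultimately show "V a * (g a - g b) \<le> integral {0..T} ?F"
      using tail[OF T] by (simp add: algebra_simps)
  qed
qed

text \<open>The argument of w lies in (0, pi/2), so multiplied by s it lies in [- pi, 0], where the
  sine is nonpositive.\<close>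

lemma Im_powr_nonpos:
  assumes "Re w > 0" "Im w > 0" "- 2 \<le> s" "s \<le> 0"
  shows "Im (w powr of_real s) \<le> 0"
proof -
  have w: "w \<noteq> 0" using assms by auto
  define \<omega> where "\<omega> = Im (Ln w)"
  have om: "0 < \<omega>" "\<omega> < pi / 2" using Im_Ln_pos_lt_imp[OF assms(2)] Re_Ln_pos_lt_imp[OF assms(1)] by (auto simp: \<omega>_def)
  have "Im (w powr of_real s) = exp (s * Re (Ln w)) * sin (s * \<omega>)"
    using w by (simp add: powr_def Im_exp \<omega>_def)
  moreover have "sin ((- s) * \<omega>) \<ge> 0"
  proof (rule sin_ge_zero)
    have "- s * \<omega> \<le> 2 * \<omega>" using om assms by (intro mult_right_mono) auto
    then show "- s * \<omega> \<le> pi" using om by simp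
  qed (use om assms in \<open>auto intro!: mult_nonneg_nonneg simp: mult_nonpos_nonneg\<close>)
  ultimately show ?thesis by (simp add: mult_nonneg_nonpos)
qed

text \<open>For s in [-1, 0) the power turns the open first quadrant into the open fourth, and it
  does not raise the modulus above 1 since |w| >= 1.\<close>

lemma powr_neg_facts:
  assumes "Re w \<ge> 1" "Im w > 0" "- 1 \<le> s" "s < 0"
  shows "Re (w powr of_real s) > 0" "Re (w powr of_real s) \<le> 1" "Im (w powr of_real s) < 0"
proof -
  have w: "w \<noteq> 0" using assms by auto
  define \<omega> where "\<omega> = Im (Ln w)"
  have om: "0 < \<omega>" "\<omega> < pi / 2"
    using Im_Ln_pos_lt_imp[OF assms(2)] Re_Ln_pos_lt_imp[of w] assms(1) by (auto simp: \<omega>_def)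
  have "- s * \<omega> \<le> 1 * \<omega>" using om assms by (intro mult_right_mono) auto
  then have so: "0 < - s * \<omega>" "- s * \<omega> < pi / 2" using om assms by (auto simp: mult_neg_pos)
  have "Re (w powr of_real s) = exp (s * Re (Ln w)) * cos (- s * \<omega>)"
    "Im (w powr of_real s) = exp (s * Re (Ln w)) * - sin (- s * \<omega>)"
    using w by (auto simp: powr_def Im_exp Re_exp \<omega>_def)
  moreover have "cos (- s * \<omega>) > 0" using so by (intro cos_gt_zero_pi) linarith+
  moreover have "sin (- s * \<omega>) > 0" using so by (intro sin_gt_zero) linarith+
  moreover have "exp (s * Re (Ln w)) \<le> 1"
  proof -
    have "norm w \<ge> 1" using complex_Re_le_cmod[of w] assms(1) by linarith
    then have "Re (Ln w) \<ge> 0" using w by (simp add: Re_Ln)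
    then show ?thesis using assms by (simp add: mult_nonpos_nonneg)
  qed
  ultimately show "Re (w powr of_real s) > 0" "Re (w powr of_real s) \<le> 1" "Im (w powr of_real s) < 0"
    using mult_mono[of "exp (s * Re (Ln w))" 1 "cos (- s * \<omega>)" 1]
    by (auto simp: mult_pos_neg simp del: mult_minus_left)
qed

lemma (in mixing) mixlaw_integrable_ident:
  assumes "integrable \<mu> (\<lambda>s. s)" "integrable \<mu> (\<lambda>s. s\<^sup>2)"
  shows "integrable (mixlaw \<mu> a b c) (\<lambda>y. y)"
proof -
  interpret Q: real_distribution "mixlaw \<mu> a b c" by (rule real_distribution_mixlaw)
  have "integrable (mixlaw \<mu> a b c) (\<lambda>y. 1 + y\<^sup>2)"
    using mixlaw_second_moment(1)[OF assms] by simp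
  then show ?thesis
  proof (rule Bochner_Integration.integrable_bound)
    have "\<bar>y\<bar> \<le> 1 + y\<^sup>2" for y :: real
    proof -
      have "0 \<le> (\<bar>y\<bar> - 1)\<^sup>2" by simp
      then have "2 * \<bar>y\<bar> \<le> 1 + y\<^sup>2" by (simp add: power2_diff)
      then show ?thesis by simp
    qed
    then show "AE y in mixlaw \<mu> a b c. norm y \<le> norm (1 + y\<^sup>2)"
      by (auto intro!: AE_I2 order_trans[OF _ abs_ge_self])
  qed auto
qed

lemma (in mixing) mixlaw_negative_part_pos:
  assumes "integrable \<mu> (\<lambda>s. s)" "integrable \<mu> (\<lambda>s. s\<^sup>2)"
    and "a + b * (\<integral>s. s \<partial>\<mu>) = 0" "c > 0"
  shows "0 < (\<integral>y. max 0 (- y) \<partial>mixlaw \<mu> a b c)"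
proof -
  interpret Q: real_distribution "mixlaw \<mu> a b c" by (rule real_distribution_mixlaw)
  note i = mixlaw_integrable_ident[OF assms(1,2), of a b c]
  have "(\<integral>y. y \<partial>mixlaw \<mu> a b c)
      = (\<integral>s. (\<integral>x. a + b * s + c * sqrt s * x \<partial>std_normal_distribution) \<partial>\<mu>)"
    by (rule mixlaw_integral(2)[OF i])
  also have "\<dots> = (\<integral>s. a + b * s \<partial>\<mu>)"
    using std_normal_moments(1,2) M2.prob_space by simp
  also have "\<dots> = 0" using assms prob_UNIV by simp
  finally have "(\<integral>y. y \<partial>mixlaw \<mu> a b c) = 0" .
  from Q.negative_part_pos(2)[OF i this AE_nonzero[OF real_distribution_mixlaw mixlaw_no_atom[OF assms(4)]]]
  show ?thesis .
qed

context tempered_stable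
begin

lemma integrable_mixlaw_ident: "integrable (mixlaw \<mu> a b c) (\<lambda>y. y)"
  by (rule mixlaw_integrable_ident[OF mean_integrable second_moment_integrable])

text \<open>The characteristic function \<open>r exp (i \<theta>)\<close> has \<open>r\<close> decreasing and \<open>u \<theta>'(u)\<close> increasing.\<close>

lemma mixlaw_median_pos:
  assumes "c > 0"
  shows "measure (mixlaw \<mu> c (- c) 1) {0<..} > 1 / 2"
proof -
  let ?Q = "mixlaw \<mu> c (- c) 1"
  interpret Q: real_distribution ?Q by (rule real_distribution_mixlaw)
  \<comment> \<open>\<psi> is the logarithm of the characteristic function. With z = u + i c one has
    w' = v z and \<psi>' = i c - p z, so the modulus decays at rate Re (p z) and the phase moves at
    speed c - Im (p z).\<close>
  define w where "w u = 1 + of_real v * Complex (u\<^sup>2 / 2) (u * c)" for u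
  define \<psi> where "\<psi> u = \<i> * of_real (u * c) - cts_exponent \<alpha> (of_real v * Complex (u\<^sup>2 / 2) (u * c)) / of_real v" for u
  define z where "z u = Complex u c" for u
  define p where "p u = w u powr of_real (\<alpha> - 1)" for u
  have Re_w: "Re (w u) \<ge> 1" for u using v_pos by (simp add: w_def)
  have Im_w: "Im (w u) > 0" if "u > 0" for u using v_pos assms that by (simp add: w_def)
  have w_deriv: "(w has_vector_derivative of_real v * z u) (at u)" for u
  proof -
    have "w = (\<lambda>u. 1 + of_real v * ((of_real u)\<^sup>2 / 2 + of_real u * (of_real c * \<i>)))"
      by (auto simp: w_def fun_eq_iff complex_eq_iff simp flip: of_real_power)
    moreover have D: "((\<lambda>x. 1 + of_real v * (x\<^sup>2 / 2 + x * (of_real c * \<i>))) has_field_derivative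
        of_real v * (of_real u + of_real c * \<i>)) (at (of_real u))"
      by (auto intro!: derivative_eq_intros)
    moreover have "z u = of_real u + of_real c * \<i>" by (simp add: z_def complex_eq_iff)
    ultimately show ?thesis using has_vector_derivative_real_field[OF D] by simp
  qed
  have \<psi>_deriv: "(\<psi> has_vector_derivative \<i> * of_real c - p u * z u) (at u)" for u
  proof -
    have "(cts_exponent \<alpha> has_field_derivative (1 + (w u - 1)) powr (of_real \<alpha> - 1)) (at (w u - 1))"
      using Re_w[of u] by (intro cts_exponent_has_derivative) simp
    then have "(cts_exponent \<alpha> has_field_derivative p u) (at (w u - 1))" by (simp add: p_def)
    moreover have "((\<lambda>u. w u - 1) has_vector_derivative of_real v * z u - 0) (at u)"
      by (intro has_vector_derivative_diff w_deriv has_vector_derivative_const)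
    ultimately have "((cts_exponent \<alpha> \<circ> (\<lambda>u. w u - 1)) has_vector_derivative (of_real v * z u - 0) * p u) (at u)"
      by (rule field_vector_diff_chain_at[rotated])
    then have B: "((\<lambda>u. cts_exponent \<alpha> (w u - 1)) has_vector_derivative (of_real v * z u - 0) * p u) (at u)"
      by (simp only: comp_def)
    have "((\<lambda>x. \<i> * (x * of_real c)) has_field_derivative \<i> * of_real c) (at (of_real u))"
      by (auto intro!: derivative_eq_intros)
    from has_vector_derivative_real_field[OF this]
    have A: "((\<lambda>u. \<i> * of_real (u * c)) has_vector_derivative \<i> * of_real c) (at u)" by simp
    have "((\<lambda>u. \<i> * of_real (u * c) - cts_exponent \<alpha> (w u - 1) / of_real v)
        has_vector_derivative \<i> * of_real c - (of_real v * z u - 0) * p u / of_real v) (at u)"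
      by (rule has_vector_derivative_diff[OF A has_vector_derivative_divide[OF B]])
    moreover have "\<psi> = (\<lambda>u. \<i> * of_real (u * c) - cts_exponent \<alpha> (w u - 1) / of_real v)"
      by (simp add: \<psi>_def w_def fun_eq_iff)
    ultimately show ?thesis using v_pos by (simp add: mult.commute)
  qed
  have p_deriv: "(p has_vector_derivative of_real (\<alpha> - 1) * w u powr of_real (\<alpha> - 2) * (of_real v * z u)) (at u)" for u
  proof -
    have "w u \<notin> \<real>\<^sub>\<le>\<^sub>0" using Re_w[of u] by (auto simp: complex_nonpos_Reals_iff)
    then have "((\<lambda>z. z powr of_real (\<alpha> - 1)) has_field_derivative
       of_real (\<alpha> - 1) * w u powr (of_real (\<alpha> - 1) - 1)) (at (w u))" by (rule has_field_derivative_powr)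
    moreover have "of_real (\<alpha> - 1) - 1 = complex_of_real (\<alpha> - 2)" by simp
    ultimately have "((\<lambda>z. z powr of_real (\<alpha> - 1)) has_field_derivative
       of_real (\<alpha> - 1) * w u powr of_real (\<alpha> - 2)) (at (w u))" by (simp only:)
    from field_vector_diff_chain_at[OF w_deriv this]
    show ?thesis by (simp add: p_def[abs_def] comp_def mult_ac)
  qed
  define r where "r u = exp (Re (\<psi> u))" for u
  define \<theta> where "\<theta> u = Im (\<psi> u)" for u
  define \<kappa> where "\<kappa> u = u * (c - Im (p u * z u))" for u
  \<comment> \<open>Obtained from \<kappa> = u \<theta>' by eliminating z^2 through v z^2 = 2 (w -
    1) - v c^2. In this form each of the three summands is nonnegative by the quadrant facts for the
    powers of w.\<close>
  define \<kappa>' where "\<kappa>' u = c * (1 - Re (p u)) - 2 * \<alpha> * u * Im (p u) - u * (1 - \<alpha>) * (2 + v * c\<^sup>2) * Im (w u powr of_real (\<alpha> - 2))" for u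
  define r' where "r' u = r u * (- Re (p u * z u))" for u
  have p_facts: "Re (p u) > 0" "Re (p u) \<le> 1" "Im (p u) < 0" if "u > 0" for u
    unfolding p_def using powr_neg_facts[OF Re_w Im_w[OF that], of "\<alpha> - 1"] alpha by auto
  have Re_\<psi>: "((\<lambda>u. Re (\<psi> u)) has_real_derivative - Re (p u * z u)) (at u)" for u
    using bounded_linear.has_vector_derivative[OF bounded_linear_Re \<psi>_deriv[of u]]
    by (simp add: has_real_derivative_iff_has_vector_derivative)
  have Im_\<psi>: "(\<theta> has_real_derivative c - Im (p u * z u)) (at u)" for u
    using bounded_linear.has_vector_derivative[OF bounded_linear_Im \<psi>_deriv[of u]]
    by (simp add: has_real_derivative_iff_has_vector_derivative \<theta>_def[abs_def])
  have char_Q: "Im (char ?Q u) = r u * sin (\<theta> u)" if "u > 0" for u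
  proof -
    have "char ?Q u = iexp (u * c) * claplace \<mu> (Complex (u\<^sup>2 / 2) (u * c))"
      by (simp add: char_mixlaw)
    also have "\<dots> = exp (\<psi> u)"
      using that by (subst claplace_eq) (auto simp: \<psi>_def exp_add[symmetric])
    finally show ?thesis by (simp add: Im_exp r_def \<theta>_def)
  qed
  have F_eq: "Im (char ?Q u) / u = r u * sin (\<theta> u) / u" if "u > 0" for u
    by (simp add: char_Q[OF that])
  have F_int: "((\<lambda>u. r u * sin (\<theta> u) / u) has_integral (LINT u:{0<..<T}|lborel. Im (char ?Q u) / u)) {0..T}" for T
  proof -
    have "((\<lambda>u. Im (char ?Q u) / u) has_integral (LINT u:{0<..<T}|lborel. Im (char ?Q u) / u)) {0<..<T}"
      using set_borel_integral_eq_integral[OF char_sign_integral(1)[OF Q.real_distribution_axioms integrable_mixlaw_ident]]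
      by (simp add: integrable_integral)
    then have "((\<lambda>u. r u * sin (\<theta> u) / u) has_integral (LINT u:{0<..<T}|lborel. Im (char ?Q u) / u)) {0<..<T}"
      by (rule has_integral_eq[rotated]) (simp add: F_eq)
    then show ?thesis by (simp add: has_integral_Icc_iff_Ioo)
  qed
  obtain d b where db: "d > 0" "\<And>T. T \<ge> b \<Longrightarrow> d \<le> integral {0..T} (\<lambda>u. r u * sin (\<theta> u) / u)"
  proof (rule oscillating_integral_pos[of \<theta> \<kappa> r r' \<kappa>'])
    show "isCont \<theta> 0" by (rule DERIV_isCont[OF Im_\<psi>])
    have "Complex 0 0 = 0" by (simp add: complex_eq_iff)
    then show "\<theta> 0 = 0" by (simp add: \<theta>_def \<psi>_def cts_exponent_def)
    show "(\<lambda>u. r u * sin (\<theta> u) / u) integrable_on {0..T}" for T using F_int by blast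
    fix u :: real assume u: "u > 0"
    show "(\<theta> has_real_derivative \<kappa> u / u) (at u)" using Im_\<psi>[of u] u by (simp add: \<kappa>_def)
    show "(r has_real_derivative r' u) (at u)"
      unfolding r'_def r_def by (rule DERIV_fun_exp[OF Re_\<psi>])
    show "r u > 0" by (simp add: r_def)
    have "Re (p u * z u) > 0" unfolding times_complex.sel z_def complex.sel
      using mult_pos_pos[OF p_facts(1)[OF u] u] mult_neg_pos[OF p_facts(3)[OF u] assms] by linarith
    then show "r' u < 0" by (simp add: r'_def r_def mult_pos_neg)
    have "Im (p u * z u) = Re (p u) * c + Im (p u) * u" by (simp add: z_def)
    also have "\<dots> < c"
      using mult_right_mono[OF p_facts(2)[OF u] less_imp_le[OF assms]] mult_neg_pos[OF p_facts(3)[OF u] u]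
      by linarith
    finally show "\<kappa> u > 0" using u by (simp add: \<kappa>_def)
    show "\<kappa>' u \<ge> 0"
    proof -
      have "c * (1 - Re (p u)) \<ge> 0" using p_facts[OF u] assms by simp
      moreover have "2 * \<alpha> * u * Im (p u) \<le> 0" using p_facts[OF u] u alpha by (intro mult_nonneg_nonpos) auto
      moreover have "Im (w u powr of_real (\<alpha> - 2)) \<le> 0"
        using Im_powr_nonpos[of "w u" "\<alpha> - 2"] Re_w[of u] Im_w[OF u] alpha by simp
      then have "u * (1 - \<alpha>) * (2 + v * c\<^sup>2) * Im (w u powr of_real (\<alpha> - 2)) \<le> 0"
        using u alpha v_pos by (intro mult_nonneg_nonpos mult_nonneg_nonneg) auto
      ultimately show ?thesis unfolding \<kappa>'_def by linarith
    qed
    show "(\<kappa> has_real_derivative \<kappa>' u) (at u)"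
    proof -
      have zd: "(z has_vector_derivative 1) (at u)"
      proof -
        have "z = (\<lambda>u. of_real u + of_real c * \<i>)" by (auto simp: z_def fun_eq_iff complex_eq_iff)
        moreover have D: "((\<lambda>x. x + of_real c * \<i>) has_field_derivative 1) (at (of_real u))"
          by (auto intro!: derivative_eq_intros)
        ultimately show ?thesis using has_vector_derivative_real_field[OF D] by simp
      qed
      let ?q = "w u powr of_real (\<alpha> - 2)"
      have pq: "p u = ?q * w u"
      proof -
        have "w u \<noteq> 0" using Re_w[of u] by auto
        then have "w u powr (of_real (\<alpha> - 2) + 1) = ?q * w u" by (simp only: powr_add) simp
        moreover have "of_real (\<alpha> - 2) + 1 = complex_of_real (\<alpha> - 1)" by simp
        ultimately show ?thesis unfolding p_def by (simp only:)
      qed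
      have zz: "of_real v * (z u * z u) = 2 * (w u - 1) - of_real (v * c\<^sup>2)"
        by (simp add: z_def w_def complex_eq_iff power2_eq_square algebra_simps)
      have pz: "((\<lambda>u. p u * z u) has_vector_derivative
          p u * 1 + of_real (\<alpha> - 1) * ?q * (of_real v * z u) * z u) (at u)"
        by (rule has_vector_derivative_mult[OF p_deriv zd])
      have "p u * 1 + of_real (\<alpha> - 1) * ?q * (of_real v * z u) * z u
          = p u + of_real (\<alpha> - 1) * ?q * (of_real v * (z u * z u))" by (simp add: algebra_simps)
      also have "\<dots> = of_real (2 * \<alpha> - 1) * p u - of_real ((\<alpha> - 1) * (2 + v * c\<^sup>2)) * ?q"
        unfolding zz pq by (simp add: algebra_simps)
      finally have deriv_pz: "((\<lambda>u. p u * z u) has_vector_derivative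
          of_real (2 * \<alpha> - 1) * p u - of_real ((\<alpha> - 1) * (2 + v * c\<^sup>2)) * ?q) (at u)" using pz by simp
      have Impz: "((\<lambda>u. Im (p u * z u)) has_real_derivative
          (2 * \<alpha> - 1) * Im (p u) - ((\<alpha> - 1) * (2 + v * c\<^sup>2)) * Im ?q) (at u)"
      proof -
        have Im_mult: "Im (of_real a * y) = a * Im y" for a y by simp
        show ?thesis
          using bounded_linear.has_vector_derivative[OF bounded_linear_Im deriv_pz]
          unfolding has_real_derivative_iff_has_vector_derivative minus_complex.sel(2) Im_mult .
      qed
      have "(\<kappa> has_real_derivative 1 * (c - Im (p u * z u)) +
          (0 - ((2 * \<alpha> - 1) * Im (p u) - ((\<alpha> - 1) * (2 + v * c\<^sup>2)) * Im ?q)) * u) (at u)"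
        unfolding \<kappa>_def[abs_def] by (intro DERIV_mult DERIV_diff DERIV_const DERIV_ident Impz)
      moreover have "1 * (c - Im (p u * z u)) +
          (0 - ((2 * \<alpha> - 1) * Im (p u) - ((\<alpha> - 1) * (2 + v * c\<^sup>2)) * Im ?q)) * u = \<kappa>' u"
        unfolding \<kappa>'_def by (simp add: z_def algebra_simps)
      ultimately show ?thesis by simp
    qed
  next
    fix d b :: real
    assume "d > 0" "\<And>T. b \<le> T \<Longrightarrow> d \<le> integral {0..T} (\<lambda>u. r u * sin (\<theta> u) / u)"
    then show thesis by (rule that)
  qed
  \<comment> \<open>A bound d independent of T survives the limit T to infinity; mere positivity of
    each truncated integral would only give a weak inequality.\<close>
  have "d \<le> pi / 2 * (measure ?Q {0<..} - measure ?Q {..<0})"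
  proof (rule tendsto_lowerbound[OF char_sign_integral(2)[OF Q.real_distribution_axioms integrable_mixlaw_ident]])
    show "eventually (\<lambda>T. d \<le> (LINT u:{0<..<T}|lborel. Im (char ?Q u) / u)) at_top"
      using eventually_ge_at_top[of b]
    proof eventually_elim
      case (elim T)
      then show ?case using db(2)[of T] integral_unique[OF F_int[of T]] by simp
    qed
  qed simp
  then have "0 < pi / 2 * (measure ?Q {0<..} - measure ?Q {..<0})" using db(1) by linarith
  then have lt: "measure ?Q {..<0} < measure ?Q {0<..}" by (simp add: zero_less_mult_iff)
  have "measure ?Q UNIV = 1" using Q.prob_space by simp
  moreover have "measure ?Q UNIV = measure ?Q {..<0} + measure ?Q {0} + measure ?Q {0<..}"
  proof -
    have "UNIV = ({..<0} \<union> {0}) \<union> {0::real<..}" by auto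
    then have "measure ?Q UNIV = measure ?Q (({..<0} \<union> {0}) \<union> {0<..})" by simp
    also have "\<dots> = measure ?Q ({..<0} \<union> {0}) + measure ?Q {0<..}"
      by (rule Q.finite_measure_Union) auto
    also have "measure ?Q ({..<0} \<union> {0}) = measure ?Q {..<0} + measure ?Q {0}"
      by (rule Q.finite_measure_Union) auto
    finally show ?thesis .
  qed
  moreover have "measure ?Q {0} = 0" by (rule mixlaw_no_atom) simp
  ultimately show ?thesis using lt by linarith
qed

end

section \<open>Small-time asymptotics\<close>

lemma eventually_at_right_0I: "(\<And>t::real. t > 0 \<Longrightarrow> P t) \<Longrightarrow> eventually P (at_right 0)"
  by (rule eventually_mono[OF eventually_at_right_less])

lemma tendsto_at_right_0_cong:
  assumes "(F \<longlongrightarrow> l) (at_right (0::real))" "\<And>t. t > 0 \<Longrightarrow> F t = G t"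
  shows "(G \<longlongrightarrow> l) (at_right 0)"
  by (rule Lim_transform_eventually[OF assms(1) eventually_at_right_0I[OF assms(2)]])

text \<open>With x = s sqrt t / 2 the price identity reads N(x) - N(0) = C t / 2. As C t tends to 0,
  so does x, and s is C t / sqrt t divided by the difference quotient of N at 0, whose limit is 1 /
  sqrt (2 pi).\<close>

lemma atm_vol_tendsto:
  assumes s: "\<And>t. t > 0 \<Longrightarrow> s t > 0"
    and price: "\<And>t. t > 0 \<Longrightarrow> black_call t 0 (s t) = C t"
    and lim: "((\<lambda>t. C t / sqrt t) \<longlongrightarrow> l) (at_right 0)"
  shows "(s \<longlongrightarrow> sqrt (2 * pi) * l) (at_right 0)"
    and "((\<lambda>t. s t * sqrt t / 2) \<longlongrightarrow> 0) (at_right 0)"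
proof -
  define x where "x t = s t * sqrt t / 2" for t
  have pos: "eventually (\<lambda>t::real. t > 0) (at_right 0)"
    by (rule eventually_at_right_less)
  have xpos: "x t > 0" if "t > 0" for t using s[OF that] that by (simp add: x_def)
  have N: "std_normal_cdf (x t) - 1 / 2 = C t / 2" if "t > 0" for t
    using price[OF that] by (simp add: black_call_0 x_def)
  have sq: "((\<lambda>t::real. sqrt t) \<longlongrightarrow> 0) (at_right 0)"
    by real_asymp
  have "((\<lambda>t. C t / sqrt t * sqrt t) \<longlongrightarrow> l * 0) (at_right 0)"
    by (intro tendsto_mult lim sq)
  moreover have "eventually (\<lambda>t. C t / sqrt t * sqrt t = C t) (at_right 0)"
    using pos by eventually_elim simp
  ultimately have "(C \<longlongrightarrow> l * 0) (at_right 0)" by (rule Lim_transform_eventually)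
  then have C0: "(C \<longlongrightarrow> 0) (at_right 0)" by simp
  show x0: "((\<lambda>t. s t * sqrt t / 2) \<longlongrightarrow> 0) (at_right 0)"
    unfolding x_def[symmetric]
  proof (rule tendstoI)
    fix e :: real assume e: "e > 0"
    have "std_normal_cdf 0 < std_normal_cdf e" using e by (simp only: std_normal_cdf_less_iff)
    then have "eventually (\<lambda>t. C t < 2 * (std_normal_cdf e - 1 / 2)) (at_right 0)"
      using C0 by (intro order_tendstoD(2)) auto
    with pos show "eventually (\<lambda>t. dist (x t) 0 < e) (at_right 0)"
    proof eventually_elim
      case (elim t)
      have "std_normal_cdf (x t) = 1 / 2 + C t / 2" using N[OF elim(1)] by simp
      also have "\<dots> < std_normal_cdf e" using elim(2) by simp
      finally have "std_normal_cdf (x t) < std_normal_cdf e" .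
      then show ?case using xpos[OF elim(1)] by simp
    qed
  qed
  have "((\<lambda>y. (std_normal_cdf y - std_normal_cdf 0) / (y - 0)) \<longlongrightarrow> std_normal_density 0) (at 0)"
    using std_normal_cdf_has_derivative[of 0] by (simp only: has_field_derivative_iff)
  moreover have "filterlim x (at 0) (at_right 0)"
    using x0 pos xpos unfolding x_def[symmetric] filterlim_at
    by (auto elim!: eventually_mono simp: less_imp_neq[THEN not_sym])
  ultimately have "((\<lambda>t. (std_normal_cdf (x t) - std_normal_cdf 0) / (x t - 0)) \<longlongrightarrow> std_normal_density 0) (at_right 0)"
    by (rule filterlim_compose)
  then have "((\<lambda>t. C t / sqrt t / ((std_normal_cdf (x t) - std_normal_cdf 0) / (x t - 0))) \<longlongrightarrow> l / std_normal_density 0) (at_right 0)"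
    by (intro tendsto_divide lim) (simp_all add: std_normal_density_def)
  moreover have "eventually (\<lambda>t. C t / sqrt t / ((std_normal_cdf (x t) - std_normal_cdf 0) / (x t - 0)) = s t) (at_right 0)"
    using pos
  proof eventually_elim
    case (elim t)
    have "std_normal_cdf 0 < std_normal_cdf (x t)" using xpos[OF elim] by (simp only: std_normal_cdf_less_iff)
    then have "C t > 0" using N[OF elim] by simp
    then show ?case using N[OF elim] elim by (simp add: x_def)
  qed
  ultimately have "(s \<longlongrightarrow> l / std_normal_density 0) (at_right 0)"
    by (rule Lim_transform_eventually)
  then show "(s \<longlongrightarrow> sqrt (2 * pi) * l) (at_right 0)"
    by (simp add: std_normal_density_def mult.commute)
qed

lemma atm_vol_ge:
  assumes "s > 0" "t > 0" "black_call t 0 s = C"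
  shows "sqrt (2 * pi) * (C / sqrt t) \<le> s"
proof -
  have "std_normal_cdf (s * sqrt t / 2) - 1 / 2 \<le> s * sqrt t / 2 / sqrt (2 * pi)"
    using assms by (intro std_normal_cdf_le) auto
  then have "C \<le> 2 * (s * sqrt t / 2 / sqrt (2 * pi))" using assms(3) by (simp only: black_call_0; linarith)
  then have "C \<le> s * sqrt t / sqrt (2 * pi)" by simp
  then show ?thesis using assms by (simp add: field_simps)
qed

text \<open>Sublinear growth of the exponent: for v tending to infinity the Laplace transform at 1
  tends to 1, which is the collapse of the mixing law to 0.\<close>

lemma ts_exponent_over_tendsto_0:
  assumes "0 \<le> \<alpha>" "\<alpha> < 1"
  shows "((\<lambda>v. ts_exponent \<alpha> v / v) \<longlongrightarrow> 0) at_top"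
proof (cases "\<alpha> = 0")
  case True
  have "((\<lambda>v::real. ln (1 + v) / v) \<longlongrightarrow> 0) at_top" by real_asymp
  then show ?thesis using True by (simp add: ts_exponent_def)
next
  case False
  then have "\<alpha> > 0" using assms by simp
  then have "((\<lambda>v. ((1 + v) powr \<alpha> - 1) / \<alpha> / v) \<longlongrightarrow> 0) at_top"
    using assms by real_asymp
  then show ?thesis using False by (simp add: ts_exponent_def)
qed

lemma cts_exponent_0 [simp]: "cts_exponent \<alpha> 0 = 0"
  by (simp add: cts_exponent_def)

text \<open>Taylor's formula on the disc of radius 1/2, which avoids the branch cut. The coefficient
  (\<alpha> - 1) / 2 is the source of the Gaussian limit of the subordinator when \<beta> >
  1.\<close>

lemma cts_exponent_Peano:
  "((\<lambda>w. (cts_exponent \<alpha> w - w) / w\<^sup>2) \<longlongrightarrow> of_real ((\<alpha> - 1) / 2)) (at 0)"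
proof -
  define S where "S = cball (0::complex) (1 / 2)"
  define a where "a = complex_of_real \<alpha>"
  define F where "F i w = (if i = 0 then cts_exponent \<alpha> w else if i = 1 then (1 + w) powr (a - 1)
      else if i = 2 then (a - 1) * (1 + w) powr (a - 2) else (a - 1) * (a - 2) * (1 + w) powr (a - 3))"
    for i :: nat and w
  have Re_S: "Re w > - 1" if "w \<in> S" for w
    using that abs_Re_le_cmod[of w] by (auto simp: S_def)
  have pd: "((\<lambda>w. (1 + w) powr s) has_field_derivative s * (1 + w) powr (s - 1) * 1) (at w within A)"
    if "w \<in> S" for w s A
    by (rule has_field_derivative_at_within,
        rule DERIV_chain2[where f="\<lambda>z. z powr s" and g="\<lambda>w. 1 + w"])
      (use one_plus_not_nonpos_Reals[OF Re_S[OF that]] in \<open>auto intro!: has_field_derivative_powr derivative_eq_intros\<close>)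
  have "continuous_on S (F 3)"
    unfolding F_def using pd by (auto intro!: continuous_intros DERIV_continuous_on[of S "\<lambda>w. (1 + w) powr (a - 3)"])
  then have "bounded (F 3 ` S)"
    by (intro compact_imp_bounded compact_continuous_image) (auto simp: S_def)
  then obtain B where B: "\<And>w. w \<in> S \<Longrightarrow> norm (F 3 w) \<le> B"
    unfolding bounded_iff by auto
  have T: "norm (F 0 w - (\<Sum>i\<le>2. F i 0 * (w - 0) ^ i / fact i)) \<le> B * norm (w - 0) ^ Suc 2 / fact 2"
    if "w \<in> S" for w
  proof (rule field_Taylor[of S 2 F])
    show "convex S" "0 \<in> S" by (auto simp: S_def)
    show "w \<in> S" by fact
    show "(F i has_field_derivative F (Suc i) x) (at x within S)" if "x \<in> S" "i \<le> 2" for i x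
    proof -
      consider "i = 0" | "i = 1" | "i = 2" using \<open>i \<le> 2\<close> by linarith
      then show ?thesis
      proof cases
        case 1
        then show ?thesis unfolding F_def
          using cts_exponent_has_derivative[OF Re_S[OF that(1)], of \<alpha>]
          by (simp add: a_def has_field_derivative_at_within)
      next
        case 2
        then show ?thesis unfolding F_def using pd[OF that(1), of "a - 1" S] by (simp add: numeral_eq_Suc)
      next
        case 3
        then show ?thesis unfolding F_def
          using DERIV_cmult[OF pd[OF that(1), of "a - 2" S], of "a - 1"] by (simp add: mult.assoc)
      qed
    qed
    show "norm (F (Suc 2) x) \<le> B" if "x \<in> S" for x using B[OF that] by (simp add: eval_nat_numeral)
  qed
  have sum: "(\<Sum>i\<le>2. F i 0 * (w - 0) ^ i / fact i) = w + (a - 1) / 2 * w\<^sup>2" for w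
    by (simp add: numeral_2_eq_2 F_def)
  have near: "norm ((cts_exponent \<alpha> w - w) / w\<^sup>2 - of_real ((\<alpha> - 1) / 2)) \<le> B / 2 * norm w"
    if "w \<in> S" "w \<noteq> 0" for w
  proof -
    have "norm (cts_exponent \<alpha> w - (w + (a - 1) / 2 * w\<^sup>2)) \<le> B * norm w ^ 3 / 2"
      using T[OF that(1)] unfolding sum by (simp add: F_def eval_nat_numeral)
    moreover have "(cts_exponent \<alpha> w - w) / w\<^sup>2 - of_real ((\<alpha> - 1) / 2)
        = (cts_exponent \<alpha> w - (w + (a - 1) / 2 * w\<^sup>2)) / w\<^sup>2"
      using that(2) by (simp add: field_simps a_def)
    moreover have "norm w > 0" using that by simp
    ultimately show ?thesis
      by (simp add: norm_divide norm_mult norm_power divide_le_eq power2_eq_square power3_eq_cube mult_ac)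
  qed
  show ?thesis
  proof (rule LIM_zero_cancel, rule Lim_null_comparison)
    have "eventually (\<lambda>w. w \<in> S \<and> w \<noteq> 0) (at 0)"
      unfolding S_def eventually_at by (intro exI[of _ "1/2"]) (auto simp: dist_norm)
    then show "eventually (\<lambda>w. norm ((cts_exponent \<alpha> w - w) / w\<^sup>2 - of_real ((\<alpha> - 1) / 2)) \<le> B / 2 * norm w) (at 0)"
      by eventually_elim (use near in auto)
    show "((\<lambda>w. B / 2 * norm w) \<longlongrightarrow> 0) (at (0::complex))"
      by (auto intro!: tendsto_eq_intros)
  qed
qed

lemma powr_tendsto_0: "e > 0 \<Longrightarrow> ((\<lambda>t. t powr e) \<longlongrightarrow> 0) (at_right (0::real))"
  by real_asymp

lemma powr_tendsto_at_top: "e < 0 \<Longrightarrow> filterlim (\<lambda>t. t powr e) at_top (at_right (0::real))"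
  by real_asymp

text \<open>On the left half-plane |exp w - 1| is at most |w| and at most 2, hence at most 2 sqrt
  |w|. The square root matters: for \<beta> < 1 the mean of S stays 1 while the mean of sqrt S tends
  to 0.\<close>

lemma (in mixing) claplace_minus_1:
  assumes "integrable \<mu> (\<lambda>s. sqrt s)" "Re z \<ge> 0"
  shows "norm (claplace \<mu> z - 1) \<le> 2 * sqrt (norm z) * (\<integral>s. sqrt s \<partial>\<mu>)"
proof -
  have b: "norm (exp w - 1) \<le> 2 * sqrt (norm w)" if w: "Re w \<le> 0" for w :: complex
  proof -
    have n1: "norm (exp w) \<le> 1" using w by simp
    have "norm (exp w - exp 0) \<le> 1 * norm (w - 0)"
      by (rule field_differentiable_bound[of "{w. Re w \<le> 0}" exp exp])
        (use w in \<open>auto intro!: derivative_eq_intros convex_halfspace_Re_le\<close>)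
    then have 1: "norm (exp w - 1) \<le> norm w" by simp
    have 2: "norm (exp w - 1) \<le> 2" using norm_triangle_ineq4[of "exp w" 1] n1 unfolding norm_one by linarith
    show ?thesis
    proof (cases "norm w \<le> 1")
      case True
      then have "sqrt (norm w) * sqrt (norm w) \<le> 1 * sqrt (norm w)" by (intro mult_right_mono) auto
      moreover have "sqrt (norm w) * sqrt (norm w) = norm w" by simp
      moreover have "0 \<le> sqrt (norm w)" by simp
      ultimately show ?thesis using 1 by linarith
    next
      case False
      then have "1 \<le> sqrt (norm w)" by simp
      then show ?thesis using 2 by linarith
    qed
  qed
  have Re: "AE s in \<mu>. Re (- z * of_real s) \<le> 0"
    using AE_pos assms(2) by (auto elim!: eventually_mono)
  have i: "integrable \<mu> (\<lambda>s. exp (- z * of_real s))"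
    by (rule bounded_integrable[of _ 1]) (use Re in \<open>auto elim!: eventually_mono\<close>)
  have "claplace \<mu> z - 1 = (\<integral>s. exp (- z * of_real s) - 1 \<partial>\<mu>)"
    unfolding claplace_def using i prob_UNIV by simp
  also have "norm \<dots> \<le> (\<integral>s. norm (exp (- z * of_real s) - 1) \<partial>\<mu>)" by (rule integral_norm_bound)
  also have "\<dots> \<le> (\<integral>s. 2 * sqrt (norm z) * sqrt s \<partial>\<mu>)"
  proof (rule integral_mono_AE)
    show "integrable \<mu> (\<lambda>s. norm (exp (- z * of_real s) - 1))" using i by (intro integrable_norm) simp
    show "integrable \<mu> (\<lambda>s. 2 * sqrt (norm z) * sqrt s)" using assms(1) by (rule integrable_mult_right)
    show "AE s in \<mu>. norm (exp (- z * of_real s) - 1) \<le> 2 * sqrt (norm z) * sqrt s"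
      using Re AE_pos
    proof eventually_elim
      case (elim s)
      show ?case using b[OF elim(1)] elim(2) by (simp add: norm_mult real_sqrt_mult mult.assoc)
    qed
  qed
  also have "\<dots> = 2 * sqrt (norm z) * (\<integral>s. sqrt s \<partial>\<mu>)" by simp
  finally show ?thesis .
qed

lemma powr_tendsto_indicator:
  assumes "e \<ge> 0"
  shows "((\<lambda>t. t powr e) \<longlongrightarrow> (if e = 0 then 1 else 0)) (at_right (0::real))"
proof (cases "e = 0")
  case True
  have "eventually (\<lambda>t::real. t powr e = 1) (at_right 0)"
    using eventually_at_right_less[of "0::real"] by eventually_elim (simp add: True)
  then show ?thesis using True by (simp add: tendsto_eventually)
qed (use assms powr_tendsto_0[of e] in auto)

section \<open>The model as a family of mixtures; exact formulas for volatility and skew\<close>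

locale ats = ats_model M \<alpha> kbar \<beta> S g
  for M :: "'a measure" and \<alpha> kbar \<beta> :: real and S :: "real \<Rightarrow> 'a \<Rightarrow> real" and g +
  fixes \<sigma> etabar \<delta> :: real
  assumes params: "0 \<le> \<alpha>" "\<alpha> < 1" "kbar > 0" "\<sigma> > 0" "etabar > 0"
begin

text \<open>Here \<open>k t\<close> is the quotient \<open>k\<^sub>t / t\<close> of the model, which is the variance of \<open>S t\<close>; further
  \<open>x t = t \<sigma>\<^sup>2 \<eta>\<^sub>t\<close> and \<open>h t = \<phi>\<^sub>t t\<close>.\<close>

definition mu :: "real \<Rightarrow> real measure" where "mu t = distr M borel (S t)"
definition k :: "real \<Rightarrow> real" where "k t = kbar * t powr (\<beta> - 1)"
definition v :: "real \<Rightarrow> real" where "v t = k t / (1 - \<alpha>)"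
definition K :: real where "K = \<sigma>\<^sup>2 * etabar"
definition x :: "real \<Rightarrow> real" where "x t = K * t powr (1 + \<delta>)"
definition h :: "real \<Rightarrow> real" where "h t = ats_phi M \<sigma> etabar \<delta> S t * t"
text \<open>The law of \<open>f t / sqrt t\<close>, as \<open>law_f\<close> shows. After division by
  \<open>sqrt t\<close> the Gaussian coefficient is the constant \<sigma>, and only the drift
  coefficients and the mixing law vary with t.\<close>

definition law :: "real \<Rightarrow> real measure" where
  "law t = mixlaw (mu t) (h t / sqrt t) (- (x t / sqrt t + \<sigma>\<^sup>2 * sqrt t / 2)) \<sigma>"

abbreviation f where "f \<equiv> ats_f M \<sigma> etabar \<delta> S g"

lemma K_pos: "K > 0" using params by (simp add: K_def)
lemma k_pos: "t > 0 \<Longrightarrow> k t > 0" using params by (simp add: k_def)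
lemma x_pos: "t > 0 \<Longrightarrow> x t > 0" using K_pos by (simp add: x_def)

lemma x_eq: "t > 0 \<Longrightarrow> x t = t * \<sigma>\<^sup>2 * ats_eta etabar \<delta> t"
  by (simp add: x_def K_def ats_eta_def powr_add)

lemma x_over_sqrt: "t > 0 \<Longrightarrow> x t / sqrt t = K * t powr (1 / 2 + \<delta>)"
  by (simp add: x_def powr_half_sqrt[symmetric] powr_diff[symmetric] powr_add[symmetric]
      flip: times_divide_eq_right)

lemma laplace_pos:
  assumes "t > 0" "u \<ge> 0"
  shows "integrable M (\<lambda>\<omega>. exp (- u * S t \<omega>))" "laplace_transform M (S t) u > 0"
proof -
  have [measurable]: "S t \<in> borel_measurable M" using S_measurable assms by simp
  show i: "integrable M (\<lambda>\<omega>. exp (- u * S t \<omega>))"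
    using S_positive[OF assms(1)] assms
    by (intro integrable_const_bound[of _ 1]) (auto elim!: eventually_mono)
  have "(\<integral>\<omega>. 0 \<partial>M) < (\<integral>\<omega>. exp (- u * S t \<omega>) \<partial>M)"
    by (rule integral_less_AE_space) (use i emeasure_space_1 in auto)
  then show "laplace_transform M (S t) u > 0" by (simp add: laplace_transform_def)
qed

lemma log_laplace:
  assumes "t > 0" "u \<ge> 0"
  shows "ats_log_laplace \<alpha> kbar \<beta> t u = - ts_exponent \<alpha> (v t * u) / v t"
proof -
  have "kbar * t powr \<beta> / t = k t" using assms by (simp add: k_def powr_diff)
  then have k': "kbar * t powr \<beta> = k t * t" using assms by (simp add: field_simps)
  have k0: "k t > 0" by (rule k_pos[OF assms(1)])
  have A: "t / (k t * t) = 1 / k t" "u * (k t * t) / t = k t * u"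
    "u * (k t * t) / ((1 - \<alpha>) * t) = k t / (1 - \<alpha>) * u"
    using assms k0 params by auto
  show ?thesis
  proof (cases "\<alpha> = 0")
    case True
    then show ?thesis
      unfolding ats_log_laplace_def ats_k_def Let_def k' ts_exponent_def v_def using A by simp
  next
    case False
    have "1 / k t * ((1 - \<alpha>) / \<alpha>) * (1 - X) = - ((X - 1) / \<alpha>) / (k t / (1 - \<alpha>))" for X
      using k0 params False by (simp add: field_simps)
    then show ?thesis using False
      unfolding ats_log_laplace_def ats_k_def Let_def k' ts_exponent_def v_def A by simp
  qed
qed

lemma tempered_stable_mu:
  assumes "t > 0" shows "tempered_stable (mu t) \<alpha> (v t)"
proof -
  have [measurable]: "S t \<in> borel_measurable M" using S_measurable assms by simp
  interpret R: real_distribution "mu t" unfolding mu_def by (rule real_distribution_distr) simp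
  show ?thesis
  proof
    show "AE s in mu t. 0 < s" unfolding mu_def using S_positive[OF assms] by (subst AE_distr_iff) auto
    show "0 \<le> \<alpha>" "\<alpha> < 1" "v t > 0" using params k_pos[OF assms] by (auto simp: v_def)
    fix u :: real assume u: "u \<ge> 0"
    have "(\<integral>s. exp (- u * s) \<partial>mu t) = laplace_transform M (S t) u"
      unfolding mu_def laplace_transform_def by (subst integral_distr) auto
    also have "\<dots> = exp (ats_log_laplace \<alpha> kbar \<beta> t u)"
      using S_laplace[OF assms u] laplace_pos(2)[OF assms u] by (metis exp_ln)
    finally show "(\<integral>s. exp (- u * s) \<partial>mu t) = exp (- ts_exponent \<alpha> (v t * u) / v t)"
      using log_laplace[OF assms u] by simp
  qed
qed

lemma q_eq: "t > 0 \<Longrightarrow> tempered_stable.q \<alpha> (v t) = k t"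
  using tempered_stable.q_def[OF tempered_stable_mu, of t] params by (simp add: v_def)

lemma h_eq:
  assumes "t > 0" shows "h t = ts_exponent \<alpha> (v t * x t) / v t"
  using S_laplace[OF assms, of "x t"] x_pos[OF assms] log_laplace[OF assms, of "x t"] assms
  by (simp add: h_def ats_phi_def x_eq)

text \<open>Concavity of the exponent gives h <= x; its quadratic lower bound limits the loss to k
  x^2 / 2, half the variance of x t times S t. This loss is the only correction in the centred
  drift.\<close>

lemma h_bounds:
  assumes "t > 0" shows "x t - k t * (x t)\<^sup>2 / 2 \<le> h t" "h t \<le> x t" "0 \<le> h t"
proof -
  interpret T: tempered_stable "mu t" \<alpha> "v t" by (rule tempered_stable_mu[OF assms])
  show "x t - k t * (x t)\<^sup>2 / 2 \<le> h t"
    using T.ts_exponent_ge_v[of "x t"] x_pos[OF assms] q_eq[OF assms] h_eq[OF assms] by simp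
  have "ts_exponent \<alpha> (v t * x t) \<le> v t * x t"
    using T.v_pos x_pos[OF assms] params by (intro ts_exponent_le) auto
  then show "h t \<le> x t" unfolding h_eq[OF assms] using T.v_pos by (simp add: divide_le_eq mult.commute)
  show "0 \<le> h t" unfolding h_eq[OF assms]
    using T.v_pos x_pos[OF assms] by (intro divide_nonneg_nonneg ts_exponent_nonneg) auto
qed

lemma law_f:
  fixes F :: "real \<Rightarrow> real"
  assumes t: "t > 0" and [measurable]: "F \<in> borel_measurable borel"
  shows "(\<integral>\<omega>. F (f t \<omega>) \<partial>M) = (\<integral>y. F (sqrt t * y) \<partial>law t)"
proof -
  have [measurable]: "S t \<in> borel_measurable M" using S_measurable t by simp
  have [measurable]: "g \<in> borel_measurable M" using g_std_normal by (auto simp: distributed_def)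
  have dg: "distr M borel g = std_normal_distribution"
  proof -
    have "distr M borel g = distr M lborel g" by (rule distr_cong) auto
    also have "\<dots> = std_normal_distribution" using g_std_normal by (rule distributed_distr_eq_density)
    finally show ?thesis .
  qed
  have joint: "mu t \<Otimes>\<^sub>M std_normal_distribution = distr M (borel \<Otimes>\<^sub>M borel) (\<lambda>\<omega>. (S t \<omega>, g \<omega>))"
    using S_g_indep[OF t] unfolding indep_var_distribution_eq mu_def dg[symmetric] by simp
  let ?a = "h t / sqrt t" and ?b = "- (x t / sqrt t + \<sigma>\<^sup>2 * sqrt t / 2)"
  have eqf: "sqrt t * (?a + ?b * S t \<omega> + \<sigma> * sqrt (S t \<omega>) * g \<omega>) = f t \<omega>" for \<omega>
  proof -
    have "sqrt t * ?a = h t" "sqrt t * ?b = - (x t + \<sigma>\<^sup>2 * t / 2)" using t by (auto simp: field_simps)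
    then have "sqrt t * (?a + ?b * S t \<omega> + \<sigma> * sqrt (S t \<omega>) * g \<omega>)
        = h t - (x t + \<sigma>\<^sup>2 * t / 2) * S t \<omega> + \<sigma> * (sqrt (S t \<omega>) * sqrt t) * g \<omega>"
      by (simp only: distrib_left mult.assoc[symmetric]; simp add: algebra_simps)
    also have "\<dots> = f t \<omega>"
      unfolding ats_f_def x_eq[OF t] h_def by (simp add: real_sqrt_mult algebra_simps)
    finally show ?thesis .
  qed
  have "(\<integral>y. F (sqrt t * y) \<partial>law t) = (\<integral>\<omega>. F (sqrt t * (?a + ?b * S t \<omega> + \<sigma> * sqrt (S t \<omega>) * g \<omega>)) \<partial>M)"
    unfolding law_def mixlaw_def joint
    by (subst integral_distr) (auto simp: integral_distr)
  then show ?thesis by (simp only: eqf)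
qed

lemma law_properties:
  assumes "t > 0"
  shows "real_distribution (law t)" "measure (law t) {0} = 0"
    "integrable (law t) (\<lambda>y. exp (sqrt t * y))" "(\<integral>y. exp (sqrt t * y) \<partial>law t) = 1"
    "max 0 (x t * (\<integral>s. max 0 (1 - s) \<partial>mu t) - k t * (x t)\<^sup>2 / 2)
       \<le> (\<integral>y. max 0 (exp (sqrt t * y) - 1) \<partial>law t)"
proof -
  interpret T: tempered_stable "mu t" \<alpha> "v t" by (rule tempered_stable_mu[OF assms])
  let ?a = "h t / sqrt t" and ?b = "- (x t / sqrt t + \<sigma>\<^sup>2 * sqrt t / 2)"
  \<comment> \<open>At \<tau> = \<open>sqrt t\<close> half the conditional Gaussian variance cancels
    the drift \<open>\<sigma>\<^sup>2 * t / 2 * s\<close>, leaving h - x s; \<phi> was defined so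
    that exp (h - x S) has mean one.\<close>
  have e: "sqrt t * (?a + ?b * s) + (sqrt t)\<^sup>2 * \<sigma>\<^sup>2 * s / 2 = h t - x t * s" for s
  proof -
    have "sqrt t * ?a = h t" "sqrt t * ?b = - (x t + \<sigma>\<^sup>2 * t / 2)" using assms by (auto simp: field_simps)
    then have "sqrt t * (?a + ?b * s) = h t - (x t + \<sigma>\<^sup>2 * t / 2) * s"
      by (simp only: distrib_left mult.assoc[symmetric]; simp add: algebra_simps)
    then show ?thesis using assms by (simp add: algebra_simps)
  qed
  have ex: "exp (h t - x t * s) = exp (h t) * exp (- x t * s)" for s
    by (simp add: exp_diff exp_minus divide_inverse)
  have i: "integrable (mu t) (\<lambda>s. exp (sqrt t * (?a + ?b * s) + (sqrt t)\<^sup>2 * \<sigma>\<^sup>2 * s / 2))"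
    unfolding e ex using T.exp_integrable[of "x t"] x_pos[OF assms] by simp
  show "real_distribution (law t)" unfolding law_def by (rule T.real_distribution_mixlaw)
  show "measure (law t) {0} = 0" unfolding law_def using params by (intro T.mixlaw_no_atom)
  show "integrable (law t) (\<lambda>y. exp (sqrt t * y))" unfolding law_def by (rule T.mixlaw_exp(1)[OF i])
  have "(\<integral>y. exp (sqrt t * y) \<partial>law t) = (\<integral>s. exp (h t) * exp (- x t * s) \<partial>mu t)"
    unfolding law_def T.mixlaw_exp(2)[OF i] e ex ..
  also have "\<dots> = exp (h t) * exp (- ts_exponent \<alpha> (v t * x t) / v t)"
    using T.laplace[of "x t"] x_pos[OF assms] by simp
  also have "\<dots> = 1" unfolding h_eq[OF assms] by (simp add: exp_add[symmetric])
  finally show "(\<integral>y. exp (sqrt t * y) \<partial>law t) = 1" .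
  have im: "integrable (mu t) (\<lambda>s. max 0 (1 - s))"
    using T.mean_integrable by (intro Bochner_Integration.integrable_max) auto
  have im2: "integrable (mu t) (\<lambda>s. max 0 (h t - x t * s))"
    using T.mean_integrable by (intro Bochner_Integration.integrable_max) auto
  have "x t * (\<integral>s. max 0 (1 - s) \<partial>mu t) - k t * (x t)\<^sup>2 / 2
      = (\<integral>s. x t * max 0 (1 - s) - k t * (x t)\<^sup>2 / 2 \<partial>mu t)"
    using im T.prob_UNIV by simp
  also have "\<dots> \<le> (\<integral>s. max 0 (h t - x t * s) \<partial>mu t)"
  proof (rule integral_mono[OF _ im2])
    show "integrable (mu t) (\<lambda>s. x t * max 0 (1 - s) - k t * (x t)\<^sup>2 / 2)" using im by simp
    fix s
    have "0 \<le> k t * (x t)\<^sup>2 / 2" using k_pos[OF assms] by simp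
    then show "x t * max 0 (1 - s) - k t * (x t)\<^sup>2 / 2 \<le> max 0 (h t - x t * s)"
      using h_bounds(1)[OF assms] x_pos[OF assms] by (auto simp: max_def algebra_simps)
  qed
  finally have "max 0 (x t * (\<integral>s. max 0 (1 - s) \<partial>mu t) - k t * (x t)\<^sup>2 / 2) \<le> (\<integral>s. max 0 (h t - x t * s) \<partial>mu t)"
    by simp
  also have "\<dots> \<le> (\<integral>y. max 0 (exp (sqrt t * y) - 1) \<partial>law t)"
    using T.mixlaw_price_lower[OF i T.mean_integrable] unfolding e law_def .
  finally show "max 0 (x t * (\<integral>s. max 0 (1 - s) \<partial>mu t) - k t * (x t)\<^sup>2 / 2)
       \<le> (\<integral>y. max 0 (exp (sqrt t * y) - 1) \<partial>law t)" .
qed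

definition C :: "real \<Rightarrow> real" where "C t = (\<integral>y. max 0 (exp (sqrt t * y) - 1) \<partial>law t)"

lemma C_put: "t > 0 \<Longrightarrow> C t = (\<integral>y. max 0 (1 - exp (sqrt t * y)) \<partial>law t)"
  unfolding C_def by (rule call_price_bounds(3)) (auto simp: law_properties)

lemma C_pos: "t > 0 \<Longrightarrow> C t > 0"
  unfolding C_def by (rule call_price_bounds(1)) (auto simp: law_properties)

lemma C_lower: "t > 0 \<Longrightarrow> x t * (\<integral>s. max 0 (1 - s) \<partial>mu t) - k t * (x t)\<^sup>2 / 2 \<le> C t"
  using law_properties(5)[of t] unfolding C_def by simp

text \<open>The bound of \<open>mixlaw_put_upper\<close> divided by \<open>sqrt t\<close>, with the
  mean of S set to one. For \<beta> < 1 the last two terms vanish in the limit and x / sqrt t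
  remains, which matches the lower bound.\<close>

definition C_bound :: "real \<Rightarrow> real" where
  "C_bound t = x t / sqrt t + \<sigma>\<^sup>2 * sqrt t / 2
     + \<sigma> * (\<integral>s. sqrt s \<partial>mu t) * (\<integral>x. \<bar>x\<bar> \<partial>std_normal_distribution)"

lemma C_upper:
  assumes "t > 0"
  shows "C t / sqrt t \<le> C_bound t"
proof -
  interpret T: tempered_stable "mu t" \<alpha> "v t" by (rule tempered_stable_mu[OF assms])
  let ?R = "- (- (x t / sqrt t + \<sigma>\<^sup>2 * sqrt t / 2)) * (\<integral>s. s \<partial>mu t)
     + \<sigma> * (\<integral>s. sqrt s \<partial>mu t) * (\<integral>x. \<bar>x\<bar> \<partial>std_normal_distribution)"
  have "C t \<le> sqrt t * ?R"
    unfolding C_put[OF assms] law_def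
  proof (rule T.mixlaw_put_upper[OF T.mean_integrable])
    have "0 \<le> x t / sqrt t" "0 \<le> \<sigma>\<^sup>2 * sqrt t / 2" using assms x_pos[OF assms] by auto
    then show "- (x t / sqrt t + \<sigma>\<^sup>2 * sqrt t / 2) \<le> 0" by linarith
  qed (use assms h_bounds[OF assms] params in auto)
  then have "C t / sqrt t \<le> ?R" using assms by (simp add: divide_le_eq mult.commute)
  then show ?thesis by (simp add: C_bound_def T.mean_eq)
qed

lemma smile_price:
  assumes t: "t > 0"
  shows "smile (\<lambda>y. \<integral>\<omega>. max 0 (exp (f t \<omega>) - exp (y * sqrt t)) \<partial>M) t
    (- sqrt t * measure (law t) {0<..}) (implied_vol M f t)"
proof
  have eq: "(\<integral>\<omega>. max 0 (exp (f t \<omega>) - exp (y * sqrt t)) \<partial>M)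
      = (\<integral>z. max 0 (exp (sqrt t * z) - exp (y * sqrt t)) \<partial>law t)" for y
    by (rule law_f[OF t]) measurable
  show "t > 0" by fact
  show "0 < (\<integral>\<omega>. max 0 (exp (f t \<omega>) - exp (0 * sqrt t)) \<partial>M)"
    using call_price_bounds(1)[of "law t" "sqrt t"] law_properties[OF t] t unfolding eq by simp
  show "(\<integral>\<omega>. max 0 (exp (f t \<omega>) - exp (0 * sqrt t)) \<partial>M) < 1"
    using call_price_bounds(2)[of "law t" "sqrt t"] law_properties[OF t] t unfolding eq by simp
  show "((\<lambda>y. \<integral>\<omega>. max 0 (exp (f t \<omega>) - exp (y * sqrt t)) \<partial>M) has_real_derivative
      - sqrt t * measure (law t) {0<..}) (at 0)"
    unfolding eq using t by (intro call_price_has_derivative law_properties) auto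
qed (simp add: implied_vol_def)

lemma atm:
  assumes t: "t > 0"
  shows "atm_vol M f t > 0" "black_call t 0 (atm_vol M f t) = C t"
    "skew_term M f t = (std_normal_cdf (- (atm_vol M f t * sqrt t / 2)) - measure (law t) {0<..})
       / std_normal_density (atm_vol M f t * sqrt t / 2)"
proof -
  interpret I: smile "\<lambda>y. \<integral>\<omega>. max 0 (exp (f t \<omega>) - exp (y * sqrt t)) \<partial>M" t
    "- sqrt t * measure (law t) {0<..}" "implied_vol M f t"
    by (rule smile_price[OF t])
  show "atm_vol M f t > 0" using I.I_0(1) by (simp add: atm_vol_def)
  have "(\<integral>\<omega>. max 0 (exp (f t \<omega>) - exp (0 * sqrt t)) \<partial>M) = C t"
    unfolding C_def using law_f[OF t, of "\<lambda>z. max 0 (exp z - exp (0 * sqrt t))"] by simp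
  then show "black_call t 0 (atm_vol M f t) = C t" using I.I_0(2) by (simp add: atm_vol_def)
  have "skew_term M f t = (- sqrt t * measure (law t) {0<..} + sqrt t * std_normal_cdf (- implied_vol M f t 0 * sqrt t / 2))
     / (sqrt t * std_normal_density (implied_vol M f t 0 * sqrt t / 2))"
    unfolding skew_term_def by (rule DERIV_imp_deriv[OF I.I_has_derivative])
  also have "\<dots> = (sqrt t * (std_normal_cdf (- implied_vol M f t 0 * sqrt t / 2) - measure (law t) {0<..}))
     / (sqrt t * std_normal_density (implied_vol M f t 0 * sqrt t / 2))"
    by (simp add: algebra_simps)
  finally show "skew_term M f t = (std_normal_cdf (- (atm_vol M f t * sqrt t / 2)) - measure (law t) {0<..})
       / std_normal_density (atm_vol M f t * sqrt t / 2)"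
    using t by (simp add: atm_vol_def)
qed

lemma atm_limit:
  assumes "((\<lambda>t. C t / sqrt t) \<longlongrightarrow> l) (at_right 0)"
  shows "(atm_vol M f \<longlongrightarrow> sqrt (2 * pi) * l) (at_right 0)"
  using atm_vol_tendsto(1)[of "atm_vol M f" C l] atm assms by auto

text \<open>The at-the-money argument of the normal functions tends to 0, where the distribution
  function is 1/2 and the density 1 / sqrt (2 pi); hence the skew depends only on the limit of P (f
  t > 0).\<close>

lemma skew_limit:
  assumes C: "((\<lambda>t. C t / sqrt t) \<longlongrightarrow> l) (at_right 0)"
    and p: "((\<lambda>t. measure (law t) {0<..}) \<longlongrightarrow> p) (at_right 0)"
  shows "(skew_term M f \<longlongrightarrow> sqrt (2 * pi) * (1 / 2 - p)) (at_right 0)"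
proof -
  let ?y = "\<lambda>t. atm_vol M f t * sqrt t / 2"
  have y: "(?y \<longlongrightarrow> 0) (at_right 0)"
    using atm_vol_tendsto(2)[of "atm_vol M f" C l] atm C by auto
  have y': "((\<lambda>t. - ?y t) \<longlongrightarrow> 0) (at_right 0)" using tendsto_minus[OF y] by simp
  have "((\<lambda>t. std_normal_cdf (- ?y t)) \<longlongrightarrow> std_normal_cdf 0) (at_right 0)"
    by (rule isCont_tendsto_compose[OF isCont_std_normal_cdf y'])
  moreover have "((\<lambda>t. std_normal_density (?y t)) \<longlongrightarrow> std_normal_density 0) (at_right 0)"
    by (rule isCont_tendsto_compose[OF isCont_std_normal_density y])
  ultimately have "((\<lambda>t. (std_normal_cdf (- ?y t) - measure (law t) {0<..}) / std_normal_density (?y t))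
      \<longlongrightarrow> (std_normal_cdf 0 - p) / std_normal_density 0) (at_right 0)"
    by (intro tendsto_divide tendsto_diff p) (simp_all add: std_normal_density_def)
  moreover have "eventually (\<lambda>t. (std_normal_cdf (- ?y t) - measure (law t) {0<..}) / std_normal_density (?y t)
      = skew_term M f t) (at_right 0)"
    using eventually_at_right_less[of "0::real"] by eventually_elim (simp add: atm(3))
  ultimately have "(skew_term M f \<longlongrightarrow> (std_normal_cdf 0 - p) / std_normal_density 0) (at_right 0)"
    by (rule Lim_transform_eventually)
  then show ?thesis by (simp add: std_normal_density_def mult.commute)
qed

section \<open>Collapse of the subordinator for \<beta> < 1 and vanishing volatility\<close>

lemma v_at_top:
  assumes "\<beta> < 1" shows "filterlim v at_top (at_right 0)"
proof -
  have "filterlim (\<lambda>t. (kbar / (1 - \<alpha>)) * t powr (\<beta> - 1)) at_top (at_right 0)"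
    using assms params by (intro filterlim_tendsto_pos_mult_at_top[OF tendsto_const] powr_tendsto_at_top) auto
  then show ?thesis by (simp add: v_def[abs_def] k_def)
qed

lemma laplace_1_tendsto:
  assumes "\<beta> < 1" shows "((\<lambda>t. exp (- ts_exponent \<alpha> (v t) / v t)) \<longlongrightarrow> 1) (at_right 0)"
proof -
  have "((\<lambda>t. exp (- (ts_exponent \<alpha> (v t) / v t))) \<longlongrightarrow> exp (- 0)) (at_right 0)"
    using params by (intro tendsto_exp tendsto_minus filterlim_compose[OF ts_exponent_over_tendsto_0 v_at_top[OF assms]]) auto
  then show ?thesis by (simp only: minus_divide_left minus_zero exp_zero)
qed

lemma sqrt_mean_tendsto_0:
  assumes "\<beta> < 1" shows "((\<lambda>t. \<integral>s. sqrt s \<partial>mu t) \<longlongrightarrow> 0) (at_right 0)"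
proof (rule tendstoI)
  fix e :: real assume e: "e > 0"
  define \<epsilon> where "\<epsilon> = min 1 (e / 4)"
  have eps: "0 < \<epsilon>" "\<epsilon> \<le> 1" "2 * \<epsilon> < e" using e by (auto simp: \<epsilon>_def)
  have "((\<lambda>t. 2 * \<epsilon> + (1 - exp (- ts_exponent \<alpha> (v t) / v t)) / (\<epsilon> * (1 - exp (- \<epsilon>\<^sup>2))))
     \<longlongrightarrow> 2 * \<epsilon> + (1 - 1) / (\<epsilon> * (1 - exp (- \<epsilon>\<^sup>2)))) (at_right 0)"
    using eps by (intro tendsto_intros laplace_1_tendsto[OF assms]) auto
  then have "eventually (\<lambda>t. 2 * \<epsilon> + (1 - exp (- ts_exponent \<alpha> (v t) / v t)) / (\<epsilon> * (1 - exp (- \<epsilon>\<^sup>2))) < e) (at_right 0)"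
    using eps by (intro order_tendstoD(2)) auto
  then show "eventually (\<lambda>t. dist (\<integral>s. sqrt s \<partial>mu t) 0 < e) (at_right 0)"
    using eventually_at_right_less[of "0::real"]
  proof eventually_elim
    case (elim t)
    interpret T: tempered_stable "mu t" \<alpha> "v t" by (rule tempered_stable_mu[OF elim(2)])
    have "0 \<le> (\<integral>s. sqrt s \<partial>mu t)"
      using T.AE_pos by (intro integral_nonneg_AE) (auto elim!: eventually_mono)
    moreover have "(\<integral>s. sqrt s \<partial>mu t) \<le> 2 * \<epsilon> + (1 - exp (- ts_exponent \<alpha> (v t) / v t)) / (\<epsilon> * (1 - exp (- \<epsilon>\<^sup>2)))"
      by (rule T.sqrt_mean_le[OF eps(1,2)])
    ultimately show ?case using elim(1) by (simp add: dist_real_def)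
  qed
qed

lemma put_mean_tendsto_1:
  assumes "\<beta> < 1" shows "((\<lambda>t. \<integral>s. max 0 (1 - s) \<partial>mu t) \<longlongrightarrow> 1) (at_right 0)"
proof (rule tendsto_sandwich)
  show "((\<lambda>t. 1 - (1 - exp (- ts_exponent \<alpha> (v t) / v t)) / (1 - exp (- 1))) \<longlongrightarrow> 1) (at_right 0)"
  proof -
    have "((\<lambda>t. 1 - (1 - exp (- ts_exponent \<alpha> (v t) / v t)) / (1 - exp (- 1 :: real)))
        \<longlongrightarrow> 1 - (1 - 1) / (1 - exp (- 1))) (at_right 0)"
      by (intro tendsto_diff tendsto_divide tendsto_const laplace_1_tendsto assms) auto
    then show ?thesis by simp
  qed
  show "((\<lambda>_. 1) \<longlongrightarrow> 1) (at_right (0::real))" by simp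
  show "eventually (\<lambda>t. 1 - (1 - exp (- ts_exponent \<alpha> (v t) / v t)) / (1 - exp (- 1)) \<le> (\<integral>s. max 0 (1 - s) \<partial>mu t)) (at_right 0)"
    using eventually_at_right_less[of "0::real"]
    by eventually_elim (rule tempered_stable.put_on_mean_ge[OF tempered_stable_mu])
  show "eventually (\<lambda>t. (\<integral>s. max 0 (1 - s) \<partial>mu t) \<le> 1) (at_right 0)"
    using eventually_at_right_less[of "0::real"]
  proof eventually_elim
    case (elim t)
    interpret T: tempered_stable "mu t" \<alpha> "v t" by (rule tempered_stable_mu[OF elim])
    have "(\<integral>s. max 0 (1 - s) \<partial>mu t) \<le> (\<integral>s. 1 \<partial>mu t)"
      using T.mean_integrable T.AE_pos
      by (intro integral_mono_AE Bochner_Integration.integrable_max) (auto elim!: eventually_mono)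
    then show ?case using T.prob_UNIV by simp
  qed
qed

lemma x_sqrt_tendsto:
  assumes "1 / 2 + \<delta> \<ge> 0"
  shows "((\<lambda>t. x t / sqrt t) \<longlongrightarrow> (if \<delta> = - 1 / 2 then K else 0)) (at_right 0)"
proof -
  have "((\<lambda>t. K * t powr (1 / 2 + \<delta>)) \<longlongrightarrow> K * (if 1 / 2 + \<delta> = 0 then 1 else 0)) (at_right 0)"
    by (intro tendsto_mult tendsto_const powr_tendsto_indicator assms)
  from tendsto_at_right_0_cong[OF this x_over_sqrt[symmetric]]
  have "((\<lambda>t. x t / sqrt t) \<longlongrightarrow> K * (if 1 / 2 + \<delta> = 0 then 1 else 0)) (at_right 0)" .
  moreover have "K * (if 1 / 2 + \<delta> = 0 then 1 else 0) = (if \<delta> = - 1 / 2 then K else 0)"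
    by auto
  ultimately show ?thesis by (simp only:)
qed

lemma sqrt_tendsto: "((\<lambda>t::real. sqrt t) \<longlongrightarrow> 0) (at_right 0)"
  by real_asymp

lemma C_bound_tendsto:
  assumes "\<beta> < 1" "((\<lambda>t. x t / sqrt t) \<longlongrightarrow> l) (at_right 0)"
  shows "(C_bound \<longlongrightarrow> l) (at_right 0)"
proof -
  have "(C_bound \<longlongrightarrow> l + \<sigma>\<^sup>2 * 0 / 2 + \<sigma> * 0 * (\<integral>x. \<bar>x\<bar> \<partial>std_normal_distribution)) (at_right 0)"
    unfolding C_bound_def[abs_def] using assms
    by (intro tendsto_intros sqrt_mean_tendsto_0 sqrt_tendsto) auto
  then show ?thesis by simp
qed

lemma atm_vol_tendsto_0:
  assumes "\<beta> < 1" "- 1 / 2 < \<delta>"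
  shows "(atm_vol M f \<longlongrightarrow> 0) (at_right 0)"
proof -
  have "((\<lambda>t. x t / sqrt t) \<longlongrightarrow> 0) (at_right 0)"
    using x_sqrt_tendsto assms by simp
  note up = C_bound_tendsto[OF assms(1) this]
  have "((\<lambda>t. C t / sqrt t) \<longlongrightarrow> 0) (at_right 0)"
    by (rule tendsto_sandwich[OF _ _ tendsto_const up]; rule eventually_at_right_0I)
      (auto intro!: divide_nonneg_nonneg less_imp_le[OF C_pos] C_upper)
  from atm_limit[OF this] show ?thesis by simp
qed

section \<open>Drift correction, characteristic functions and weak limits\<close>

lemma h_sqrt_le:
  assumes "t > 0"
  shows "(x t - h t) / sqrt t \<le> kbar * K\<^sup>2 / 2 * t powr (\<beta> + 1 / 2 + 2 * \<delta>)"
proof -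
  \<comment> \<open>The exponent (\<beta> - 1) + 2 (1 + \<delta>) - 1/2 = \<beta> + 1/2 + 2 \<delta>
    collects k, x^2 and the division by \<open>sqrt t\<close>.\<close>
  have "(x t - h t) / sqrt t \<le> k t * (x t)\<^sup>2 / 2 / sqrt t"
    using h_bounds(1)[OF assms] assms by (intro divide_right_mono) auto
  also have "\<dots> = kbar * K\<^sup>2 / 2 * (t powr (\<beta> - 1) * (t powr (1 + \<delta>))\<^sup>2 / t powr (1 / 2))"
    using assms by (simp add: k_def x_def power_mult_distrib powr_half_sqrt)
  also have "(t powr (1 + \<delta>))\<^sup>2 = t powr (2 * (1 + \<delta>))" using assms by (simp add: powr_power mult.commute)
  also have "t powr (\<beta> - 1) * t powr (2 * (1 + \<delta>)) / t powr (1 / 2) = t powr (\<beta> + 1 / 2 + 2 * \<delta>)"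
    by (simp add: powr_add[symmetric] powr_diff[symmetric] algebra_simps)
  finally show ?thesis .
qed

lemma h_sqrt_tendsto:
  assumes "\<beta> + 1 / 2 + 2 * \<delta> > 0"
  shows "((\<lambda>t. (x t - h t) / sqrt t) \<longlongrightarrow> 0) (at_right 0)"
proof (rule tendsto_sandwich[OF _ _ tendsto_const])
  show "eventually (\<lambda>t. 0 \<le> (x t - h t) / sqrt t) (at_right 0)"
    by (rule eventually_at_right_0I) (use h_bounds in \<open>auto intro!: divide_nonneg_nonneg\<close>)
  have "((\<lambda>t. kbar * K\<^sup>2 / 2 * t powr (\<beta> + 1 / 2 + 2 * \<delta>)) \<longlongrightarrow> kbar * K\<^sup>2 / 2 * 0) (at_right 0)"
    by (intro tendsto_mult tendsto_const powr_tendsto_0 assms)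
  then show "((\<lambda>t. kbar * K\<^sup>2 / 2 * t powr (\<beta> + 1 / 2 + 2 * \<delta>)) \<longlongrightarrow> 0) (at_right 0)" by simp
qed (rule eventually_at_right_0I, rule h_sqrt_le)

lemma h_over_sqrt_tendsto:
  assumes "((\<lambda>t. x t / sqrt t) \<longlongrightarrow> l) (at_right 0)" "\<beta> + 1 / 2 + 2 * \<delta> > 0"
  shows "((\<lambda>t. h t / sqrt t) \<longlongrightarrow> l) (at_right 0)"
  using tendsto_diff[OF assms(1) h_sqrt_tendsto[OF assms(2)]] by (simp add: diff_divide_distrib)

text \<open>The point u^2 c^2 / 2 - i u b of \<open>char_mixlaw\<close> for the coefficients of
  \<open>law t\<close>: the characteristic function at u evaluates the Laplace transform of S t
  there.\<close>

definition z :: "real \<Rightarrow> real \<Rightarrow> complex" where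
  "z u t = Complex (u\<^sup>2 * \<sigma>\<^sup>2 / 2) (u * (x t / sqrt t + \<sigma>\<^sup>2 * sqrt t / 2))"

lemma z_tendsto:
  assumes "((\<lambda>t. x t / sqrt t) \<longlongrightarrow> l) (at_right 0)"
  shows "(z u \<longlongrightarrow> Complex (u\<^sup>2 * \<sigma>\<^sup>2 / 2) (u * l)) (at_right 0)"
proof -
  have "(z u \<longlongrightarrow> Complex (u\<^sup>2 * \<sigma>\<^sup>2 / 2) (u * (l + \<sigma>\<^sup>2 * 0 / 2))) (at_right 0)"
    unfolding z_def[abs_def] by (intro tendsto_Complex tendsto_intros assms sqrt_tendsto) auto
  then show ?thesis by simp
qed

lemma Re_z: "u \<noteq> 0 \<Longrightarrow> Re (z u t) > 0"
  using params by (simp add: z_def)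

lemma char_law:
  assumes "t > 0"
  shows "char (law t) u = iexp (u * (h t / sqrt t))
    * claplace (mu t) (z u t)"
proof -
  interpret T: tempered_stable "mu t" \<alpha> "v t" by (rule tempered_stable_mu[OF assms])
  have "- u * - (x t / sqrt t + \<sigma>\<^sup>2 * sqrt t / 2) = u * (x t / sqrt t + \<sigma>\<^sup>2 * sqrt t / 2)"
    by (simp add: algebra_simps)
  then show ?thesis unfolding law_def z_def T.char_mixlaw by (simp only:)
qed

lemma char_law_0: "t > 0 \<Longrightarrow> char (law t) 0 = 1"
  by (intro real_distribution.char_zero law_properties(1))

text \<open>Levy's continuity theorem along sequences; the limit has no atom at 0, so 0 is a
  continuity point of its distribution function. Convergence is asked for u different from 0 only,
  because at u = 0 the point \<open>z u t\<close> leaves the open half-plane of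
  \<open>claplace_eq\<close>.\<close>

lemma prob_limit:
  assumes R: "real_distribution R" "measure R {0} = 0"
    and char: "\<And>u. u \<noteq> 0 \<Longrightarrow> ((\<lambda>t. char (law t) u) \<longlongrightarrow> char R u) (at_right 0)"
  shows "((\<lambda>t. measure (law t) {0<..}) \<longlongrightarrow> measure R {0<..}) (at_right 0)"
    and "\<And>X. \<forall>i. X i > 0 \<Longrightarrow> X \<longlonglongrightarrow> 0 \<Longrightarrow> weak_conv_m (\<lambda>i. law (X i)) R"
proof -
  interpret R: real_distribution R by fact
  show w: "weak_conv_m (\<lambda>i. law (X i)) R" if X: "\<forall>i. X i > 0" "X \<longlonglongrightarrow> 0" for X
  proof (rule levy_continuity)
    show "real_distribution (law (X i))" for i using X by (intro law_properties) auto
    show "(\<lambda>i. char (law (X i)) u) \<longlonglongrightarrow> char R u" for u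
    proof (cases "u = 0")
      case True
      then show ?thesis using X by (simp add: char_law_0 R.char_zero)
    next
      case False
      have "filterlim X (at_right 0) sequentially"
        using X by (intro tendsto_imp_filterlim_at_right) auto
      from filterlim_compose[OF char[OF False] this] show ?thesis .
    qed
  qed fact
  have compl: "measure Q {0<..} = 1 - cdf Q 0" if "real_distribution Q" for Q
  proof -
    interpret Q: real_distribution Q by fact
    have "{0<..} = space Q - {..0}" by auto
    then show ?thesis using Q.prob_compl[of "{..0}"] by (simp add: cdf_def)
  qed
  show "((\<lambda>t. measure (law t) {0<..}) \<longlongrightarrow> measure R {0<..}) (at_right 0)"
    unfolding tendsto_at_iff_sequentially comp_def
  proof (intro allI impI)
    fix X :: "nat \<Rightarrow> real" assume X: "\<forall>i. X i \<in> {0<..} - {0}" "X \<longlonglongrightarrow> 0"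
    have "weak_conv_m (\<lambda>i. law (X i)) R" using X by (intro w) auto
    moreover have "isCont (cdf R) 0" using R.isCont_cdf R(2) by simp
    ultimately have "(\<lambda>i. cdf (law (X i)) 0) \<longlonglongrightarrow> cdf R 0"
      by (auto simp: weak_conv_m_def weak_conv_def comp_def)
    then have "(\<lambda>i. 1 - cdf (law (X i)) 0) \<longlonglongrightarrow> 1 - cdf R 0" by (intro tendsto_intros)
    moreover have "measure (law (X i)) {0<..} = 1 - cdf (law (X i)) 0" for i
      using X by (intro compl law_properties) auto
    ultimately show "(\<lambda>i. measure (law (X i)) {0<..}) \<longlonglongrightarrow> measure R {0<..}"
      by (simp add: compl[OF R(1)])
  qed
qed

lemma C_limit:
  assumes R: "real_distribution R" "measure R {0} = 0" "integrable R (\<lambda>y. y)"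
    and char: "\<And>u. u \<noteq> 0 \<Longrightarrow> ((\<lambda>t. char (law t) u) \<longlongrightarrow> char R u) (at_right 0)"
    and B: "\<And>t. 0 < t \<Longrightarrow> t \<le> 1 \<Longrightarrow> (\<integral>y. y\<^sup>2 \<partial>law t) \<le> B"
  shows "((\<lambda>t. C t / sqrt t) \<longlongrightarrow> (\<integral>y. max 0 (- y) \<partial>R)) (at_right 0)"
proof -
  \<comment> \<open>The approach to 0 is taken inside {0..1}, where the uniform second moment bound
    is available for every term of the sequence.\<close>
  have "((\<lambda>t. C t / sqrt t) \<longlongrightarrow> (\<integral>y. max 0 (- y) \<partial>R)) (at 0 within {0..1})"
    unfolding tendsto_at_iff_sequentially comp_def
  proof (intro allI impI)
    fix X :: "nat \<Rightarrow> real" assume "\<forall>i. X i \<in> {0..1} - {0}" and X0: "X \<longlonglongrightarrow> 0"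
    then have X: "\<And>i. X i > 0" "\<And>i. X i \<le> 1" by (auto simp: less_le)
    have "(\<lambda>i. (\<integral>y. max 0 (1 - exp (sqrt (X i) * y)) \<partial>law (X i)) / sqrt (X i)) \<longlonglongrightarrow> (\<integral>y. max 0 (- y) \<partial>R)"
    proof (rule expectation_put_tendsto)
      show "real_distribution (law (X i))" for i by (rule law_properties[OF X(1)])
      show "weak_conv_m (\<lambda>i. law (X i)) R" using prob_limit(2)[OF R(1,2) char] X X0 by blast
      show "integrable (law (X i)) (\<lambda>y. y\<^sup>2)" for i
      proof -
        interpret T: tempered_stable "mu (X i)" \<alpha> "v (X i)" by (rule tempered_stable_mu[OF X(1)])
        show ?thesis unfolding law_def
          by (rule T.mixlaw_second_moment(1)[OF T.mean_integrable T.second_moment_integrable])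
      qed
      show "(\<integral>y. y\<^sup>2 \<partial>law (X i)) \<le> B" for i by (rule B[OF X])
      show "(\<lambda>i. sqrt (X i)) \<longlonglongrightarrow> 0" using tendsto_real_sqrt[OF X0] by simp
    qed (use R X in auto)
    then show "(\<lambda>i. C (X i) / sqrt (X i)) \<longlonglongrightarrow> (\<integral>y. max 0 (- y) \<partial>R)"
      using C_put[OF X(1)] by simp
  qed
  then show ?thesis by (simp add: at_within_Icc_at_right)
qed

section \<open>Limits of volatility and skew for \<beta> at least 1\<close>

lemma k_le: "1 \<le> \<beta> \<Longrightarrow> 0 < t \<Longrightarrow> t \<le> 1 \<Longrightarrow> k t \<le> kbar"
  using params powr_le1[of "\<beta> - 1" t] mult_left_mono[of "t powr (\<beta> - 1)" 1 kbar] by (simp add: k_def)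

text \<open>The conditional mean is A + Bx (1 - s) - D s: drift correction, centred fluctuation and
  Gaussian compensator. The fluctuation has variance at most K^2 kbar t^(\<beta> + 2 \<delta>),
  bounded for t <= 1 because \<delta> >= - \<beta> / 2.\<close>

lemma second_moment_bound:
  assumes "1 \<le> \<beta>" "- \<beta> / 2 \<le> \<delta>" "0 < t" "t \<le> 1"
  shows "(\<integral>y. y\<^sup>2 \<partial>law t) \<le> 3 * ((kbar * K\<^sup>2 / 2)\<^sup>2 + K\<^sup>2 * kbar + \<sigma>^4 / 4 * (1 + kbar)) + \<sigma>\<^sup>2"
proof -
  interpret T: tempered_stable "mu t" \<alpha> "v t" by (rule tempered_stable_mu[OF assms(3)])
  define A where "A = (h t - x t) / sqrt t"
  define Bx where "Bx = x t / sqrt t"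
  define D where "D = \<sigma>\<^sup>2 * sqrt t / 2"
  have le1: "t powr e \<le> 1" if "e \<ge> 0" for e using assms that by (intro powr_le1) auto
  have ab: "h t / sqrt t + - (x t / sqrt t + \<sigma>\<^sup>2 * sqrt t / 2) * s = A + Bx * (1 - s) - D * s" for s
    by (simp add: A_def Bx_def D_def algebra_simps diff_divide_distrib)
  have "(\<integral>y. y\<^sup>2 \<partial>law t) = (\<integral>s. (A + Bx * (1 - s) - D * s)\<^sup>2 + \<sigma>\<^sup>2 * s \<partial>mu t)"
    unfolding law_def T.mixlaw_second_moment(2)[OF T.mean_integrable T.second_moment_integrable] ab ..
  also have "\<dots> \<le> (\<integral>s. 3 * (A\<^sup>2 + Bx\<^sup>2 * (1 - 2 * s + s\<^sup>2) + D\<^sup>2 * s\<^sup>2) + \<sigma>\<^sup>2 * s \<partial>mu t)"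
  proof (rule integral_mono)
    have "(\<lambda>s. (A + Bx * (1 - s) - D * s)\<^sup>2 + \<sigma>\<^sup>2 * s)
        = (\<lambda>s. (A + Bx)\<^sup>2 + (\<sigma>\<^sup>2 - 2 * (A + Bx) * (Bx + D)) * s + (Bx + D)\<^sup>2 * s\<^sup>2)"
      by (auto simp: fun_eq_iff power2_eq_square algebra_simps)
    then show "integrable (mu t) (\<lambda>s. (A + Bx * (1 - s) - D * s)\<^sup>2 + \<sigma>\<^sup>2 * s)"
      using T.mean_integrable T.second_moment_integrable by simp
    show "integrable (mu t) (\<lambda>s. 3 * (A\<^sup>2 + Bx\<^sup>2 * (1 - 2 * s + s\<^sup>2) + D\<^sup>2 * s\<^sup>2) + \<sigma>\<^sup>2 * s)"
      using T.mean_integrable T.second_moment_integrable by simp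
    fix s
    have "(p + q - r)\<^sup>2 \<le> 3 * (p\<^sup>2 + q\<^sup>2 + r\<^sup>2)" for p q r :: real
    proof -
      have "0 \<le> (p - q)\<^sup>2 + (p + r)\<^sup>2 + (q + r)\<^sup>2" by simp
      then show ?thesis by (simp add: power2_eq_square algebra_simps)
    qed
    from this[of A "Bx * (1 - s)" "D * s"]
    have "(A + Bx * (1 - s) - D * s)\<^sup>2 \<le> 3 * (A\<^sup>2 + Bx\<^sup>2 * (1 - s)\<^sup>2 + D\<^sup>2 * s\<^sup>2)"
      by (simp only: power_mult_distrib)
    also have "(1 - s)\<^sup>2 = 1 - 2 * s + s\<^sup>2" by (simp add: power2_eq_square algebra_simps)
    finally show "(A + Bx * (1 - s) - D * s)\<^sup>2 + \<sigma>\<^sup>2 * s \<le> 3 * (A\<^sup>2 + Bx\<^sup>2 * (1 - 2 * s + s\<^sup>2) + D\<^sup>2 * s\<^sup>2) + \<sigma>\<^sup>2 * s"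
      by (rule add_right_mono)
  qed
  also have "\<dots> = 3 * (A\<^sup>2 + Bx\<^sup>2 * ((\<integral>s. s\<^sup>2 \<partial>mu t) - 1) + D\<^sup>2 * (\<integral>s. s\<^sup>2 \<partial>mu t)) + \<sigma>\<^sup>2"
    using T.mean_integrable T.second_moment_integrable T.mean_eq T.prob_UNIV by simp
  \<comment> \<open>As the mean is 1, the integral of (1 - s)^2 is the second moment minus 1, hence
    at most k t.\<close>
  also have "\<dots> \<le> 3 * (A\<^sup>2 + Bx\<^sup>2 * k t + D\<^sup>2 * (1 + k t)) + \<sigma>\<^sup>2"
    using T.second_moment_le unfolding q_eq[OF assms(3)]
    by (intro add_right_mono mult_left_mono add_mono order_refl) auto
  also have "\<dots> \<le> 3 * ((kbar * K\<^sup>2 / 2)\<^sup>2 + K\<^sup>2 * kbar + \<sigma>^4 / 4 * (1 + kbar)) + \<sigma>\<^sup>2"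
  proof (intro add_right_mono mult_left_mono add_mono)
    have "\<bar>A\<bar> \<le> kbar * K\<^sup>2 / 2"
    proof -
      have "\<bar>A\<bar> = (x t - h t) / sqrt t" using h_bounds[OF assms(3)] assms(3) by (simp add: A_def abs_divide)
      also note h_sqrt_le[OF assms(3)]
      also have "kbar * K\<^sup>2 / 2 * t powr (\<beta> + 1 / 2 + 2 * \<delta>) \<le> kbar * K\<^sup>2 / 2 * 1"
        using assms params by (intro mult_left_mono le1) auto
      finally show ?thesis by simp
    qed
    from power_mono[OF this, of 2] show "A\<^sup>2 \<le> (kbar * K\<^sup>2 / 2)\<^sup>2" by simp
    have "Bx\<^sup>2 * k t = K\<^sup>2 * kbar * ((t powr (1 / 2 + \<delta>))\<^sup>2 * t powr (\<beta> - 1))"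
      unfolding Bx_def x_over_sqrt[OF assms(3)] by (simp add: k_def power_mult_distrib)
    also have "(t powr (1 / 2 + \<delta>))\<^sup>2 = t powr (2 * (1 / 2 + \<delta>))" using assms(3) by (simp add: powr_power mult.commute)
    also have "t powr (2 * (1 / 2 + \<delta>)) * t powr (\<beta> - 1) = t powr (\<beta> + 2 * \<delta>)"
      by (simp add: powr_add[symmetric] algebra_simps)
    also have "K\<^sup>2 * kbar * t powr (\<beta> + 2 * \<delta>) \<le> K\<^sup>2 * kbar * 1"
      using assms params by (intro mult_left_mono le1) auto
    finally show "Bx\<^sup>2 * k t \<le> K\<^sup>2 * kbar" by simp
    have "D\<^sup>2 = \<sigma>^4 / 4 * t" using assms(3) by (simp add: D_def power_divide power_mult_distrib)
    also have "\<dots> * (1 + k t) \<le> \<sigma>^4 / 4 * (1 + kbar)"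
      using assms k_le[of t] k_pos[OF assms(3)] mult_left_mono[of t 1 "\<sigma>^4 / 4"] by (intro mult_mono) auto
    finally show "D\<^sup>2 * (1 + k t) \<le> \<sigma>^4 / 4 * (1 + kbar)" .
  qed auto
  finally show ?thesis .
qed

text \<open>Common end of the cases \<beta> = 1 and \<beta> > 1. The mixing law m is general since
  for \<beta> > 1 it is a point mass; the centring condition makes the limit law mean zero, so its
  negative part has positive expectation.\<close>

lemma limits_of_weak_limit:
  assumes "1 \<le> \<beta>" "- \<beta> / 2 \<le> \<delta>" "mixing m" "integrable m (\<lambda>s. s)" "integrable m (\<lambda>s. s\<^sup>2)"
    and "a + b * (\<integral>s. s \<partial>m) = 0" "c > 0"
    and char: "\<And>u. u \<noteq> 0 \<Longrightarrow> ((\<lambda>t. char (law t) u) \<longlongrightarrow> char (mixlaw m a b c) u) (at_right 0)"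
  shows "\<exists>s0 > 0. (atm_vol M f \<longlongrightarrow> s0) (at_right 0)"
    "(skew_term M f \<longlongrightarrow> sqrt (2 * pi) * (1 / 2 - measure (mixlaw m a b c) {0<..})) (at_right 0)"
proof -
  interpret m: mixing m by fact
  note R = m.real_distribution_mixlaw[of a b c] m.mixlaw_no_atom[OF assms(7), of a b 0]
  have C: "((\<lambda>t. C t / sqrt t) \<longlongrightarrow> (\<integral>y. max 0 (- y) \<partial>mixlaw m a b c)) (at_right 0)"
    by (rule C_limit[OF R m.mixlaw_integrable_ident[OF assms(4,5)] char second_moment_bound[OF assms(1,2)]])
  have "0 < sqrt (2 * pi) * (\<integral>y. max 0 (- y) \<partial>mixlaw m a b c)"
    using m.mixlaw_negative_part_pos[OF assms(4-7)] by simp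
  then show "\<exists>s0 > 0. (atm_vol M f \<longlongrightarrow> s0) (at_right 0)"
    using atm_limit[OF C] by blast
  show "(skew_term M f \<longlongrightarrow> sqrt (2 * pi) * (1 / 2 - measure (mixlaw m a b c) {0<..})) (at_right 0)"
    by (rule skew_limit[OF C prob_limit(1)[OF R char]])
qed

text \<open>For \<beta> = 1 the parameter v t is constant, so the complex Laplace transform is one
  fixed continuous function and only its argument and the phase move. Both drift coefficients tend,
  up to sign, to the same a, nonzero exactly at \<delta> = -1/2.\<close>

lemma limits_beta_1:
  assumes b: "\<beta> = 1" and d: "- 1 / 2 \<le> \<delta>"
  defines "a \<equiv> (if \<delta> = - 1 / 2 then K else 0)"
  shows "\<exists>s0 > 0. (atm_vol M f \<longlongrightarrow> s0) (at_right 0)"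
    "(skew_term M f \<longlongrightarrow> sqrt (2 * pi) * (1 / 2 - measure (mixlaw (mu 1) a (- a) \<sigma>) {0<..})) (at_right 0)"
proof -
  interpret T1: tempered_stable "mu 1" \<alpha> "v 1" by (rule tempered_stable_mu) simp
  have v1: "v t = v 1" if "t > 0" for t using that unfolding v_def k_def by (simp add: b)
  have char: "((\<lambda>t. char (law t) u) \<longlongrightarrow> char (mixlaw (mu 1) a (- a) \<sigma>) u) (at_right 0)" if u: "u \<noteq> 0" for u
  proof -
    define z0 where "z0 = Complex (u\<^sup>2 * \<sigma>\<^sup>2 / 2) (u * a)"
    have x: "((\<lambda>t. x t / sqrt t) \<longlongrightarrow> a) (at_right 0)"
      unfolding a_def using d by (intro x_sqrt_tendsto) auto
    have h: "((\<lambda>t. h t / sqrt t) \<longlongrightarrow> a) (at_right 0)"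
      using d b by (intro h_over_sqrt_tendsto x) auto
    have z: "(z u \<longlongrightarrow> z0) (at_right 0)" unfolding z0_def by (rule z_tendsto[OF x])
    have Re0: "Re z0 > 0" using u params by (simp add: z0_def)
    have "Re (of_real (v 1) * z0) > - 1" using mult_pos_pos[OF T1.v_pos Re0] by simp
    from DERIV_isCont[OF cts_exponent_has_derivative[OF this]]
    have cont: "isCont (cts_exponent \<alpha>) (of_real (v 1) * z0)" .
    have "((\<lambda>t. iexp (u * (h t / sqrt t)) * exp (- cts_exponent \<alpha> (of_real (v 1) * z u t) / of_real (v 1)))
        \<longlongrightarrow> iexp (u * a) * exp (- cts_exponent \<alpha> (of_real (v 1) * z0) / of_real (v 1))) (at_right 0)"
      using T1.v_pos
      by (intro tendsto_intros h isCont_tendsto_compose[OF cont] z) auto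
    also have "iexp (u * a) * exp (- cts_exponent \<alpha> (of_real (v 1) * z0) / of_real (v 1))
        = char (mixlaw (mu 1) a (- a) \<sigma>) u"
      using T1.claplace_eq[OF Re0] unfolding T1.char_mixlaw by (simp add: z0_def)
    finally show ?thesis
    proof (rule tendsto_at_right_0_cong)
      fix t :: real assume t: "t > 0"
      show "iexp (u * (h t / sqrt t)) * exp (- cts_exponent \<alpha> (of_real (v 1) * z u t) / of_real (v 1)) = char (law t) u"
        unfolding char_law[OF t]
        using tempered_stable.claplace_eq[OF tempered_stable_mu[OF t] Re_z[OF u]] v1[OF t] by simp
    qed
  qed
  have m: "a + - a * (\<integral>s. s \<partial>mu 1) = 0" using T1.mean_eq by simp
  show "\<exists>s0 > 0. (atm_vol M f \<longlongrightarrow> s0) (at_right 0)"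
    "(skew_term M f \<longlongrightarrow> sqrt (2 * pi) * (1 / 2 - measure (mixlaw (mu 1) a (- a) \<sigma>) {0<..})) (at_right 0)"
    using limits_of_weak_limit[OF _ _ T1.mixing_axioms T1.mean_integrable T1.second_moment_integrable m params(4) char] b d
    by auto
qed

lemma mixing_return: "mixing (return borel (1::real))"
proof -
  interpret R: prob_space "return borel (1::real)" by (rule prob_space_return) simp
  show ?thesis by unfold_locales (auto simp: AE_return)
qed

lemma sqrt_k: "t > 0 \<Longrightarrow> sqrt (k t) = sqrt kbar * t powr ((\<beta> - 1) / 2)"
  by (simp add: k_def real_sqrt_mult powr_half_sqrt[symmetric] powr_powr)

lemma x_sqrt_k: 
  assumes "t > 0" shows "x t / sqrt t * sqrt (k t) = K * sqrt kbar * t powr (\<beta> / 2 + \<delta>)"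
proof -
  have "x t / sqrt t * sqrt (k t) = K * sqrt kbar * (t powr (1 / 2 + \<delta>) * t powr ((\<beta> - 1) / 2))"
    unfolding x_over_sqrt[OF assms] sqrt_k[OF assms] by simp
  also have "t powr (1 / 2 + \<delta>) * t powr ((\<beta> - 1) / 2) = t powr (\<beta> / 2 + \<delta>)"
    by (simp add: powr_add[symmetric] diff_divide_distrib add.commute)
  finally show ?thesis .
qed

text \<open>A central limit theorem for the subordinator: (S - 1) / sqrt k becomes standard normal,
  so the fluctuation x / sqrt t (1 - S) adds a variance d0^2 to \<sigma>^2. The centred normal limit
  is written as a mixture over the point mass at 1; its symmetry makes the skew vanish.\<close>

lemma limits_beta_gt_1:
  assumes b: "\<beta> > 1" and d: "- \<beta> / 2 \<le> \<delta>"
  shows "\<exists>s0 > 0. (atm_vol M f \<longlongrightarrow> s0) (at_right 0)" "(skew_term M f \<longlongrightarrow> 0) (at_right 0)"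
proof -
  \<comment> \<open>The limit of x / sqrt t times sqrt k, of order t^(\<beta>/2 + \<delta>); nonzero
    only on the boundary \<delta> = - \<beta> / 2.\<close>
  define d0 where "d0 = K * sqrt kbar * (if \<beta> / 2 + \<delta> = 0 then 1 else 0)"
  define s0 where "s0 = sqrt (\<sigma>\<^sup>2 + d0\<^sup>2)"
  have s0: "s0 > 0" "s0\<^sup>2 = \<sigma>\<^sup>2 + d0\<^sup>2" using params by (auto simp: s0_def intro!: add_pos_nonneg)
  let ?m = "return borel (1::real)"
  interpret m: mixing ?m by (rule mixing_return)
  have sk0: "((\<lambda>t. sqrt (k t)) \<longlongrightarrow> 0) (at_right 0)"
  proof -
    have "((\<lambda>t. sqrt kbar * t powr ((\<beta> - 1) / 2)) \<longlongrightarrow> sqrt kbar * 0) (at_right 0)"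
      using b by (intro tendsto_mult tendsto_const powr_tendsto_0) auto
    from tendsto_at_right_0_cong[OF this sqrt_k[symmetric]] show ?thesis by simp
  qed
  have skx: "((\<lambda>t. x t / sqrt t * sqrt (k t)) \<longlongrightarrow> d0) (at_right 0)"
  proof -
    have "((\<lambda>t. K * sqrt kbar * t powr (\<beta> / 2 + \<delta>)) \<longlongrightarrow> d0) (at_right 0)"
      unfolding d0_def using d by (intro tendsto_mult tendsto_const powr_tendsto_indicator) auto
    from tendsto_at_right_0_cong[OF this x_sqrt_k[symmetric]] show ?thesis .
  qed
  have char: "((\<lambda>t. char (law t) u) \<longlongrightarrow> char (mixlaw ?m 0 0 s0) u) (at_right 0)" if u: "u \<noteq> 0" for u
  proof -
    \<comment> \<open>\<open>z u t\<close> itself may diverge when \<delta> < -1/2, but sqrt k times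
      it converges. The argument w = v z of the exponent then tends to 0, and w^2 / v = y^2 / (1 -
      \<alpha>) stays finite.\<close>
    define y where "y t = of_real (sqrt (k t)) * z u t" for t
    have y: "(y \<longlongrightarrow> Complex 0 (u * d0)) (at_right 0)"
    proof -
      have "((\<lambda>t. Complex (sqrt (k t) * (u\<^sup>2 * \<sigma>\<^sup>2 / 2)) (u * (x t / sqrt t * sqrt (k t)) + u * (sqrt (k t) * (\<sigma>\<^sup>2 * sqrt t / 2))))
        \<longlongrightarrow> Complex (0 * (u\<^sup>2 * \<sigma>\<^sup>2 / 2)) (u * d0 + u * (0 * (\<sigma>\<^sup>2 * 0 / 2)))) (at_right 0)"
        by (intro tendsto_Complex tendsto_intros sk0 skx sqrt_tendsto) auto
      moreover have "y = (\<lambda>t. Complex (sqrt (k t) * (u\<^sup>2 * \<sigma>\<^sup>2 / 2)) (u * (x t / sqrt t * sqrt (k t)) + u * (sqrt (k t) * (\<sigma>\<^sup>2 * sqrt t / 2))))"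
        by (auto simp: y_def z_def fun_eq_iff complex_eq_iff algebra_simps)
      ultimately show ?thesis by simp
    qed
    define w where "w t = of_real (v t) * z u t" for t
    have w_eq: "w t = y t * of_real (sqrt (k t)) / of_real (1 - \<alpha>)" if "t > 0" for t
    proof -
      have "complex_of_real (v t) = of_real (sqrt (k t)) * of_real (sqrt (k t)) / of_real (1 - \<alpha>)"
        using k_pos[OF that] by (simp add: v_def flip: of_real_mult)
      then show ?thesis by (simp add: w_def y_def)
    qed
    have pos: "eventually (\<lambda>t::real. t > 0) (at_right 0)" by (rule eventually_at_right_less)
    have w0: "(w \<longlongrightarrow> 0) (at_right 0)"
    proof -
      have "((\<lambda>t. y t * of_real (sqrt (k t)) / of_real (1 - \<alpha>)) \<longlongrightarrow> Complex 0 (u * d0) * of_real 0 / of_real (1 - \<alpha>)) (at_right 0)"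
        using params by (intro tendsto_intros y sk0) auto
      from tendsto_at_right_0_cong[OF this w_eq[symmetric]] show ?thesis by simp
    qed
    have wne: "w t \<noteq> 0" if "t > 0" for t
      using Re_z[OF u, of t] k_pos[OF that] params by (auto simp: w_def v_def)
    have "filterlim w (at 0) (at_right 0)"
      unfolding filterlim_at using w0 pos wne by (auto elim!: eventually_mono)
    from filterlim_compose[OF cts_exponent_Peano this]
    have eps: "((\<lambda>t. (cts_exponent \<alpha> (w t) - w t) / (w t)\<^sup>2) \<longlongrightarrow> of_real ((\<alpha> - 1) / 2)) (at_right 0)" .
    define E where "E t = \<i> * of_real (u * (h t / sqrt t)) - cts_exponent \<alpha> (w t) / of_real (v t)" for t
    \<comment> \<open>Second-order expansion of the log-characteristic function: the linear part of
      the exponent is z, whose imaginary part cancels h / sqrt t up to (x - h) / sqrt t and a term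
      of order \<open>sqrt t\<close>; the rest is y^2 / (1 - \<alpha>) times a convergent
      quotient.\<close>
    have E_eq: "E t = \<i> * of_real (- (u * ((x t - h t) / sqrt t)) - u * (\<sigma>\<^sup>2 * sqrt t / 2)) - of_real (u\<^sup>2 * \<sigma>\<^sup>2 / 2)
        - (y t)\<^sup>2 / of_real (1 - \<alpha>) * ((cts_exponent \<alpha> (w t) - w t) / (w t)\<^sup>2)" if t: "t > 0" for t
    proof -
      have vt: "v t > 0" using k_pos[OF t] params by (simp add: v_def)
      have "(y t)\<^sup>2 = of_real (k t) * (z u t)\<^sup>2"
        using k_pos[OF t] by (simp add: y_def power_mult_distrib flip: of_real_power)
      moreover have "k t = v t * (1 - \<alpha>)" using params by (simp add: v_def)
      ultimately have "(y t)\<^sup>2 / of_real (1 - \<alpha>) = (w t)\<^sup>2 / of_real (v t)"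
        using vt params by (simp add: w_def power2_eq_square)
      then have "(y t)\<^sup>2 / of_real (1 - \<alpha>) * ((cts_exponent \<alpha> (w t) - w t) / (w t)\<^sup>2)
          = (cts_exponent \<alpha> (w t) - w t) / of_real (v t)" using wne[OF t] by simp
      also have "\<dots> = cts_exponent \<alpha> (w t) / of_real (v t) - z u t"
        using vt by (simp add: w_def diff_divide_distrib)
      finally have "cts_exponent \<alpha> (w t) / of_real (v t)
          = z u t + (y t)\<^sup>2 / of_real (1 - \<alpha>) * ((cts_exponent \<alpha> (w t) - w t) / (w t)\<^sup>2)" by simp
      moreover have "z u t = of_real (u\<^sup>2 * \<sigma>\<^sup>2 / 2) + \<i> * of_real (u * (x t / sqrt t + \<sigma>\<^sup>2 * sqrt t / 2))"
        by (simp add: z_def complex_eq_iff)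
      ultimately show ?thesis unfolding E_def
        by (simp add: algebra_simps diff_divide_distrib)
    qed
    have L1: "((\<lambda>t. \<i> * of_real (- (u * ((x t - h t) / sqrt t)) - u * (\<sigma>\<^sup>2 * sqrt t / 2)) - of_real (u\<^sup>2 * \<sigma>\<^sup>2 / 2)
        - (y t)\<^sup>2 / of_real (1 - \<alpha>) * ((cts_exponent \<alpha> (w t) - w t) / (w t)\<^sup>2))
       \<longlongrightarrow> \<i> * of_real (- (u * 0) - u * (\<sigma>\<^sup>2 * 0 / 2)) - of_real (u\<^sup>2 * \<sigma>\<^sup>2 / 2)
        - (Complex 0 (u * d0))\<^sup>2 / of_real (1 - \<alpha>) * of_real ((\<alpha> - 1) / 2)) (at_right 0)"
      using params b d by (intro tendsto_intros h_sqrt_tendsto sqrt_tendsto y eps) auto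
    have eqv: "\<i> * of_real (- (u * 0) - u * (\<sigma>\<^sup>2 * 0 / 2)) - of_real (u\<^sup>2 * \<sigma>\<^sup>2 / 2)
        - (Complex 0 (u * d0))\<^sup>2 / of_real (1 - \<alpha>) * of_real ((\<alpha> - 1) / 2) = of_real (- (u\<^sup>2 * s0\<^sup>2 / 2))"
    proof -
      have "(Complex 0 (u * d0))\<^sup>2 = of_real (- (u\<^sup>2 * d0\<^sup>2))" by (simp add: complex_eq_iff power2_eq_square)
      then have "(Complex 0 (u * d0))\<^sup>2 / of_real (1 - \<alpha>) * of_real ((\<alpha> - 1) / 2)
          = of_real (- (u\<^sup>2 * d0\<^sup>2) / (1 - \<alpha>) * ((\<alpha> - 1) / 2))" by simp
      also have "- (u\<^sup>2 * d0\<^sup>2) / (1 - \<alpha>) * ((\<alpha> - 1) / 2) = u\<^sup>2 * d0\<^sup>2 / 2"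
        using params by (simp add: field_simps)
      finally show ?thesis unfolding s0(2) by (simp add: algebra_simps add_divide_distrib)
    qed
    have "(E \<longlongrightarrow> of_real (- (u\<^sup>2 * s0\<^sup>2 / 2))) (at_right 0)"
      using tendsto_at_right_0_cong[OF L1 E_eq[symmetric]] unfolding eqv .
    then have L2: "((\<lambda>t. exp (E t)) \<longlongrightarrow> exp (of_real (- (u\<^sup>2 * s0\<^sup>2 / 2)))) (at_right 0)" by (rule tendsto_exp)
    have char_E: "exp (E t) = char (law t) u" if t: "t > 0" for t
      unfolding char_law[OF t] E_def w_def
      using tempered_stable.claplace_eq[OF tempered_stable_mu[OF t] Re_z[OF u]] by (simp add: exp_add[symmetric])
    have eqv2: "char (mixlaw ?m 0 0 s0) u = exp (of_real (- (u\<^sup>2 * s0\<^sup>2 / 2)))"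
    proof -
      have "claplace ?m (Complex (u\<^sup>2 * s0\<^sup>2 / 2) (- u * 0)) = exp (- Complex (u\<^sup>2 * s0\<^sup>2 / 2) (- u * 0) * of_real 1)"
        unfolding claplace_def by (rule integral_return) auto
      moreover have "- Complex (u\<^sup>2 * s0\<^sup>2 / 2) (- u * 0) * of_real 1 = of_real (- (u\<^sup>2 * s0\<^sup>2 / 2))"
        by (simp add: complex_eq_iff)
      ultimately have cl: "claplace ?m (Complex (u\<^sup>2 * s0\<^sup>2 / 2) (- u * 0)) = exp (of_real (- (u\<^sup>2 * s0\<^sup>2 / 2)))"
        by (simp only:)
      show ?thesis unfolding m.char_mixlaw cl by simp
    qed
    show ?thesis using tendsto_at_right_0_cong[OF L2 char_E] unfolding eqv2 .
  qed
  have i: "integrable ?m (\<lambda>s. s)" "integrable ?m (\<lambda>s. s\<^sup>2)"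
    by (rule m.bounded_integrable[of _ 1]; simp add: AE_return)+
  have z: "0 + 0 * (\<integral>s. s \<partial>?m) = (0::real)" by simp
  show "\<exists>s0 > 0. (atm_vol M f \<longlongrightarrow> s0) (at_right 0)"
    using limits_of_weak_limit(1)[OF _ d mixing_return i z s0(1) char] b by auto
  show "(skew_term M f \<longlongrightarrow> 0) (at_right 0)"
    using limits_of_weak_limit(2)[OF _ d mixing_return i z s0(1) char] b m.mixlaw_median_0[OF s0(1)] by auto
qed

lemma skew_negative:
  assumes "\<beta> = 1" "\<delta> = - 1 / 2"
  shows "\<exists>\<xi> < 0. (skew_term M f \<longlongrightarrow> \<xi>) (at_right 0)"
proof -
  interpret T1: tempered_stable "mu 1" \<alpha> "v 1" by (rule tempered_stable_mu) simp
  \<comment> \<open>Division by \<sigma> > 0 preserves the sign of the mixture and normalises its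
    Gaussian coefficient to 1, the form of \<open>mixlaw_median_pos\<close>.\<close>
  define c where "c = K / \<sigma>"
  have Kc: "K = \<sigma> * c" and c: "c > 0" using params K_pos by (auto simp: c_def)
  have "measure (mixlaw (mu 1) K (- K) \<sigma>) {0<..} = measure (mixlaw (mu 1) c (- c) 1) {0<..}"
  proof -
    have "K + - K * s + \<sigma> * sqrt s * y \<in> {0<..} \<longleftrightarrow> c + - c * s + 1 * sqrt s * y \<in> {0<..}" for s y
    proof -
      have "K + - K * s + \<sigma> * sqrt s * y = \<sigma> * (c + - c * s + 1 * sqrt s * y)"
        by (simp add: Kc algebra_simps)
      then show ?thesis using params by (simp only: greaterThan_iff zero_less_mult_iff) auto
    qed
    then show ?thesis by (simp only: T1.mixlaw_prob(2)[OF borel_open[OF open_greaterThan]])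
  qed
  then have "1 / 2 < measure (mixlaw (mu 1) K (- K) \<sigma>) {0<..}" using T1.mixlaw_median_pos[OF c] by simp
  then have "sqrt (2 * pi) * (1 / 2 - measure (mixlaw (mu 1) K (- K) \<sigma>) {0<..}) < 0"
    by (intro mult_pos_neg) auto
  moreover have "(skew_term M f \<longlongrightarrow> sqrt (2 * pi) * (1 / 2 - measure (mixlaw (mu 1) K (- K) \<sigma>) {0<..})) (at_right 0)"
    using limits_beta_1(2)[OF assms(1)] assms(2) by simp
  ultimately show ?thesis by blast
qed

lemma skew_tendsto_0_beta_1:
  assumes "\<beta> = 1" "- 1 / 2 < \<delta>"
  shows "(skew_term M f \<longlongrightarrow> 0) (at_right 0)"
proof -
  interpret T1: tempered_stable "mu 1" \<alpha> "v 1" by (rule tempered_stable_mu) simp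
  show ?thesis using limits_beta_1(2)[OF assms(1)] assms(2) T1.mixlaw_median_0[OF params(4)] by simp
qed

section \<open>Lower price bounds: the critical \<delta> for \<beta> < 1 and exploding
  volatility\<close>

lemma C_lower_div:
  assumes "t > 0"
  shows "x t / sqrt t * ((\<integral>s. max 0 (1 - s) \<partial>mu t) - k t * x t / 2) \<le> C t / sqrt t"
proof -
  have "x t / sqrt t * ((\<integral>s. max 0 (1 - s) \<partial>mu t) - k t * x t / 2)
      = (x t * (\<integral>s. max 0 (1 - s) \<partial>mu t) - k t * (x t)\<^sup>2 / 2) / sqrt t"
    by (simp add: power2_eq_square algebra_simps diff_divide_distrib)
  also have "\<dots> \<le> C t / sqrt t" using C_lower[OF assms] assms by (intro divide_right_mono) auto
  finally show ?thesis .
qed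

text \<open>The product k x has order t^(\<beta> + \<delta>). Its vanishing makes the correction k x
  / 2 small against the put expectation when the latter tends to 1.\<close>

lemma kx_tendsto:
  assumes "\<beta> + \<delta> > 0"
  shows "((\<lambda>t. k t * x t) \<longlongrightarrow> 0) (at_right 0)"
proof -
  have "((\<lambda>t. kbar * K * t powr (\<beta> + \<delta>)) \<longlongrightarrow> kbar * K * 0) (at_right 0)"
    by (intro tendsto_mult tendsto_const powr_tendsto_0 assms)
  moreover have "kbar * K * t powr (\<beta> + \<delta>) = k t * x t" for t
  proof -
    have "t powr (\<beta> + \<delta>) = t powr (\<beta> - 1) * t powr (1 + \<delta>)" by (simp add: powr_add[symmetric])
    then show ?thesis by (simp add: k_def x_def)
  qed
  ultimately show ?thesis by simp
qed

text \<open>The subordinator collapses to 0, so f t / sqrt t tends to the constant K > 0 and P (f t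
  > 0) tends to 1, whence the skew sqrt (2 pi) (1/2 - 1). The price over \<open>sqrt t\<close> is
  squeezed to the same K.\<close>

lemma limits_delta_half:
  assumes "\<beta> < 1" "\<delta> = - 1 / 2" "\<beta> + \<delta> > 0"
  shows "\<exists>s0 > 0. (atm_vol M f \<longlongrightarrow> s0) (at_right 0)" "(skew_term M f \<longlongrightarrow> - sqrt (pi / 2)) (at_right 0)"
proof -
  have xK: "((\<lambda>t. x t / sqrt t) \<longlongrightarrow> K) (at_right 0)"
    using x_sqrt_tendsto assms by simp
  have C: "((\<lambda>t. C t / sqrt t) \<longlongrightarrow> K) (at_right 0)"
  proof (rule tendsto_sandwich[OF _ _ _ C_bound_tendsto[OF assms(1) xK]])
    have "((\<lambda>t. x t / sqrt t * ((\<integral>s. max 0 (1 - s) \<partial>mu t) - k t * x t / 2)) \<longlongrightarrow> K * (1 - 0 / 2)) (at_right 0)"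
      by (intro tendsto_intros xK put_mean_tendsto_1 kx_tendsto assms) auto
    then show "((\<lambda>t. x t / sqrt t * ((\<integral>s. max 0 (1 - s) \<partial>mu t) - k t * x t / 2)) \<longlongrightarrow> K) (at_right 0)" by simp
  qed (rule eventually_at_right_0I, erule C_lower_div C_upper)+
  show "\<exists>s0 > 0. (atm_vol M f \<longlongrightarrow> s0) (at_right 0)"
    using atm_limit[OF C] K_pos by (intro exI[of _ "sqrt (2 * pi) * K"]) auto
  let ?R = "return borel K"
  interpret R0: prob_space ?R by (rule prob_space_return) simp
  interpret R: real_distribution ?R by unfold_locales auto
  have char: "((\<lambda>t. char (law t) u) \<longlongrightarrow> char ?R u) (at_right 0)" for u
  proof -
    have h: "((\<lambda>t. h t / sqrt t) \<longlongrightarrow> K) (at_right 0)"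
      using assms by (intro h_over_sqrt_tendsto xK) auto
    note z = z_tendsto[OF xK, of u]
    have "((\<lambda>t. claplace (mu t) (z u t) - 1) \<longlongrightarrow> 0) (at_right 0)"
    proof (rule Lim_null_comparison)
      show "eventually (\<lambda>t. norm (claplace (mu t) (z u t) - 1) \<le> 2 * sqrt (norm (z u t)) * (\<integral>s. sqrt s \<partial>mu t)) (at_right 0)"
      proof (rule eventually_at_right_0I)
        fix t :: real assume t: "t > 0"
        interpret T: tempered_stable "mu t" \<alpha> "v t" by (rule tempered_stable_mu[OF t])
        show "norm (claplace (mu t) (z u t) - 1) \<le> 2 * sqrt (norm (z u t)) * (\<integral>s. sqrt s \<partial>mu t)"
          by (rule T.claplace_minus_1[OF T.sqrt_integrable[OF T.mean_integrable]]) (simp add: z_def)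
      qed
      have "((\<lambda>t. 2 * sqrt (norm (z u t)) * (\<integral>s. sqrt s \<partial>mu t))
        \<longlongrightarrow> 2 * sqrt (norm (Complex (u\<^sup>2 * \<sigma>\<^sup>2 / 2) (u * K))) * 0) (at_right 0)"
        by (intro tendsto_intros z sqrt_mean_tendsto_0 assms)
      then show "((\<lambda>t. 2 * sqrt (norm (z u t)) * (\<integral>s. sqrt s \<partial>mu t)) \<longlongrightarrow> 0) (at_right 0)" by simp
    qed
    then have "((\<lambda>t. iexp (u * (h t / sqrt t)) * (claplace (mu t) (z u t) - 1 + 1)) \<longlongrightarrow> iexp (u * K) * (0 + 1)) (at_right 0)"
      by (intro tendsto_intros h) auto
    then have L: "((\<lambda>t. iexp (u * (h t / sqrt t)) * claplace (mu t) (z u t)) \<longlongrightarrow> iexp (u * K)) (at_right 0)" by simp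
    have eqv: "char ?R u = iexp (u * K)"
      unfolding char_def by (rule integral_return) auto
    show ?thesis using tendsto_at_right_0_cong[OF L char_law[symmetric]] unfolding eqv .
  qed
  have "measure ?R {0} = 0" "measure ?R {0<..} = 1"
    using K_pos by (auto simp: measure_return)
  then have "((\<lambda>t. measure (law t) {0<..}) \<longlongrightarrow> 1) (at_right 0)"
    using prob_limit(1)[OF R.real_distribution_axioms _ char] by simp
  from skew_limit[OF C this]
  have "(skew_term M f \<longlongrightarrow> sqrt (2 * pi) * (1 / 2 - 1)) (at_right 0)" .
  moreover have "sqrt (2 * pi) * (1 / 2 - 1) = - sqrt (pi / 2)"
  proof -
    have "sqrt (2 * pi) = sqrt (2\<^sup>2 * (pi / 2))" by simp
    also have "\<dots> = 2 * sqrt (pi / 2)" by (simp only: real_sqrt_mult real_sqrt_power) simp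
    finally show ?thesis by simp
  qed
  ultimately show "(skew_term M f \<longlongrightarrow> - sqrt (pi / 2)) (at_right 0)" by (simp only:)
qed

lemma atm_at_top:
  assumes "filterlim G at_top (at_right 0)" "eventually (\<lambda>t. G t \<le> C t / sqrt t) (at_right 0)"
  shows "filterlim (atm_vol M f) at_top (at_right 0)"
proof (rule filterlim_at_top_mono)
  show "filterlim (\<lambda>t. sqrt (2 * pi) * G t) at_top (at_right 0)"
    by (intro filterlim_tendsto_pos_mult_at_top[OF tendsto_const] assms) auto
  show "eventually (\<lambda>t. sqrt (2 * pi) * G t \<le> atm_vol M f t) (at_right 0)"
    using assms(2) eventually_at_right_less[of "0::real"]
  proof eventually_elim
    case (elim t)
    have "sqrt (2 * pi) * G t \<le> sqrt (2 * pi) * (C t / sqrt t)" using elim by (intro mult_left_mono) auto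
    also have "\<dots> \<le> atm_vol M f t" using atm[OF elim(2)] elim by (intro atm_vol_ge) auto
    finally show ?case .
  qed
qed

lemma atm_vol_at_top_beta_lt_1:
  assumes "\<beta> < 1" "\<delta> < - 1 / 2" "\<beta> + \<delta> > 0"
  shows "filterlim (atm_vol M f) at_top (at_right 0)"
proof (rule atm_at_top)
  have "((\<lambda>t. K * ((\<integral>s. max 0 (1 - s) \<partial>mu t) - k t * x t / 2)) \<longlongrightarrow> K * (1 - 0 / 2)) (at_right 0)"
    by (intro tendsto_intros put_mean_tendsto_1 kx_tendsto assms) auto
  then show "filterlim (\<lambda>t. K * ((\<integral>s. max 0 (1 - s) \<partial>mu t) - k t * x t / 2) * t powr (1 / 2 + \<delta>)) at_top (at_right 0)"
    using K_pos assms by (intro filterlim_tendsto_pos_mult_at_top[where c="K * (1 - 0 / 2)"] powr_tendsto_at_top) auto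
  show "eventually (\<lambda>t. K * ((\<integral>s. max 0 (1 - s) \<partial>mu t) - k t * x t / 2) * t powr (1 / 2 + \<delta>) \<le> C t / sqrt t) (at_right 0)"
    using eventually_at_right_less[of "0::real"]
  proof eventually_elim
    case (elim t)
    then show ?case using C_lower_div[OF elim] unfolding x_over_sqrt[OF elim] by (simp only: mult_ac)
  qed
qed

text \<open>Here the put expectation itself tends to be as small as sqrt k, so the bound c sqrt k is
  used and sqrt k is factored out. The price over \<open>sqrt t\<close> is at least a multiple of
  t^(\<beta>/2 + \<delta>), provided e = sqrt k x, of order t^((\<beta> + 1)/2 + \<delta>),
  vanishes.\<close>

lemma atm_vol_at_top_beta_ge_1:
  assumes "1 \<le> \<beta>" "\<delta> < - \<beta> / 2" "(\<beta> + 1) / 2 + \<delta> > 0"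
  shows "filterlim (atm_vol M f) at_top (at_right 0)"
proof (rule atm_at_top)
  define V where "V = kbar / (1 - \<alpha>)"
  define c where "c = 1 / (16 * exp 2 * (1 + sqrt (V / (1 - \<alpha>)))\<^sup>2)"
  have "V > 0" using params by (simp add: V_def)
  then have "1 + sqrt (V / (1 - \<alpha>)) > 0" using params by (intro add_pos_nonneg) auto
  then have c: "c > 0" by (simp add: c_def)
  define e where "e t = sqrt kbar * K * t powr ((\<beta> + 1) / 2 + \<delta>)" for t
  have e0: "(e \<longlongrightarrow> 0) (at_right 0)"
  proof -
    have "((\<lambda>t. sqrt kbar * K * t powr ((\<beta> + 1) / 2 + \<delta>)) \<longlongrightarrow> sqrt kbar * K * 0) (at_right 0)"
      by (intro tendsto_mult tendsto_const powr_tendsto_0 assms)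
    then show ?thesis by (simp add: e_def[abs_def])
  qed
  have "((\<lambda>t. K * sqrt kbar * (c - e t / 2)) \<longlongrightarrow> K * sqrt kbar * (c - 0 / 2)) (at_right 0)"
    by (intro tendsto_intros e0) auto
  then show "filterlim (\<lambda>t. K * sqrt kbar * (c - e t / 2) * t powr (\<beta> / 2 + \<delta>)) at_top (at_right 0)"
    using K_pos params c assms
    by (intro filterlim_tendsto_pos_mult_at_top[where c="K * sqrt kbar * (c - 0 / 2)"] powr_tendsto_at_top) auto
  have "eventually (\<lambda>t::real. 0 < t \<and> t < 1) (at_right 0)"
    by (intro eventually_conj eventually_at_right_less eventually_at_right_real[THEN eventually_mono, of 0 1]) auto
  then show "eventually (\<lambda>t. K * sqrt kbar * (c - e t / 2) * t powr (\<beta> / 2 + \<delta>) \<le> C t / sqrt t) (at_right 0)"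
  proof eventually_elim
    case (elim t)
    then have t: "t > 0" by simp
    interpret T: tempered_stable "mu t" \<alpha> "v t" by (rule tempered_stable_mu[OF t])
    \<comment> \<open>For \<beta> >= 1 and t < 1 the parameter v is bounded, which makes the
      constant c independent of t.\<close>
    have "v t \<le> V" using k_le[OF assms(1) t] elim params by (simp add: v_def V_def divide_right_mono)
    from T.put_on_mean_ge_sqrt[OF this] have put: "sqrt (k t) * c \<le> (\<integral>s. max 0 (1 - s) \<partial>mu t)"
      by (simp add: q_eq[OF t] c_def)
    have ex: "sqrt (k t) * x t = e t"
    proof -
      have "sqrt (k t) * x t = sqrt kbar * K * (t powr ((\<beta> - 1) / 2) * t powr (1 + \<delta>))"
        unfolding sqrt_k[OF t] x_def by simp
      also have "t powr ((\<beta> - 1) / 2) * t powr (1 + \<delta>) = t powr ((\<beta> + 1) / 2 + \<delta>)"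
        by (simp add: powr_add[symmetric] field_simps)
      finally show ?thesis by (simp add: e_def)
    qed
    have "k t * x t = sqrt (k t) * (sqrt (k t) * x t)" using k_pos[OF t] by simp
    then have kx: "k t * x t = sqrt (k t) * e t" by (simp only: ex)
    have "K * sqrt kbar * (c - e t / 2) * t powr (\<beta> / 2 + \<delta>) = x t / sqrt t * sqrt (k t) * (c - e t / 2)"
      unfolding x_sqrt_k[OF t] by simp
    also have "\<dots> = x t / sqrt t * (sqrt (k t) * c - k t * x t / 2)"
    proof -
      have "sqrt (k t) * c - sqrt (k t) * e t / 2 = sqrt (k t) * (c - e t / 2)" by (simp add: algebra_simps)
      then show ?thesis unfolding kx by (simp only: mult.assoc)
    qed
    also have "\<dots> \<le> x t / sqrt t * ((\<integral>s. max 0 (1 - s) \<partial>mu t) - k t * x t / 2)"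
      using put x_pos[OF t] t by (intro mult_left_mono diff_right_mono) auto
    also have "\<dots> \<le> C t / sqrt t" by (rule C_lower_div[OF t])
    finally show ?case .
  qed
qed

end

section \<open>From admissibility to the exponent conditions\<close>

lemma ats_delta_lower_ge: "- \<beta> \<le> ats_delta_lower \<alpha> \<beta>"
  by (simp add: ats_delta_lower_def)

text \<open>For \<alpha> > 0, (1 - \<beta> (1 - \<alpha>)) / \<alpha> <= (\<beta> + 1) / 2
  rearranges to \<beta> >= 1. For \<alpha> = 0 the upper bound on \<beta> forces \<beta> = 1, where
  both sides equal -1.\<close>

lemma ats_delta_lower_half:
  assumes "0 \<le> \<alpha>" "\<alpha> < 1" "1 \<le> \<beta>" "\<beta> \<le> 1 / (1 - \<alpha> / 2)"
  shows "- (\<beta> + 1) / 2 \<le> ats_delta_lower \<alpha> \<beta>"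
proof (cases "\<alpha> = 0")
  case True
  then show ?thesis using assms by (simp add: ats_delta_lower_def)
next
  case False
  then have a: "\<alpha> > 0" using assms by simp
  have "(2 - \<alpha>) * 1 \<le> (2 - \<alpha>) * \<beta>" using assms by (intro mult_left_mono) auto
  then have "2 * (1 - \<beta> * (1 - \<alpha>)) \<le> (\<beta> + 1) * \<alpha>" by (simp add: algebra_simps)
  then have "(1 - \<beta> * (1 - \<alpha>)) / \<alpha> \<le> (\<beta> + 1) / 2" using a by (simp add: field_simps)
  then have "min \<beta> ((1 - \<beta> * (1 - \<alpha>)) / \<alpha>) \<le> (\<beta> + 1) / 2" by (rule min.coboundedI2)
  then show ?thesis using False unfolding ats_delta_lower_def by (simp only: if_False; linarith)
qed

theorem theorem5p1:
  fixes M :: "'a measure" and S :: "real \<Rightarrow> 'a \<Rightarrow> real" and g :: "'a \<Rightarrow> real"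
    and \<alpha> kbar sigmabar etabar \<beta> \<delta> :: real
    and sigma_hat xi_hat :: "real \<Rightarrow> real"
  assumes "0 \<le> \<alpha>" and "\<alpha> < 1"
    and "kbar > 0" and "sigmabar > 0" and "etabar > 0"
    and "ats_admissible \<alpha> \<beta> \<delta>"
    and "ats_model M \<alpha> kbar \<beta> S g"
    and "sigma_hat = atm_vol M (ats_f M sigmabar etabar \<delta> S g)"
    and "xi_hat = skew_term M (ats_f M sigmabar etabar \<delta> S g)"
  shows
    "((\<beta> < 1 \<and> - min (1 / 2) \<beta> < \<delta> \<and> \<delta> \<le> 0) \<or> (\<beta> = 0 \<and> \<delta> = 0) \<longrightarrow>
        (sigma_hat \<longlongrightarrow> 0) (at_right 0)) \<and>
     (ats_delta_lower \<alpha> \<beta> < \<delta> \<and> \<delta> < - (1 / 2) * max \<beta> 1 \<longrightarrow>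
        filterlim sigma_hat at_top (at_right 0)) \<and>
     (1 \<le> \<beta> \<and> - \<beta> / 2 \<le> \<delta> \<and> \<delta> \<le> 0 \<and> (\<beta>, \<delta>) \<noteq> (1, - 1 / 2) \<longrightarrow>
        (\<exists>sigma0 > 0. (sigma_hat \<longlongrightarrow> sigma0) (at_right 0)) \<and>
        (xi_hat \<longlongrightarrow> 0) (at_right 0)) \<and>
     (\<beta> < 1 \<and> \<delta> = - 1 / 2 \<longrightarrow>
        (\<exists>sigma0 > 0. (sigma_hat \<longlongrightarrow> sigma0) (at_right 0)) \<and>
        (xi_hat \<longlongrightarrow> - sqrt (pi / 2)) (at_right 0)) \<and>
     (\<beta> = 1 \<and> \<delta> = - 1 / 2 \<longrightarrow>
        (\<exists>sigma0 > 0. (sigma_hat \<longlongrightarrow> sigma0) (at_right 0)) \<and>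
        (\<exists>xi0 < 0. (xi_hat \<longlongrightarrow> xi0) (at_right 0)))"
proof -
  interpret ats M \<alpha> kbar \<beta> S g sigmabar etabar \<delta>
    using assms by (intro ats.intro ats_axioms.intro) auto
  have adm: "(\<beta> = 0 \<and> \<delta> = 0) \<or> (0 \<le> \<beta> \<and> \<beta> \<le> 1 / (1 - \<alpha> / 2) \<and> ats_delta_lower \<alpha> \<beta> < \<delta> \<and> \<delta> \<le> 0)"
    using assms(6) by (simp add: ats_admissible_def)
  \<comment> \<open>A negative \<delta> rules out the exceptional pair (0, 0), so the lower bound on
    \<delta> is in force.\<close>
  have pos: "\<beta> + \<delta> > 0" if "\<delta> < 0" using adm ats_delta_lower_ge[of \<beta> \<alpha>] that by auto
  show ?thesis unfolding assms(8,9)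
  proof (intro conjI impI)
    assume "(\<beta> < 1 \<and> - min (1 / 2) \<beta> < \<delta> \<and> \<delta> \<le> 0) \<or> (\<beta> = 0 \<and> \<delta> = 0)"
    then show "(atm_vol M f \<longlongrightarrow> 0) (at_right 0)" by (intro atm_vol_tendsto_0) auto
  next
    assume c: "ats_delta_lower \<alpha> \<beta> < \<delta> \<and> \<delta> < - (1 / 2) * max \<beta> 1"
    show "filterlim (atm_vol M f) at_top (at_right 0)"
    proof (cases "\<beta> < 1")
      case True
      then show ?thesis using c pos by (intro atm_vol_at_top_beta_lt_1) auto
    next
      case False
      then have "\<beta> \<le> 1 / (1 - \<alpha> / 2)" using adm by auto
      then have "- (\<beta> + 1) / 2 \<le> ats_delta_lower \<alpha> \<beta>" using assms False by (intro ats_delta_lower_half) auto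
      then have "(\<beta> + 1) / 2 + \<delta> > 0" using c by (simp add: field_simps)
      then show ?thesis using c False by (intro atm_vol_at_top_beta_ge_1) auto
    qed
  next
    assume c: "1 \<le> \<beta> \<and> - \<beta> / 2 \<le> \<delta> \<and> \<delta> \<le> 0 \<and> (\<beta>, \<delta>) \<noteq> (1, - 1 / 2)"
    show "\<exists>sigma0 > 0. (atm_vol M f \<longlongrightarrow> sigma0) (at_right 0)"
      using c limits_beta_1(1) limits_beta_gt_1(1) by (cases "\<beta> = 1") auto
    show "(skew_term M f \<longlongrightarrow> 0) (at_right 0)"
      using c skew_tendsto_0_beta_1 limits_beta_gt_1(2) by (cases "\<beta> = 1") auto
  next
    assume c: "\<beta> < 1 \<and> \<delta> = - 1 / 2"
    then show "\<exists>sigma0 > 0. (atm_vol M f \<longlongrightarrow> sigma0) (at_right 0)"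
      "(skew_term M f \<longlongrightarrow> - sqrt (pi / 2)) (at_right 0)"
      using limits_delta_half pos by auto
  next
    assume c: "\<beta> = 1 \<and> \<delta> = - 1 / 2"
    then show "\<exists>sigma0 > 0. (atm_vol M f \<longlongrightarrow> sigma0) (at_right 0)"
      "\<exists>xi0 < 0. (skew_term M f \<longlongrightarrow> xi0) (at_right 0)"
      using limits_beta_1(1) skew_negative by auto
  qed
qed

end
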